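(* Let $d\ge 3$ and $N\ge 3$ be integers. Let $G$ be a finite abelian group with a linear, faithful and liftable action on a smooth $(N-2)$-fold of degree $d$ in $\mathbb{P}^{N-1}$. Assume that there exists a decomposition $G=G_1\oplus G_2$ such that $G_1$ is cyclic and $G_2$ has order coprime to $d-1$. Then there exist an integer $N_0\le N$ and a simple polynomial $F_0(x_1,\dots,x_{N_0})$ of degree $d$ such that $F_0$ has at most one component of type $T_{\ge 2}$ and $G$ is isomorphic to a subgroup of the group $G_{F_0}$ of diagonal automorphisms of $V(F_0)$. If moreover $\gcd(|G|,d-1)\ne 1$, then $F_0$ can be chosen with exactly one component of type $T_{\ge 2}$.
   Context: All varieties are over $\mathbb{C}$. A homogeneous polynomial $F(x_1,\dots,x_k)$ ($k\ge 1$) is called smooth if the only common zero in $\mathbb{C}^k$ of $\partial F/\partial x_1,\dots,\partial F/\partial x_k$ is the origin. For a homogeneous polynomial $F$ of degree $d$ in $x_1,\dots,x_N$, $V(F)\subset\mathbb{P}^{N-1}$ is the hypersurface it defines; it is called an $(N-2)$-fold of degree $d$, and it is smooth when $F$ is smooth. A linear action of $G$ on $V(F)$ is a homomorphism $G\to\mathrm{PGL}(N,\mathbb{C})$ whose image preserves $V(F)$; it is faithful if this homomorphism is injective. The action is liftable if there is a group homomorphism $G\to\mathrm{GL}(N,\mathbb{C})$ whose composition with the projection $\mathrm{GL}(N,\mathbb{C})\to\mathrm{PGL}(N,\mathbb{C})$ is the given homomorphism. For $d\ge 3$, $k\ge 1$, a polynomial is of type $K_k$ if, up to naming of variables, it is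 $x_1^{d-1}x_2+x_2^{d-1}x_3+\cdots+x_k^{d-1}x_1$ (so type $K_1$ is $x_1^d$), and of type $T_k$ if, up to naming of variables, it is $x_1^{d-1}x_2+\cdots+x_{k-1}^{d-1}x_k+x_k^d$. Type $T_{\ge 2}$ means type $T_k$ for some $k\ge 2$. A simple polynomial is a sum of finitely many polynomials of type $K$ or $T$ (its components) of the same degree $d$ in pairwise disjoint sets of variables, which together are all the variables. Simple polynomials of degree at least $3$ are smooth. For a smooth polynomial $F(x_1,\dots,x_n)$, $G_F\subset\mathrm{PGL}(n,\mathbb{C})$ denotes the group of classes $\mathrm{diag}[\lambda_1:\cdots:\lambda_n]$ of invertible diagonal matrices $\mathrm{diag}(\lambda_1,\dots,\lambda_n)$ such that $F(\lambda_1x_1,\dots,\lambda_nx_n)=\lambda F(x_1,\dots,x_n)$ for some $\lambda\in\mathbb{C}^\times$. *)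

theory Defs
  imports
    Complex_Main
    "HOL-Library.Poly_Mapping"
    "HOL-Library.Disjoint_Sets"
    "HOL-Algebra.Coset"
    "HOL-Algebra.Elementary_Groups"
    "Jordan_Normal_Form.Matrix"
begin

section \<open>Polynomials over the complex numbers in variables indexed by naturals\<close>

text \<open>The variables $x_1, \ldots, x_n$ are represented by the indices $0, \ldots, n-1$. A polynomial maps
  each exponent vector to its coefficient; multiplication is the convolution product of
  \<^theory>\<open>HOL-Library.Poly_Mapping\<close>.\<close>

type_synonym cpoly = "(nat \<Rightarrow>\<^sub>0 nat) \<Rightarrow>\<^sub>0 complex"

definition Const :: "complex \<Rightarrow> cpoly" where
  "Const c = Poly_Mapping.single 0 c"

definition Var :: "nat \<Rightarrow> cpoly" where
  "Var i = Poly_Mapping.single (Poly_Mapping.single i 1) 1"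

definition vars :: "cpoly \<Rightarrow> nat set" where
  "vars P = (\<Union>m \<in> Poly_Mapping.keys P. Poly_Mapping.keys m)"

definition homogeneous :: "nat \<Rightarrow> cpoly \<Rightarrow> bool" where
  "homogeneous d P \<longleftrightarrow>
     (\<forall>m \<in> Poly_Mapping.keys P. (\<Sum>i \<in> Poly_Mapping.keys m. Poly_Mapping.lookup m i) = d)"

definition eval_poly :: "(nat \<Rightarrow> complex) \<Rightarrow> cpoly \<Rightarrow> complex" where
  "eval_poly a P = (\<Sum>m \<in> Poly_Mapping.keys P.
     Poly_Mapping.lookup P m * (\<Prod>i \<in> Poly_Mapping.keys m. a i ^ Poly_Mapping.lookup m i))"

definition subst_poly :: "(nat \<Rightarrow> cpoly) \<Rightarrow> cpoly \<Rightarrow> cpoly" where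
  "subst_poly s P = (\<Sum>m \<in> Poly_Mapping.keys P.
     Const (Poly_Mapping.lookup P m) * (\<Prod>i \<in> Poly_Mapping.keys m. s i ^ Poly_Mapping.lookup m i))"

text \<open>The difference of exponent vectors below truncates when $x_i$ does not occur in the monomial,
  but then the coefficient is zero.\<close>

definition partial_deriv :: "nat \<Rightarrow> cpoly \<Rightarrow> cpoly" where
  "partial_deriv i P = (\<Sum>m \<in> Poly_Mapping.keys P.
     Poly_Mapping.single (m - Poly_Mapping.single i 1)
       (Poly_Mapping.lookup P m * of_nat (Poly_Mapping.lookup m i)))"

definition form :: "nat \<Rightarrow> nat \<Rightarrow> cpoly \<Rightarrow> bool" where
  "form n d F \<longleftrightarrow> vars F \<subseteq> {..<n} \<and> homogeneous d F"

definition smooth :: "nat \<Rightarrow> cpoly \<Rightarrow> bool" where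
  "smooth n F \<longleftrightarrow>
     (\<forall>v \<in> carrier_vec n. (\<forall>i<n. eval_poly (\<lambda>j. v $ j) (partial_deriv i F) = 0) \<longrightarrow> v = 0\<^sub>v n)"

section \<open>Hypersurfaces and linear actions\<close>

text \<open>A point of projective space is the set of all its vectors of homogeneous coordinates.\<close>

definition proj_point :: "complex vec \<Rightarrow> complex vec set" where
  "proj_point v = {c \<cdot>\<^sub>v v |c. c \<noteq> 0}"

definition hypersurface :: "nat \<Rightarrow> cpoly \<Rightarrow> complex vec set set" where
  "hypersurface n F =
     {proj_point v |v. v \<in> carrier_vec n \<and> v \<noteq> 0\<^sub>v n \<and> eval_poly (\<lambda>j. v $ j) F = 0}"

definition GL :: "nat \<Rightarrow> complex mat monoid" where
  "GL n = units_of (ring_mat TYPE(complex) n ())"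

definition scalars :: "nat \<Rightarrow> complex mat set" where
  "scalars n = {c \<cdot>\<^sub>m 1\<^sub>m n |c. c \<noteq> 0}"

definition PGL :: "nat \<Rightarrow> complex mat set monoid" where
  "PGL n = GL n Mod scalars n"

definition to_PGL :: "nat \<Rightarrow> complex mat \<Rightarrow> complex mat set" where
  "to_PGL n A = scalars n #>\<^bsub>GL n\<^esub> A"

text \<open>An element of $\mathrm{PGL}(n)$ is a class of matrices; it is applied to a projective point by
  applying all representatives to all representatives.\<close>

definition proj_apply :: "complex mat set \<Rightarrow> complex vec set \<Rightarrow> complex vec set" where
  "proj_apply C p = {A *\<^sub>v v |A v. A \<in> C \<and> v \<in> p}"

definition linear_action ::
  "('a, 'b) monoid_scheme \<Rightarrow> nat \<Rightarrow> cpoly \<Rightarrow> ('a \<Rightarrow> complex mat set) \<Rightarrow> bool" where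
  "linear_action G n F \<rho> \<longleftrightarrow> \<rho> \<in> hom G (PGL n) \<and>
     (\<forall>g \<in> carrier G. proj_apply (\<rho> g) ` hypersurface n F = hypersurface n F)"

definition faithful :: "('a, 'b) monoid_scheme \<Rightarrow> ('a \<Rightarrow> complex mat set) \<Rightarrow> bool" where
  "faithful G \<rho> \<longleftrightarrow> inj_on \<rho> (carrier G)"

definition liftable ::
  "('a, 'b) monoid_scheme \<Rightarrow> nat \<Rightarrow> ('a \<Rightarrow> complex mat set) \<Rightarrow> bool" where
  "liftable G n \<rho> \<longleftrightarrow> (\<exists>\<sigma> \<in> hom G (GL n). \<forall>g \<in> carrier G. to_PGL n (\<sigma> g) = \<rho> g)"

definition direct_sum_decomp :: "('a, 'b) monoid_scheme \<Rightarrow> 'a set \<Rightarrow> 'a set \<Rightarrow> bool" where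
  "direct_sum_decomp G G1 G2 \<longleftrightarrow> subgroup G1 G \<and> subgroup G2 G \<and>
     G1 \<inter> G2 = {\<one>\<^bsub>G\<^esub>} \<and> G1 <#>\<^bsub>G\<^esub> G2 = carrier G"

section \<open>Simple polynomials and their diagonal automorphisms\<close>

definition type_K :: "nat \<Rightarrow> nat \<Rightarrow> cpoly \<Rightarrow> bool" where
  "type_K d k P \<longleftrightarrow> k \<ge> 1 \<and> (\<exists>x. inj_on x {..<k} \<and>
     P = (\<Sum>i<k. Var (x i) ^ (d - 1) * Var (x ((i + 1) mod k))))"

definition type_T :: "nat \<Rightarrow> nat \<Rightarrow> cpoly \<Rightarrow> bool" where
  "type_T d k P \<longleftrightarrow> k \<ge> 1 \<and> (\<exists>x. inj_on x {..<k} \<and>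
     P = (\<Sum>i<k - 1. Var (x i) ^ (d - 1) * Var (x (i + 1))) + Var (x (k - 1)) ^ d)"

text \<open>The components of a simple polynomial in $n$ variables form a set: having nonempty pairwise
  disjoint sets of variables, they are pairwise distinct.\<close>

definition simple_components :: "nat \<Rightarrow> nat \<Rightarrow> cpoly \<Rightarrow> cpoly set \<Rightarrow> bool" where
  "simple_components d n F C \<longleftrightarrow> finite C \<and>
     (\<forall>P \<in> C. \<exists>k. type_K d k P \<or> type_T d k P) \<and>
     disjoint_family_on vars C \<and> (\<Union>P \<in> C. vars P) = {..<n} \<and> F = (\<Sum>P \<in> C. P)"

definition T_ge2_components :: "nat \<Rightarrow> cpoly set \<Rightarrow> cpoly set" where
  "T_ge2_components d C = {P \<in> C. \<exists>k\<ge>2. type_T d k P}"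

definition diag_aut_group :: "nat \<Rightarrow> cpoly \<Rightarrow> complex mat set monoid" where
  "diag_aut_group n F = (PGL n)\<lparr>carrier :=
     {to_PGL n (mat_diag n l) |l. (\<forall>i<n. l i \<noteq> 0) \<and>
        (\<exists>c. c \<noteq> 0 \<and> subst_poly (\<lambda>i. Const (l i) * Var i) F = Const c * F)}\<rparr>"

definition iso_to_subgroup :: "('a, 'b) monoid_scheme \<Rightarrow> ('c, 'd) monoid_scheme \<Rightarrow> bool" where
  "iso_to_subgroup G H \<longleftrightarrow> (\<exists>K. subgroup K H \<and> G \<cong> H\<lparr>carrier := K\<rparr>)"

end

theory Submission
  imports Defs
    "HOL-Computational_Algebra.Fundamental_Theorem_Algebra"
    "HOL-Number_Theory.Cong"
    "HOL-Algebra.Multiplicative_Group"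
    "HOL-Algebra.Sylow"
    "Jordan_Normal_Form.Determinant"
begin

text \<open>
  The lift makes $G$ act by commuting matrices of finite order, so there is a basis of common
  eigenvectors, with characters $\lambda_1, \ldots, \lambda_N$. Because $F$ is smooth, an invariant
  hypersurface forces $F(gx) = \chi(g) F(x)$ for a character $\chi$ (lemma
  \<open>proportional_of_zeros\<close>), and smoothness at the points of a coordinate axis or of a coordinate
  plane gives relations between the characters: every $u$ has an \<^emph>\<open>arrow\<close> $u \to w$ with
  $\lambda_u^{d-1}\lambda_w = \chi$, and two different $u, v$ cannot be served by a single
  target $w$ on the subgroup where $\lambda_u = \lambda_v$ (lemma \<open>eigencharacters\<close>). These two facts
  are all that is used about $F$; the rest concerns finite abelian groups.

  Let $H$ be the part of $G$ of order prime to $d-1$, and let $(d-1)^s$ be the least power of $d-1$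
  that kills the remaining part. On $H$ raising to the power $d-1$ is injective, so the arrows permute
  the set $X$ of distinct restrictions $\lambda_i|_H$: this permutation $\varphi$ is a disjoint union of
  cycles, and $H$ acts faithfully through them. On an element $c$ of the other part whose order does
  not divide $(d-1)^{s-1}$, an arrow lowers the order of the suitably normalised eigenvalue, so a chain of
  $s$ arrows passes through $s$ indices at which this eigenvalue is not $1$, whereas the indices at which it
  is $1$ still represent all of $X$. Hence $N \ge |X| + s$; and if equality holds, the two targets
  available at the end of the chain produce a fixed point of $\varphi$ (lemma \<open>card_bound\<close>).
  So there is room in $N$ variables for the cycles of $\varphi$ together with a path of type $T_{s+1}$,
  whose last variable takes the place of a fixed point of $\varphi$ if there is one.

  Let $F_0$ be this sum of cycles and one path. It suffices to find, separately for every prime $p$, a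
  homomorphism from $G$ to the diagonal symmetries of $F_0$ whose kernel has no element of order
  $p$, because suitable powers of these homomorphisms multiply to an injective one (lemma
  \<open>combine_primewise_characters\<close>). For $p$ dividing $d-1$ the elements of order $p$ all lie in
  the cyclic factor, and one character acting along the path detects them (lemma \<open>path_character\<close>).
  For the other primes the cycles are used. There the given action satisfies the relations only up to
  $\chi$, which need not be a $d$-th power; after passing to the $p$-part it can be twisted into an action
  that preserves $F_0$ exactly, taking as origin a point on a cycle on which a certain
  multiplicity of $p$ is minimal (lemma \<open>cycle_characters\<close>).

  If $|G|$ is prime to $d-1$, no path is needed and $G$ acts on the cycles of $X$ as it is given.
\<close>

section \<open>Polynomials along lines\<close>

definition monom_eval :: "(nat \<Rightarrow> 'b::comm_semiring_1) \<Rightarrow> (nat \<Rightarrow>\<^sub>0 nat) \<Rightarrow> 'b" where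
  "monom_eval s m = (\<Prod>i \<in> Poly_Mapping.keys m. s i ^ Poly_Mapping.lookup m i)"

lemma monom_eval_superset:
  assumes "finite S" "Poly_Mapping.keys m \<subseteq> S"
  shows "monom_eval s m = (\<Prod>i \<in> S. s i ^ Poly_Mapping.lookup m i)"
  unfolding monom_eval_def
  by (rule prod.mono_neutral_left) (use assms in \<open>auto simp: in_keys_iff\<close>)

lemma eval_poly_superset:
  assumes "finite S" "Poly_Mapping.keys P \<subseteq> S"
  shows "eval_poly a P = (\<Sum>m \<in> S. Poly_Mapping.lookup P m * monom_eval a m)"
  unfolding eval_poly_def monom_eval_def
  by (rule sum.mono_neutral_left) (use assms in \<open>auto simp: in_keys_iff\<close>)

lemma eval_poly_add: "eval_poly a (P + Q) = eval_poly a P + eval_poly a Q"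
proof -
  let ?S = "Poly_Mapping.keys P \<union> Poly_Mapping.keys Q"
  have "Poly_Mapping.keys (P + Q) \<subseteq> ?S" by (rule keys_add)
  then show ?thesis
    using eval_poly_superset[of ?S "P + Q" a] eval_poly_superset[of ?S P a] eval_poly_superset[of ?S Q a]
    by (simp add: lookup_add sum.distrib ring_distribs)
qed

lemma eval_poly_zero: "eval_poly a 0 = 0"
  by (simp add: eval_poly_def)

lemma eval_poly_sum: "eval_poly a (\<Sum>x\<in>A. f x) = (\<Sum>x\<in>A. eval_poly a (f x))"
  by (induction A rule: infinite_finite_induct) (auto simp: eval_poly_add eval_poly_zero)

lemma eval_poly_single: "eval_poly a (Poly_Mapping.single m c) = c * monom_eval a m"
  using eval_poly_superset[of "{m}" "Poly_Mapping.single m c" a] by (simp split: if_splits)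

lemma eval_poly_cong:
  assumes "\<And>i. i \<in> vars P \<Longrightarrow> a i = b i"
  shows "eval_poly a P = eval_poly b P"
  unfolding eval_poly_def
  by (intro sum.cong refl arg_cong2[where f = "(*)"] prod.cong)
    (use assms in \<open>auto simp: vars_def intro!: arg_cong2[where f = "(^)"]\<close>)

lemma eval_poly_homogeneous:
  assumes "homogeneous d P"
  shows "eval_poly (\<lambda>i. c * a i) P = c ^ d * eval_poly a P"
proof -
  have "(\<Prod>i\<in>Poly_Mapping.keys m. (c * a i) ^ Poly_Mapping.lookup m i)
      = c ^ d * (\<Prod>i\<in>Poly_Mapping.keys m. a i ^ Poly_Mapping.lookup m i)"
    if "m \<in> Poly_Mapping.keys P" for m
  proof -
    have "(\<Sum>i\<in>Poly_Mapping.keys m. Poly_Mapping.lookup m i) = d"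
      using that assms by (simp add: homogeneous_def)
    then show ?thesis
      by (simp add: power_mult_distrib prod.distrib flip: power_sum)
  qed
  then show ?thesis
    by (simp add: eval_poly_def sum_distrib_left mult_ac)
qed

definition line_poly :: "(nat \<Rightarrow> complex) \<Rightarrow> (nat \<Rightarrow> complex) \<Rightarrow> cpoly \<Rightarrow> complex poly" where
  "line_poly a v P = (\<Sum>m \<in> Poly_Mapping.keys P.
     Polynomial.smult (Poly_Mapping.lookup P m) (\<Prod>i \<in> Poly_Mapping.keys m. [:a i, v i:] ^ Poly_Mapping.lookup m i))"

lemma poly_line_poly: "poly (line_poly a v P) t = eval_poly (\<lambda>i. a i + t * v i) P"
  by (simp add: line_poly_def eval_poly_def poly_sum poly_prod)

lemma coeff_mult_top:
  fixes p q :: "'b::comm_semiring_0 poly"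
  assumes "degree p \<le> m" "degree q \<le> n"
  shows "Polynomial.coeff (p * q) (m + n) = Polynomial.coeff p m * Polynomial.coeff q n"
proof -
  have "Polynomial.coeff (p * q) (m + n) = (\<Sum>i\<le>m + n. Polynomial.coeff p i * Polynomial.coeff q (m + n - i))"
    by (rule coeff_mult)
  also have "\<dots> = (\<Sum>i\<in>{m}. Polynomial.coeff p i * Polynomial.coeff q (m + n - i))"
  proof (rule sum.mono_neutral_right)
    show "\<forall>i\<in>{..m + n} - {m}. Polynomial.coeff p i * Polynomial.coeff q (m + n - i) = 0"
    proof
      fix i assume "i \<in> {..m + n} - {m}"
      then have "i > m \<or> m + n - i > n" by auto
      then show "Polynomial.coeff p i * Polynomial.coeff q (m + n - i) = 0"
        using assms coeff_eq_0[of p i] coeff_eq_0[of q "m + n - i"] by force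
    qed
  qed auto
  finally show ?thesis by simp
qed

lemma degree_power_linear:
  fixes a v :: "'b::comm_ring_1"
  shows "degree ([:a, v:] ^ n) \<le> n \<and> Polynomial.coeff ([:a, v:] ^ n) n = v ^ n"
proof (induction n)
  case (Suc n)
  have 1: "degree [:a, v:] \<le> 1" by simp
  have "degree ([:a, v:] * [:a, v:] ^ n) \<le> 1 + n"
    by (rule order_trans[OF degree_mult_le]) (use Suc 1 in linarith)
  moreover have "Polynomial.coeff ([:a, v:] * [:a, v:] ^ n) (1 + n) = v * v ^ n"
    using coeff_mult_top[of "[:a, v:]" 1 "[:a, v:] ^ n" n] Suc 1 by simp
  ultimately show ?case by simp
qed simp

lemma degree_prod_linear:
  fixes a v :: "nat \<Rightarrow> 'b::comm_ring_1"
  assumes "finite A"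
  shows "degree (\<Prod>i\<in>A. [:a i, v i:] ^ e i) \<le> (\<Sum>i\<in>A. e i) \<and>
    Polynomial.coeff (\<Prod>i\<in>A. [:a i, v i:] ^ e i) (\<Sum>i\<in>A. e i) = (\<Prod>i\<in>A. v i ^ e i)"
  using assms
proof (induction A rule: finite_induct)
  case (insert x A)
  let ?p = "[:a x, v x:] ^ e x" and ?q = "\<Prod>i\<in>A. [:a i, v i:] ^ e i"
  have "degree (?p * ?q) \<le> e x + (\<Sum>i\<in>A. e i)"
    by (rule order_trans[OF degree_mult_le])
      (use insert.IH degree_power_linear[of "a x" "v x" "e x"] in linarith)
  moreover have "Polynomial.coeff (?p * ?q) (e x + (\<Sum>i\<in>A. e i)) = Polynomial.coeff ?p (e x) * Polynomial.coeff ?q (\<Sum>i\<in>A. e i)"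
    by (rule coeff_mult_top) (use insert.IH degree_power_linear[of "a x" "v x" "e x"] in auto)
  ultimately show ?case
    using insert degree_power_linear[of "a x" "v x" "e x"] by simp
qed simp

lemma degree_line_poly:
  assumes "homogeneous d P"
  shows "degree (line_poly a v P) \<le> d"
  unfolding line_poly_def
proof (rule degree_sum_le)
  fix m assume "m \<in> Poly_Mapping.keys P"
  then have "(\<Sum>i\<in>Poly_Mapping.keys m. Poly_Mapping.lookup m i) = d"
    using assms by (simp add: homogeneous_def)
  then show "degree (Polynomial.smult (Poly_Mapping.lookup P m)
      (\<Prod>i\<in>Poly_Mapping.keys m. [:a i, v i:] ^ Poly_Mapping.lookup m i)) \<le> d"
    using degree_prod_linear[of "Poly_Mapping.keys m" a v "Poly_Mapping.lookup m"]
    by (intro order_trans[OF degree_smult_le]) auto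
qed simp

lemma coeff_line_poly_top:
  assumes "homogeneous d P"
  shows "Polynomial.coeff (line_poly a v P) d = eval_poly v P"
  unfolding line_poly_def eval_poly_def coeff_sum coeff_smult
proof (intro sum.cong refl arg_cong2[where f = "(*)"])
  fix m assume "m \<in> Poly_Mapping.keys P"
  then have "(\<Sum>i\<in>Poly_Mapping.keys m. Poly_Mapping.lookup m i) = d"
    using assms by (simp add: homogeneous_def)
  then show "Polynomial.coeff (\<Prod>i\<in>Poly_Mapping.keys m. [:a i, v i:] ^ Poly_Mapping.lookup m i) d
      = (\<Prod>i\<in>Poly_Mapping.keys m. v i ^ Poly_Mapping.lookup m i)"
    using degree_prod_linear[of "Poly_Mapping.keys m" a v "Poly_Mapping.lookup m"] by auto
qed

lemma eval_partial_deriv: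
  "eval_poly a (partial_deriv i P) = (\<Sum>m \<in> Poly_Mapping.keys P.
     Poly_Mapping.lookup P m * of_nat (Poly_Mapping.lookup m i) * monom_eval a (m - Poly_Mapping.single i 1))"
  by (simp add: partial_deriv_def eval_poly_sum eval_poly_single)

lemma monom_eval_diff_single:
  assumes "i \<in> Poly_Mapping.keys m"
  shows "monom_eval a (m - Poly_Mapping.single i 1) =
    a i ^ (Poly_Mapping.lookup m i - 1) * (\<Prod>k\<in>Poly_Mapping.keys m - {i}. a k ^ Poly_Mapping.lookup m k)"
proof -
  have "monom_eval a (m - Poly_Mapping.single i 1)
      = (\<Prod>k\<in>Poly_Mapping.keys m. a k ^ Poly_Mapping.lookup (m - Poly_Mapping.single i 1) k)"
    by (rule monom_eval_superset) (auto simp: in_keys_iff lookup_minus lookup_single when_def)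
  also have "\<dots> = a i ^ (Poly_Mapping.lookup m i - 1) *
      (\<Prod>k\<in>Poly_Mapping.keys m - {i}. a k ^ Poly_Mapping.lookup (m - Poly_Mapping.single i 1) k)"
    by (subst prod.remove[OF _ assms]) (simp_all add: lookup_minus)
  also have "(\<Prod>k\<in>Poly_Mapping.keys m - {i}. a k ^ Poly_Mapping.lookup (m - Poly_Mapping.single i 1) k)
      = (\<Prod>k\<in>Poly_Mapping.keys m - {i}. a k ^ Poly_Mapping.lookup m k)"
    by (rule prod.cong) (auto simp: lookup_minus lookup_single when_def)
  finally show ?thesis .
qed

text \<open>The exponent $m - e_i$ in the definition of the partial derivative may involve only variables of $P$,
  so the value depends on the coordinates in \<^term>\<open>vars P\<close> alone.\<close>

lemma eval_partial_deriv_cong: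
  assumes "\<And>k. k \<in> vars P \<Longrightarrow> a k = b k"
  shows "eval_poly a (partial_deriv i P) = eval_poly b (partial_deriv i P)"
  unfolding eval_partial_deriv
proof (intro sum.cong refl)
  fix m assume m: "m \<in> Poly_Mapping.keys P"
  have eq: "a k = b k" if "k \<in> Poly_Mapping.keys m" for k
    using that m assms[of k] by (auto simp: vars_def)
  show "Poly_Mapping.lookup P m * of_nat (Poly_Mapping.lookup m i) * monom_eval a (m - Poly_Mapping.single i 1)
    = Poly_Mapping.lookup P m * of_nat (Poly_Mapping.lookup m i) * monom_eval b (m - Poly_Mapping.single i 1)"
  proof (cases "i \<in> Poly_Mapping.keys m")
    case True
    have "(\<Prod>k\<in>Poly_Mapping.keys m - {i}. a k ^ Poly_Mapping.lookup m k)
        = (\<Prod>k\<in>Poly_Mapping.keys m - {i}. b k ^ Poly_Mapping.lookup m k)"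
      by (rule prod.cong) (auto simp: eq)
    then show ?thesis using eq[OF True] by (simp only: monom_eval_diff_single[OF True])
  qed (simp add: in_keys_iff)
qed

text \<open>The derivative of $P$ at $a$ in direction $v$. It is the linear coefficient of $P$ on the line
  $a + tv$, which is how its symmetries are obtained below.\<close>

definition dir_deriv :: "nat \<Rightarrow> cpoly \<Rightarrow> (nat \<Rightarrow> complex) \<Rightarrow> (nat \<Rightarrow> complex) \<Rightarrow> complex" where
  "dir_deriv N P a v = (\<Sum>i<N. v i * eval_poly a (partial_deriv i P))"

lemma coeff_1_prod_linear:
  fixes a v :: "nat \<Rightarrow> complex"
  assumes "finite A"
  shows "Polynomial.coeff (\<Prod>i\<in>A. [:a i, v i:] ^ e i) 1
    = (\<Sum>i\<in>A. of_nat (e i) * v i * (a i ^ (e i - 1) * (\<Prod>k\<in>A - {i}. a k ^ e k)))"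
proof -
  have "Polynomial.coeff p 1 = poly (pderiv p) 0" for p :: "complex poly"
    by (simp add: poly_0_coeff_0 coeff_pderiv)
  then show ?thesis
    by (simp add: pderiv_prod poly_sum poly_prod pderiv_power pderiv_pCons mult_ac)
qed

lemma coeff_1_line_poly:
  assumes "vars P \<subseteq> {..<N}"
  shows "Polynomial.coeff (line_poly a v P) 1 = dir_deriv N P a v"
proof -
  have 1: "Polynomial.coeff (\<Prod>i\<in>Poly_Mapping.keys m. [:a i, v i:] ^ Poly_Mapping.lookup m i) 1
      = (\<Sum>i<N. v i * (of_nat (Poly_Mapping.lookup m i) * monom_eval a (m - Poly_Mapping.single i 1)))"
    if "m \<in> Poly_Mapping.keys P" for m
  proof -
    have "Poly_Mapping.keys m \<subseteq> {..<N}" using that assms by (auto simp: vars_def)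
    then have "(\<Sum>i<N. v i * (of_nat (Poly_Mapping.lookup m i) * monom_eval a (m - Poly_Mapping.single i 1)))
       = (\<Sum>i\<in>Poly_Mapping.keys m. v i * (of_nat (Poly_Mapping.lookup m i) * monom_eval a (m - Poly_Mapping.single i 1)))"
      by (intro sum.mono_neutral_right) (auto simp: in_keys_iff)
    also have "\<dots> = (\<Sum>i\<in>Poly_Mapping.keys m. of_nat (Poly_Mapping.lookup m i) * v i *
        (a i ^ (Poly_Mapping.lookup m i - 1) * (\<Prod>k\<in>Poly_Mapping.keys m - {i}. a k ^ Poly_Mapping.lookup m k)))"
      by (intro sum.cong refl, subst monom_eval_diff_single) (auto simp: mult_ac)
    finally show ?thesis by (subst coeff_1_prod_linear) auto
  qed
  have "Polynomial.coeff (line_poly a v P) 1 = (\<Sum>m\<in>Poly_Mapping.keys P. \<Sum>i<N. Poly_Mapping.lookup P m *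
     (v i * (of_nat (Poly_Mapping.lookup m i) * monom_eval a (m - Poly_Mapping.single i 1))))"
    unfolding line_poly_def coeff_sum coeff_smult by (intro sum.cong refl) (simp only: 1 sum_distrib_left)
  also have "\<dots> = dir_deriv N P a v"
    unfolding dir_deriv_def eval_partial_deriv sum_distrib_left
    by (subst sum.swap) (simp add: mult_ac)
  finally show ?thesis .
qed

lemma smooth_dir_deriv:
  assumes "form N d F" "smooth N F" "i < N" "a i \<noteq> 0"
  obtains k where "k < N" "eval_poly a (partial_deriv k F) \<noteq> 0"
proof -
  have "vec N a $ i \<noteq> 0\<^sub>v N $ i" using assms by simp
  then have "vec N a \<noteq> 0\<^sub>v N" by metis
  then obtain k where k: "k < N" "eval_poly (\<lambda>j. vec N a $ j) (partial_deriv k F) \<noteq> 0"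
    using assms(2) unfolding smooth_def by (metis vec_carrier)
  have "eval_poly (\<lambda>j. vec N a $ j) (partial_deriv k F) = eval_poly a (partial_deriv k F)"
    by (rule eval_partial_deriv_cong) (use assms(1) in \<open>auto simp: form_def\<close>)
  then show thesis using k that by simp
qed

section \<open>Forms that vanish on a smooth hypersurface\<close>

text \<open>If the roots are $z_1, \ldots, z_k$, then $p_1 / p_0 = -\sum 1/z_i$, so one of the $|1/z_i|$ is at least
  the average $|p_1/p_0|/n$. The induction splits off one root at a time. The bound is uniform in the
  polynomial, which makes it usable for a family of polynomials: a zero of $F$ on a nearby transversal
  line is found at a controlled distance.\<close>

lemma small_root:
  fixes p :: "complex poly"
  assumes "degree p \<le> n" "Polynomial.coeff p 1 \<noteq> 0"
  shows "\<exists>z. poly p z = 0 \<and> norm z * norm (Polynomial.coeff p 1) \<le> real n * norm (Polynomial.coeff p 0)"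
  using assms
proof (induction n arbitrary: p)
  case 0
  then show ?case using coeff_eq_0[of p 1] by simp
next
  case (Suc n)
  have "degree p \<ge> 1" using Suc.prems(2) le_degree by blast
  then have "\<not> constant (poly p)" using constant_degree[of p] by simp
  then obtain r where r: "poly p r = 0" using fundamental_theorem_of_algebra by blast
  then obtain q where q: "p = [:- r, 1:] * q" using poly_eq_0_iff_dvd by blast
  have p0: "Polynomial.coeff p 0 = - r * Polynomial.coeff q 0" and p1: "Polynomial.coeff p 1 = Polynomial.coeff q 0 - r * Polynomial.coeff q 1"
    unfolding q by simp_all
  show ?case
  proof (cases "norm r * norm (Polynomial.coeff p 1) \<le> real (Suc n) * norm (Polynomial.coeff p 0)")
    case True
    then show ?thesis using r by blast
  next
    case False
    have qn0: "q \<noteq> 0" using Suc.prems(2) q by auto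
    have dq: "degree q \<le> n"
      using Suc.prems(1) degree_mult_eq[of "[:- r, 1:]" q] qn0 unfolding q by simp
    have n0: "norm (Polynomial.coeff p 0) = norm r * norm (Polynomial.coeff q 0)" by (simp add: p0 norm_mult)
    have "norm r * (real (Suc n) * norm (Polynomial.coeff q 0)) < norm r * norm (Polynomial.coeff p 1)"
      using False n0 by (simp add: mult_ac)
    then have lt: "real (Suc n) * norm (Polynomial.coeff q 0) < norm (Polynomial.coeff p 1)"
      using mult_less_cancel_left_pos by (metis mult_left_mono norm_ge_zero not_le)
    have tri: "norm (Polynomial.coeff p 1) \<le> norm (Polynomial.coeff q 0) + norm r * norm (Polynomial.coeff q 1)"
      unfolding p1 by (metis norm_triangle_ineq4 norm_mult)
    have lt': "real n * norm (Polynomial.coeff p 1) < real (Suc n) * (norm r * norm (Polynomial.coeff q 1))"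
    proof -
      have "real (Suc n) * norm (Polynomial.coeff p 1) \<le> real (Suc n) * norm (Polynomial.coeff q 0) + real (Suc n) * (norm r * norm (Polynomial.coeff q 1))"
        using mult_left_mono[OF tri, of "real (Suc n)"] by (simp add: distrib_left)
      moreover have "real (Suc n) * norm (Polynomial.coeff p 1) = real n * norm (Polynomial.coeff p 1) + norm (Polynomial.coeff p 1)"
        by (simp add: distrib_right)
      ultimately show ?thesis using lt by linarith
    qed
    have q1: "Polynomial.coeff q 1 \<noteq> 0"
    proof
      assume "Polynomial.coeff q 1 = 0"
      then have "real n * norm (Polynomial.coeff p 1) < 0" using lt' by simp
      moreover have "real n * norm (Polynomial.coeff p 1) \<ge> 0" by simp
      ultimately show False by linarith
    qed
    have npos: "n > 0" using coeff_eq_0[of q 1] dq q1 by (cases n) auto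
    obtain z where z: "poly q z = 0" "norm z * norm (Polynomial.coeff q 1) \<le> real n * norm (Polynomial.coeff q 0)"
      using Suc.IH[OF dq q1] by blast
    have "real n * (norm z * norm (Polynomial.coeff p 1)) = norm z * (real n * norm (Polynomial.coeff p 1))" by simp
    also have "\<dots> \<le> norm z * (real (Suc n) * (norm r * norm (Polynomial.coeff q 1)))"
      by (rule mult_left_mono) (use lt' in auto)
    also have "\<dots> = real (Suc n) * norm r * (norm z * norm (Polynomial.coeff q 1))" by simp
    also have "\<dots> \<le> real (Suc n) * norm r * (real n * norm (Polynomial.coeff q 0))"
      by (rule mult_left_mono) (use z in auto)
    also have "\<dots> = real n * (real (Suc n) * norm (Polynomial.coeff p 0))" by (simp add: n0)
    finally have "norm z * norm (Polynomial.coeff p 1) \<le> real (Suc n) * norm (Polynomial.coeff p 0)"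
      using npos by simp
    then show ?thesis using z(1) q by auto
  qed
qed

text \<open>A bound of $r$ by a multiple of $p$ near every root of $p$ survives the cancellation of a common linear
  factor, at the cancelled root by continuity; so the roots can be removed one by one.\<close>

lemma dvd_of_local_bound:
  fixes p r :: "complex poly"
  assumes "p \<noteq> 0"
    and "\<And>t0. poly p t0 = 0 \<Longrightarrow> \<exists>C. \<forall>\<^sub>F t in nhds t0. norm (poly r t) \<le> C * norm (poly p t)"
  shows "p dvd r"
  using assms
proof (induction "degree p" arbitrary: p r)
  case 0
  then obtain a where "p = [:a:]" using degree_eq_zeroE by metis
  moreover have "a \<noteq> 0" using "0.prems"(1) calculation by simp
  ultimately show ?case using const_poly_dvd_iff[of a r] by (simp add: dvd_field_iff)
next
  case (Suc n)
  have "\<not> constant (poly p)" using constant_degree[of p] Suc.hyps(2) by simp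
  then obtain s where s: "poly p s = 0" using fundamental_theorem_of_algebra by blast
  then obtain p' where p': "p = [:- s, 1:] * p'" using poly_eq_0_iff_dvd by blast
  obtain C where "\<forall>\<^sub>F t in nhds s. norm (poly r t) \<le> C * norm (poly p t)"
    using Suc.prems(2)[OF s] by blast
  then have "norm (poly r s) \<le> C * norm (poly p s)" by (rule eventually_nhds_x_imp_x)
  then have "poly r s = 0" using s by simp
  then obtain r' where r': "r = [:- s, 1:] * r'" using poly_eq_0_iff_dvd by blast
  have p'0: "p' \<noteq> 0" using Suc.prems(1) p' by auto
  have "degree p = Suc (degree p')"
    using degree_mult_eq[of "[:- s, 1:]" p'] p'0 unfolding p' by simp
  then have deg: "n = degree p'" using Suc.hyps(2) by simp
  have "p' dvd r'"
  proof (rule Suc.hyps(1)[OF deg p'0])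
    fix t0 assume "poly p' t0 = 0"
    then have "poly p t0 = 0" by (simp add: p')
    then obtain C where C: "\<forall>\<^sub>F t in nhds t0. norm (poly r t) \<le> C * norm (poly p t)"
      using Suc.prems(2) by blast
    have cancel: "norm (poly r' t) \<le> C * norm (poly p' t)"
      if "norm (poly r t) \<le> C * norm (poly p t)" "t \<noteq> s" for t
    proof -
      have "norm (t - s) * norm (poly r' t) \<le> norm (t - s) * (C * norm (poly p' t))"
      proof -
        have "norm (poly r t) = norm (t - s) * norm (poly r' t)" "norm (poly p t) = norm (t - s) * norm (poly p' t)"
          by (simp_all add: p' r' norm_mult[symmetric] left_diff_distrib del: norm_mult)
        then show ?thesis using that(1) by (simp only: mult.left_commute)
      qed
      then show ?thesis using that(2) by simp
    qed
    have neq: "\<forall>\<^sub>F t in at t0. t \<noteq> s"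
    proof (cases "t0 = s")
      case False
      then show ?thesis by (intro tendsto_imp_eventually_ne[OF tendsto_ident_at]) simp
    qed (simp add: eventually_at_filter)
    have C': "\<forall>\<^sub>F t in at t0. norm (poly r t) \<le> C * norm (poly p t)"
      using C by (simp add: eventually_nhds_conv_at)
    have at: "\<forall>\<^sub>F t in at t0. norm (poly r' t) \<le> C * norm (poly p' t)"
      using neq C' by eventually_elim (rule cancel)
    have cont: "((\<lambda>t. norm (poly q t)) \<longlongrightarrow> norm (poly q t0)) (at t0)" for q :: "complex poly"
      by (intro tendsto_norm) (use isCont_def poly_isCont in blast)
    have "norm (poly r' t0) \<le> C * norm (poly p' t0)"
      by (rule tendsto_le[OF _ tendsto_mult[OF tendsto_const cont] cont at]) simp
    then have "\<forall>\<^sub>F t in nhds t0. norm (poly r' t) \<le> C * norm (poly p' t)"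
      using at by (simp add: eventually_nhds_conv_at)
    then show "\<exists>C. \<forall>\<^sub>F t in nhds t0. norm (poly r' t) \<le> C * norm (poly p' t)" by blast
  qed
  then show ?case unfolding p' r' by (rule mult_dvd_mono[OF dvd_refl])
qed

text \<open>The restriction of $P$ to the plane $a + tv + ye$, as a polynomial in $y$ whose coefficients are polynomials
  in $t$.\<close>

definition plane_poly :: "(nat \<Rightarrow> complex) \<Rightarrow> (nat \<Rightarrow> complex) \<Rightarrow> (nat \<Rightarrow> complex) \<Rightarrow> cpoly \<Rightarrow> complex poly poly" where
  "plane_poly a v e P = (\<Sum>m \<in> Poly_Mapping.keys P. Polynomial.smult [:Poly_Mapping.lookup P m:]
     (\<Prod>i \<in> Poly_Mapping.keys m. [:[:a i, v i:], [:e i:]:] ^ Poly_Mapping.lookup m i))"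

lemma poly_plane_poly:
  "poly (poly (plane_poly a v e P) [:y:]) t = eval_poly (\<lambda>i. a i + t * v i + y * e i) P"
  by (simp add: plane_poly_def eval_poly_def poly_sum poly_prod add_ac mult_ac)

lemma poly_poly_bounded:
  fixes B :: "complex poly poly"
  shows "\<exists>C\<ge>0. \<forall>t y. norm t \<le> R \<longrightarrow> norm y \<le> 1 \<longrightarrow> norm (poly (poly B [:y:]) t) \<le> C"
proof (induction B)
  case 0
  then show ?case by auto
next
  case (pCons b B)
  obtain C where C: "C \<ge> 0" "\<And>t y. norm t \<le> R \<Longrightarrow> norm y \<le> 1 \<Longrightarrow> norm (poly (poly B [:y:]) t) \<le> C"
    using pCons.IH by blast
  obtain K where K: "\<And>t. norm t \<le> R \<Longrightarrow> norm (poly b t) \<le> K"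
    using poly_bound_exists[of R b] by blast
  have "norm (poly (poly (pCons b B) [:y:]) t) \<le> \<bar>K\<bar> + C" if "norm t \<le> R" "norm y \<le> 1" for t y
  proof -
    have "norm (poly (poly (pCons b B) [:y:]) t) \<le> norm (poly b t) + norm y * norm (poly (poly B [:y:]) t)"
      by (simp, metis norm_triangle_ineq norm_mult)
    also have "\<dots> \<le> \<bar>K\<bar> + 1 * C"
      by (intro add_mono mult_mono) (use that K[OF that(1)] C in auto)
    finally show ?thesis by simp
  qed
  then show ?case using C(1) by (intro exI[of _ "\<bar>K\<bar> + C"]) auto
qed

text \<open>The difference of the two values is divisible by $y$, and the quotient is bounded on bounded sets.\<close>

lemma eval_poly_lipschitz:
  obtains C where "C \<ge> 0" "\<And>t y. norm t \<le> R \<Longrightarrow> norm y \<le> 1 \<Longrightarrow>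
    norm (eval_poly (\<lambda>i. a i + t * v i + y * e i) P - eval_poly (\<lambda>i. a i + t * v i) P) \<le> C * norm y"
proof -
  obtain b B where B: "plane_poly a v e P = pCons b B" by (cases "plane_poly a v e P")
  obtain C where C: "C \<ge> 0" "\<And>t y. norm t \<le> R \<Longrightarrow> norm y \<le> 1 \<Longrightarrow> norm (poly (poly B [:y:]) t) \<le> C"
    using poly_poly_bounded[of R B] by blast
  have eq: "eval_poly (\<lambda>i. a i + t * v i + y * e i) P = poly b t + y * poly (poly B [:y:]) t" for t y
    using poly_plane_poly[of a v e P y t] by (simp add: B)
  have eq0: "eval_poly (\<lambda>i. a i + t * v i) P = poly b t" for t
    using eq[of t 0] by simp
  have "norm (y * poly (poly B [:y:]) t) \<le> C * norm y" if "norm t \<le> R" "norm y \<le> 1" for t y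
    using mult_right_mono[OF C(2)[OF that], of "norm y"] by (simp add: norm_mult mult_ac)
  then show thesis by (intro that[OF C(1)]) (simp add: eq eq0)
qed

text \<open>A special case of the Nullstellensatz. Choose $v_0$ with $F(v_0) \ne 0$ and subtract the multiple of $F$ that
  makes $Q = F \circ T - cF$ vanish at $v_0$. Restricted to a line $w + t v_0$, $F$ becomes a polynomial $p$ of
  degree exactly $d$ and $Q$ a polynomial $r$ of smaller degree, so it is enough that $p$ divides $r$. Near
  a root of $p$ the gradient of $F$ does not vanish; moving by $O(|p(t)|)$ in a direction transversal
  to $V(F)$ reaches a zero of $F$, hence of $Q$, and since $Q$ is Lipschitz, $r = O(|p|)$ there.\<close>

lemma proportional_of_zeros:
  assumes F: "form N d F" "smooth N F" "d \<ge> 1"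
    and lin: "\<And>a v t. T (\<lambda>i. a i + t * v i) = (\<lambda>i. T a i + t * T v i)"
    and cong: "\<And>x y. (\<And>i. i < N \<Longrightarrow> x i = y i) \<Longrightarrow> T x = T y"
    and zeros: "\<And>x. eval_poly x F = 0 \<Longrightarrow> eval_poly (T x) F = 0"
  shows "\<exists>c. \<forall>x. eval_poly (T x) F = c * eval_poly x F"
proof (cases "\<exists>v0. eval_poly v0 F \<noteq> 0")
  case False
  then show ?thesis using zeros by auto
next
  case True
  then obtain v0 where v0: "eval_poly v0 F \<noteq> 0" by blast
  have hom: "homogeneous d F" and vF: "vars F \<subseteq> {..<N}" using F(1) by (auto simp: form_def)
  define c where "c = eval_poly (T v0) F / eval_poly v0 F"
  define Q where "Q x = eval_poly (T x) F - c * eval_poly x F" for x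
  have Qzero: "Q x = 0" if "eval_poly x F = 0" for x
    using zeros[OF that] that by (simp add: Q_def)
  have Q0: "Q w = 0" for w
  proof -
    define p where "p = line_poly w v0 F"
    define r where "r = line_poly (T w) (T v0) F - Polynomial.smult c p"
    have p: "poly p t = eval_poly (\<lambda>i. w i + t * v0 i) F" for t
      by (simp add: p_def poly_line_poly)
    have r: "poly r t = Q (\<lambda>i. w i + t * v0 i)" for t
      by (simp add: r_def p poly_line_poly Q_def lin)
    have degp: "degree p \<le> d" unfolding p_def by (rule degree_line_poly[OF hom])
    have cp: "Polynomial.coeff p d = eval_poly v0 F" unfolding p_def by (rule coeff_line_poly_top[OF hom])
    have degp': "degree p = d" using degp cp v0 le_degree[of p d] by simp
    have p0: "p \<noteq> 0" using cp v0 by auto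
    have "degree r \<le> d" unfolding r_def
      by (intro degree_diff_le order_trans[OF degree_smult_le] degp degree_line_poly[OF hom])
    moreover have "Polynomial.coeff r d = 0"
      unfolding r_def by (simp add: cp coeff_line_poly_top[OF hom] c_def v0)
    ultimately have degr: "r = 0 \<or> degree r < d"
      by (metis leading_coeff_0_iff order_le_less)
    have "p dvd r"
    proof (rule dvd_of_local_bound[OF p0])
      fix t0 assume t0: "poly p t0 = 0"
      define z where "z = (\<lambda>i. w i + t0 * v0 i)"
      show "\<exists>C. \<forall>\<^sub>F t in nhds t0. norm (poly r t) \<le> C * norm (poly p t)"
      \<comment> \<open>The gradient vanishes at the origin; but a line through the origin consists of multiples of $v_0$, where $Q$ is zero.\<close>
      proof (cases "\<exists>i<N. z i \<noteq> 0")
        case False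
        have T0: "T (\<lambda>i. 0) = (\<lambda>i. 0)"
          using fun_cong[OF lin[of "\<lambda>i. 0" 1 "\<lambda>i. 0"]] by auto
        have "poly r t = 0" for t
        proof -
          have "w i + t * v0 i = (t - t0) * v0 i" if "i < N" for i
          proof -
            have "z i = 0" using False that by blast
            then have "w i = - (t0 * v0 i)" by (simp add: z_def eq_neg_iff_add_eq_0)
            then show ?thesis by (simp add: algebra_simps)
          qed
          note eq = this
          have "T (\<lambda>i. w i + t * v0 i) = T (\<lambda>i. 0 + (t - t0) * v0 i)"
            by (rule cong) (simp add: eq)
          also have "\<dots> = (\<lambda>i. (t - t0) * T v0 i)"
            using lin[of "\<lambda>i. 0" "t - t0" v0] by (simp add: T0)
          finally have "eval_poly (T (\<lambda>i. w i + t * v0 i)) F = (t - t0) ^ d * eval_poly (T v0) F"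
            by (simp add: eval_poly_homogeneous[OF hom])
          moreover have "eval_poly (\<lambda>i. w i + t * v0 i) F = eval_poly (\<lambda>i. (t - t0) * v0 i) F"
            by (rule eval_poly_cong) (use vF eq in auto)
          ultimately show ?thesis
            using v0 by (simp add: r Q_def c_def eval_poly_homogeneous[OF hom])
        qed
        then show ?thesis by (intro exI[of _ 0]) simp
      next
        case True
        then obtain i where "i < N" "z i \<noteq> 0" by blast
        then obtain k where k: "k < N" "eval_poly z (partial_deriv k F) \<noteq> 0"
          using smooth_dir_deriv[OF F(1,2)] by blast
        define e :: "nat \<Rightarrow> complex" where "e = (\<lambda>i. if i = k then 1 else 0)"
        define q where "q = line_poly w v0 (partial_deriv k F)"
        have q: "poly q t = eval_poly (\<lambda>i. w i + t * v0 i) (partial_deriv k F)" for t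
          by (simp add: q_def poly_line_poly)
        define l where "l t = line_poly (\<lambda>i. w i + t * v0 i) e F" for t
        have l0: "Polynomial.coeff (l t) 0 = poly p t" for t
          using poly_line_poly[of "\<lambda>i. w i + t * v0 i" e F 0] by (simp add: l_def p poly_0_coeff_0)
        have l1: "Polynomial.coeff (l t) 1 = poly q t" for t
        proof -
          have "Polynomial.coeff (l t) 1 = (\<Sum>i<N. if i = k then eval_poly (\<lambda>i. w i + t * v0 i) (partial_deriv i F) else 0)"
            unfolding l_def coeff_1_line_poly[OF vF] dir_deriv_def e_def by (rule sum.cong) auto
          then show ?thesis using k(1) by (simp add: q)
        qed
        have dl: "degree (l t) \<le> d" for t
          unfolding l_def by (rule degree_line_poly[OF hom])
        define \<delta> where "\<delta> = norm (poly q t0) / 2"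
        have \<delta>: "\<delta> > 0" using k(2) by (simp add: \<delta>_def q z_def)
        have cq: "((\<lambda>t. norm (poly f t)) \<longlongrightarrow> norm (poly f t0)) (nhds t0)" for f :: "complex poly"
          by (intro tendsto_norm) (simp add: tendsto_at_iff_tendsto_nhds[symmetric] isContD)
        have e1: "\<forall>\<^sub>F t in nhds t0. norm (poly q t) > \<delta>"
          by (rule order_tendstoD(1)[OF cq]) (use \<delta> in \<open>simp add: \<delta>_def\<close>)
        have e2: "\<forall>\<^sub>F t in nhds t0. norm (poly p t) < \<delta> / d"
          by (rule order_tendstoD(2)[OF cq]) (use \<delta> t0 F(3) in simp)
        have e3: "\<forall>\<^sub>F t in nhds t0. norm t < norm t0 + 1"
          using order_tendstoD(2)[OF cq[of "[:0,1:]"], of "norm t0 + 1"] by simp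
        let ?R = "norm t0 + 1"
        obtain C1 where C1: "C1 \<ge> 0" "\<And>t y. norm t \<le> ?R \<Longrightarrow> norm y \<le> 1 \<Longrightarrow>
          norm (eval_poly (\<lambda>i. T w i + t * T v0 i + y * T e i) F - eval_poly (\<lambda>i. T w i + t * T v0 i) F) \<le> C1 * norm y"
          using that by (rule eval_poly_lipschitz[of ?R "T w" "T v0" "T e" F])
        obtain C2 where C2: "C2 \<ge> 0" "\<And>t y. norm t \<le> ?R \<Longrightarrow> norm y \<le> 1 \<Longrightarrow>
          norm (eval_poly (\<lambda>i. w i + t * v0 i + y * e i) F - eval_poly (\<lambda>i. w i + t * v0 i) F) \<le> C2 * norm y"
          using that by (rule eval_poly_lipschitz[of ?R "w" "v0" "e" F])
        define C where "C = C1 + norm c * C2"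
        have C0: "C \<ge> 0" using C1(1) C2(1) by (simp add: C_def)
        have QL: "norm (Q (\<lambda>i. w i + t * v0 i + y * e i) - Q (\<lambda>i. w i + t * v0 i)) \<le> C * norm y"
          if "norm t \<le> ?R" "norm y \<le> 1" for t y
        proof -
          have "Q (\<lambda>i. w i + t * v0 i + y * e i) - Q (\<lambda>i. w i + t * v0 i)
            = (eval_poly (\<lambda>i. T w i + t * T v0 i + y * T e i) F - eval_poly (\<lambda>i. T w i + t * T v0 i) F)
              - c * (eval_poly (\<lambda>i. w i + t * v0 i + y * e i) F - eval_poly (\<lambda>i. w i + t * v0 i) F)"
            unfolding Q_def lin by (simp add: algebra_simps)
          then have "norm (Q (\<lambda>i. w i + t * v0 i + y * e i) - Q (\<lambda>i. w i + t * v0 i))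
            \<le> norm (eval_poly (\<lambda>i. T w i + t * T v0 i + y * T e i) F - eval_poly (\<lambda>i. T w i + t * T v0 i) F)
              + norm c * norm (eval_poly (\<lambda>i. w i + t * v0 i + y * e i) F - eval_poly (\<lambda>i. w i + t * v0 i) F)"
            by (simp only: norm_mult[symmetric] norm_triangle_ineq4)
          also have "\<dots> \<le> C1 * norm y + norm c * (C2 * norm y)"
            by (intro add_mono mult_left_mono C1 C2 that) simp
          finally show ?thesis by (simp add: C_def algebra_simps)
        qed
        have "\<forall>\<^sub>F t in nhds t0. norm (poly r t) \<le> (C * d / \<delta>) * norm (poly p t)"
          using e1 e2 e3
        proof eventually_elim
          case (elim t)
          have "Polynomial.coeff (l t) 1 \<noteq> 0" using elim(1) \<delta> unfolding l1 by auto
          then obtain y where y: "poly (l t) y = 0" "norm y * norm (Polynomial.coeff (l t) 1) \<le> real d * norm (Polynomial.coeff (l t) 0)"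
            using small_root[OF dl] by blast
          have "norm y * \<delta> \<le> norm y * norm (Polynomial.coeff (l t) 1)"
            using elim(1) unfolding l1 by (intro mult_left_mono) auto
          then have y': "norm y * \<delta> \<le> real d * norm (poly p t)" using y(2) by (simp add: l0)
          also have "\<dots> \<le> \<delta>" using elim(2) F(3) by (simp add: field_simps)
          finally have y1: "norm y \<le> 1" using \<delta> by simp
          have "eval_poly (\<lambda>i. w i + t * v0 i + y * e i) F = 0"
            using y(1) by (simp add: l_def poly_line_poly)
          then have "Q (\<lambda>i. w i + t * v0 i + y * e i) = 0" by (rule Qzero)
          then have "norm (poly r t) \<le> C * norm y"
            using QL[of t y] elim(3) y1 by (simp add: r)
          also have "\<dots> \<le> C * (real d * norm (poly p t) / \<delta>)"
            using y' \<delta> by (intro mult_left_mono C0) (simp add: field_simps)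
          finally show ?case by (simp add: mult_ac)
        qed
        then show ?thesis by blast
      qed
    qed
    have "r = 0"
    proof (rule ccontr)
      assume "r \<noteq> 0"
      with \<open>p dvd r\<close> have "degree p \<le> degree r" by (rule dvd_imp_degree_le)
      moreover have "degree r < degree p" using degr degp' \<open>r \<noteq> 0\<close> by blast
      ultimately show False by (meson not_le)
    qed
    have w: "(\<lambda>i. w i + 0 * v0 i) = w" by (rule ext) (simp only: mult_zero_left add_0_right)
    have "Q w = poly r 0" using r[of 0] unfolding w by (rule sym)
    also have "\<dots> = 0" unfolding \<open>r = 0\<close> by simp
    finally show "Q w = 0" .
  qed
  show ?thesis using Q0 unfolding Q_def by (intro exI[of _ c]) simp
qed

section \<open>Projective linear groups and diagonal symmetries\<close>

lemma smult_smult_mat: "a \<cdot>\<^sub>m (b \<cdot>\<^sub>m A) = (a * b) \<cdot>\<^sub>m (A :: complex mat)"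
  by (intro eq_matI) auto

abbreviation mat_ring :: "nat \<Rightarrow> complex mat ring" where
  "mat_ring n \<equiv> ring_mat TYPE(complex) n ()"

lemma monoid_mat_ring: "monoid (mat_ring n)"
  by (rule ring.is_monoid[OF ring_mat])

lemma group_GL: "group (GL n)"
  unfolding GL_def by (rule monoid.units_group[OF monoid_mat_ring])

lemma GL_mult [simp]: "A \<otimes>\<^bsub>GL n\<^esub> B = A * B"
  by (simp add: GL_def units_of_def ring_mat_def)

lemma GL_one [simp]: "\<one>\<^bsub>GL n\<^esub> = 1\<^sub>m n"
  by (simp add: GL_def units_of_def ring_mat_def)

lemma GL_carrier: "A \<in> carrier (GL n) \<longleftrightarrow>
    A \<in> carrier_mat n n \<and> (\<exists>B\<in>carrier_mat n n. A * B = 1\<^sub>m n \<and> B * A = 1\<^sub>m n)"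
  by (auto simp: GL_def units_of_def ring_mat_def Units_def)

lemma GL_carrier_mat: "A \<in> carrier (GL n) \<Longrightarrow> A \<in> carrier_mat n n"
  by (simp add: GL_carrier)

lemma smult_one_mult:
  "A \<in> carrier_mat n n \<Longrightarrow> (c \<cdot>\<^sub>m 1\<^sub>m n) * A = c \<cdot>\<^sub>m (A :: complex mat)"
  "A \<in> carrier_mat n n \<Longrightarrow> A * (c \<cdot>\<^sub>m 1\<^sub>m n) = c \<cdot>\<^sub>m (A :: complex mat)"
  by (simp_all add: mult_smult_assoc_mat[of _ n n _ n] mult_smult_distrib[of _ n n _ n])

lemma scalar_in_GL: "c \<noteq> 0 \<Longrightarrow> c \<cdot>\<^sub>m 1\<^sub>m n \<in> carrier (GL n)"
  unfolding GL_carrier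
  by (intro conjI bexI[of _ "inverse c \<cdot>\<^sub>m 1\<^sub>m n"]) (auto simp: smult_one_mult smult_smult_mat)

lemma scalars_normal: "scalars n \<lhd> GL n"
proof -
  interpret GL: group "GL n" by (rule group_GL)
  have sub: "scalars n \<subseteq> carrier (GL n)" by (auto simp: scalars_def scalar_in_GL)
  have inv: "inv\<^bsub>GL n\<^esub> (c \<cdot>\<^sub>m 1\<^sub>m n) = inverse c \<cdot>\<^sub>m 1\<^sub>m n" if "c \<noteq> 0" for c
    by (rule GL.inv_equality) (use that scalar_in_GL in \<open>auto simp: smult_one_mult smult_smult_mat\<close>)
  have S: "subgroup (scalars n) (GL n)"
  proof (rule subgroup.intro[OF sub])
    show "x \<otimes>\<^bsub>GL n\<^esub> y \<in> scalars n" if "x \<in> scalars n" "y \<in> scalars n" for x y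
      using that by (force simp: scalars_def smult_one_mult smult_smult_mat)
    have "(1::complex) \<cdot>\<^sub>m 1\<^sub>m n = 1\<^sub>m n" by (intro eq_matI) auto
    then show "\<one>\<^bsub>GL n\<^esub> \<in> scalars n" by (force simp: scalars_def)
    show "inv\<^bsub>GL n\<^esub> x \<in> scalars n" if "x \<in> scalars n" for x
      using that by (force simp: scalars_def inv)
  qed
  have "A \<otimes>\<^bsub>GL n\<^esub> x \<otimes>\<^bsub>GL n\<^esub> inv\<^bsub>GL n\<^esub> A \<in> scalars n" if "A \<in> carrier (GL n)" "x \<in> scalars n" for A x
  proof -
    from \<open>x \<in> scalars n\<close> obtain c where x: "x = c \<cdot>\<^sub>m 1\<^sub>m n" by (auto simp: scalars_def)
    have "A \<otimes>\<^bsub>GL n\<^esub> x = x \<otimes>\<^bsub>GL n\<^esub> A"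
      using GL_carrier_mat[OF that(1)] by (simp add: x smult_one_mult)
    then have "A \<otimes>\<^bsub>GL n\<^esub> x \<otimes>\<^bsub>GL n\<^esub> inv\<^bsub>GL n\<^esub> A = x"
      using GL.m_assoc[of x A "inv\<^bsub>GL n\<^esub> A"] that sub GL.r_inv[of A] GL.r_one[of x] GL.inv_closed[of A]
      by (simp only: subsetD)
    then show ?thesis using that(2) by simp
  qed
  then show ?thesis using S GL.normal_inv_iff by blast
qed

lemma group_PGL: "group (PGL n)"
  unfolding PGL_def by (rule normal.factorgroup_is_group[OF scalars_normal])

lemma to_PGL_hom: "to_PGL n \<in> hom (GL n) (PGL n)"
  unfolding PGL_def to_PGL_def[abs_def] by (rule normal.r_coset_hom_Mod[OF scalars_normal])

lemma to_PGL_closed: "A \<in> carrier (GL n) \<Longrightarrow> to_PGL n A \<in> carrier (PGL n)"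
  using to_PGL_hom by (auto simp: hom_def)

lemma to_PGL_mult:
  "A \<in> carrier (GL n) \<Longrightarrow> B \<in> carrier (GL n) \<Longrightarrow> to_PGL n (A * B) = to_PGL n A \<otimes>\<^bsub>PGL n\<^esub> to_PGL n B"
  using to_PGL_hom by (auto simp: hom_def)

lemma to_PGL_one: "to_PGL n (1\<^sub>m n) = \<one>\<^bsub>PGL n\<^esub>"
  using hom_one[OF to_PGL_hom group_GL group_PGL] by simp

lemma to_PGL_alt: "A \<in> carrier (GL n) \<Longrightarrow> to_PGL n A = {c \<cdot>\<^sub>m A |c. c \<noteq> 0}"
  unfolding to_PGL_def r_coset_def scalars_def
  using GL_carrier_mat[of A n] by (auto simp: smult_one_mult)

lemma mat_self_in_to_PGL: "A \<in> carrier (GL n) \<Longrightarrow> A \<in> to_PGL n A"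
proof -
  have "(1::complex) \<cdot>\<^sub>m A = A" by (intro eq_matI) auto
  moreover assume "A \<in> carrier (GL n)"
  ultimately show ?thesis by (force simp: to_PGL_alt)
qed

lemma to_PGL_eqD:
  assumes "A \<in> carrier (GL n)" "B \<in> carrier (GL n)" "to_PGL n A = to_PGL n B"
  obtains c where "c \<noteq> 0" "A = c \<cdot>\<^sub>m B"
  using mat_self_in_to_PGL[OF assms(1)] to_PGL_alt[OF assms(2)] assms(3) that by auto

lemma to_PGL_smult:
  assumes "A \<in> carrier (GL n)" "c \<noteq> 0"
  shows "to_PGL n (c \<cdot>\<^sub>m A) = to_PGL n A"
proof -
  interpret group "GL n" by (rule group_GL)
  have cA: "c \<cdot>\<^sub>m A = (c \<cdot>\<^sub>m 1\<^sub>m n) \<otimes>\<^bsub>GL n\<^esub> A"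
    using GL_carrier_mat[OF assms(1)] by (simp add: smult_one_mult)
  then have "c \<cdot>\<^sub>m A \<in> carrier (GL n)"
    using assms scalar_in_GL m_closed by metis
  then have "to_PGL n (c \<cdot>\<^sub>m A) = {b \<cdot>\<^sub>m (c \<cdot>\<^sub>m A) |b. b \<noteq> 0}" by (rule to_PGL_alt)
  also have "\<dots> = {b \<cdot>\<^sub>m A |b. b \<noteq> 0}"
  proof (intro equalityI subsetI)
    fix X assume "X \<in> {b \<cdot>\<^sub>m A |b. b \<noteq> 0}"
    then obtain b where "b \<noteq> 0" "X = b \<cdot>\<^sub>m A" by blast
    then have "X = (b / c) \<cdot>\<^sub>m (c \<cdot>\<^sub>m A)" "b / c \<noteq> 0" using assms(2) by (simp_all add: smult_smult_mat)
    then show "X \<in> {b \<cdot>\<^sub>m (c \<cdot>\<^sub>m A) |b. b \<noteq> 0}" by blast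
  qed (use assms(2) in \<open>force simp: smult_smult_mat\<close>)
  finally show ?thesis by (simp add: to_PGL_alt[OF assms(1)])
qed

lemma mat_diag_one: "mat_diag n (\<lambda>i. 1) = 1\<^sub>m n"
  by (intro eq_matI) (auto simp: mat_diag_def)

lemma mat_diag_in_GL: "(\<And>i. i < n \<Longrightarrow> l i \<noteq> 0) \<Longrightarrow> mat_diag n l \<in> carrier (GL n)"
  unfolding GL_carrier
proof (intro conjI bexI[of _ "mat_diag n (\<lambda>i. inverse (l i))"])
  assume l: "\<And>i. i < n \<Longrightarrow> l i \<noteq> 0"
  have "mat_diag n (\<lambda>i. l i * inverse (l i)) = mat_diag n (\<lambda>i. 1)"
    by (intro eq_matI) (auto simp: mat_diag_def l)
  then show "mat_diag n l * mat_diag n (\<lambda>i. inverse (l i)) = 1\<^sub>m n"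
     "mat_diag n (\<lambda>i. inverse (l i)) * mat_diag n l = 1\<^sub>m n"
    by (simp_all add: mat_diag_one mult.commute)
qed (auto simp: mat_diag_def)

lemma Const_mult_single: "Const a * Poly_Mapping.single m b = Poly_Mapping.single m (a * b)"
  by (simp add: Const_def mult_single)

lemma single_power: "(Poly_Mapping.single m (a::complex)) ^ k
    = Poly_Mapping.single (\<Sum>_<k. m) (a ^ k)" for m :: "nat \<Rightarrow>\<^sub>0 nat"
  by (induction k) (simp_all add: mult_single add.commute del: sum_constant)

lemma lookup_sum_const: "Poly_Mapping.lookup (\<Sum>_<k. m) i = k * Poly_Mapping.lookup m i"
  for m :: "nat \<Rightarrow>\<^sub>0 nat"
  by (induction k) (simp_all add: lookup_add del: sum_constant)

lemma sum_single_keys: "(\<Sum>i\<in>Poly_Mapping.keys m. Poly_Mapping.single i (Poly_Mapping.lookup m i)) = m"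
  for m :: "'a \<Rightarrow>\<^sub>0 'b::comm_monoid_add"
proof (rule poly_mapping_eqI)
  fix k
  have *: "Poly_Mapping.lookup (Poly_Mapping.single i (Poly_Mapping.lookup m i)) k
      = (if i = k then Poly_Mapping.lookup m i else 0)" for i
    by (simp add: lookup_single when_def)
  show "Poly_Mapping.lookup (\<Sum>i\<in>Poly_Mapping.keys m. Poly_Mapping.single i (Poly_Mapping.lookup m i)) k
    = Poly_Mapping.lookup m k"
    unfolding lookup_sum * by (simp add: in_keys_iff)
qed

lemma subst_monomial:
  "(\<Prod>i\<in>A. (Const (l i) * Var i) ^ e i)
    = Poly_Mapping.single (\<Sum>i\<in>A. Poly_Mapping.single i (e i)) (\<Prod>i\<in>A. l i ^ e i)"
proof (induction A rule: infinite_finite_induct)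
  case (insert x A)
  have "(\<Sum>_<e x. Poly_Mapping.single x (1::nat)) = Poly_Mapping.single x (e x)"
    by (rule poly_mapping_eqI) (simp only: lookup_sum_const lookup_single, simp add: when_def)
  then have "(Const (l x) * Var x) ^ e x = Poly_Mapping.single (Poly_Mapping.single x (e x)) (l x ^ e x)"
    by (simp add: Var_def Const_mult_single single_power)
  then show ?case using insert by (simp add: mult_single)
qed (simp_all add: flip: single_one)

lemma subst_poly_diag:
  "subst_poly (\<lambda>i. Const (l i) * Var i) P
    = (\<Sum>m\<in>Poly_Mapping.keys P. Poly_Mapping.single m (Poly_Mapping.lookup P m * monom_eval l m))"
  by (simp add: subst_poly_def subst_monomial sum_single_keys Const_mult_single monom_eval_def)

lemma lookup_sum_single_keys:
  "Poly_Mapping.lookup (\<Sum>m\<in>Poly_Mapping.keys P. Poly_Mapping.single m (f m)) k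
    = (if k \<in> Poly_Mapping.keys P then f k else 0)"
proof -
  have *: "Poly_Mapping.lookup (Poly_Mapping.single i (f i)) k = (if i = k then f i else 0)" for i
    by (simp add: lookup_single when_def)
  show ?thesis unfolding lookup_sum * by simp
qed

text \<open>A diagonal substitution multiplies each monomial by a scalar, so being an eigenvector means that these
  scalars agree on the monomials that occur.\<close>

lemma subst_poly_diag_eq_iff:
  "subst_poly (\<lambda>i. Const (l i) * Var i) P = Const c * P
    \<longleftrightarrow> (\<forall>m\<in>Poly_Mapping.keys P. monom_eval l m = c)"
proof -
  have "Const c * P = Const c * (\<Sum>m\<in>Poly_Mapping.keys P. Poly_Mapping.single m (Poly_Mapping.lookup P m))"
    by (simp add: sum_single_keys)
  also have "\<dots> = (\<Sum>m\<in>Poly_Mapping.keys P. Poly_Mapping.single m (c * Poly_Mapping.lookup P m))"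
    by (simp add: sum_distrib_left Const_mult_single)
  finally have C: "Const c * P = \<dots>" .
  show ?thesis
  proof
    assume eq: "subst_poly (\<lambda>i. Const (l i) * Var i) P = Const c * P"
    show "\<forall>m\<in>Poly_Mapping.keys P. monom_eval l m = c"
    proof
      fix m assume m: "m \<in> Poly_Mapping.keys P"
      have "Poly_Mapping.lookup P m * monom_eval l m = c * Poly_Mapping.lookup P m"
        using arg_cong[OF eq, of "\<lambda>Q. Poly_Mapping.lookup Q m"] m
        unfolding C subst_poly_diag lookup_sum_single_keys by simp
      then show "monom_eval l m = c" using m by (simp add: in_keys_iff)
    qed
  next
    assume "\<forall>m\<in>Poly_Mapping.keys P. monom_eval l m = c"
    then show "subst_poly (\<lambda>i. Const (l i) * Var i) P = Const c * P"
      unfolding C subst_poly_diag by (intro sum.cong refl) (simp add: mult.commute)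
  qed
qed

lemma monom_eval_mult: "monom_eval (\<lambda>i. a i * b i) m = monom_eval a m * monom_eval b m"
  by (simp add: monom_eval_def power_mult_distrib prod.distrib)

lemma monom_eval_inverse: "monom_eval (\<lambda>i. inverse (a i)) m = inverse (monom_eval a m)"
  for a :: "nat \<Rightarrow> complex"
  using prod_inversef[of "\<lambda>i. a i ^ Poly_Mapping.lookup m i" "Poly_Mapping.keys m"]
  by (simp add: monom_eval_def power_inverse o_def)

lemma monom_eval_one: "monom_eval (\<lambda>i. 1) m = 1"
  by (simp add: monom_eval_def)

lemma diag_aut_group_subgroup: "subgroup (carrier (diag_aut_group n F)) (PGL n)"
proof -
  interpret PGL: group "PGL n" by (rule group_PGL)
  let ?ok = "\<lambda>l. (\<forall>i<n. l i \<noteq> 0) \<and> (\<exists>c. c \<noteq> 0 \<and> (\<forall>m\<in>Poly_Mapping.keys F. monom_eval l m = c))"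
  have car: "carrier (diag_aut_group n F) = {to_PGL n (mat_diag n l) |l. ?ok l}"
    by (simp add: diag_aut_group_def subst_poly_diag_eq_iff)
  have mult: "to_PGL n (mat_diag n l) \<otimes>\<^bsub>PGL n\<^esub> to_PGL n (mat_diag n l') = to_PGL n (mat_diag n (\<lambda>i. l i * l' i))"
    if "\<forall>i<n. l i \<noteq> 0" "\<forall>i<n. l' i \<noteq> 0" for l l'
    using that by (simp add: to_PGL_mult[symmetric] mat_diag_in_GL)
  have one: "to_PGL n (mat_diag n (\<lambda>i. 1)) = \<one>\<^bsub>PGL n\<^esub>" by (simp add: mat_diag_one to_PGL_one)
  show ?thesis unfolding car
  proof (rule subgroup.intro)
    show "{to_PGL n (mat_diag n l) |l. ?ok l} \<subseteq> carrier (PGL n)"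
      by (auto intro!: to_PGL_closed mat_diag_in_GL)
    show "\<one>\<^bsub>PGL n\<^esub> \<in> {to_PGL n (mat_diag n l) |l. ?ok l}"
      unfolding one[symmetric] by (rule CollectI, rule exI[of _ "\<lambda>i. 1"]) (auto simp: monom_eval_one intro: exI[of _ 1])
  next
    fix x y assume "x \<in> {to_PGL n (mat_diag n l) |l. ?ok l}" "y \<in> {to_PGL n (mat_diag n l) |l. ?ok l}"
    then obtain l l' c c' where x: "x = to_PGL n (mat_diag n l)" "\<forall>i<n. l i \<noteq> 0" "c \<noteq> 0" "\<forall>m\<in>Poly_Mapping.keys F. monom_eval l m = c"
      and y: "y = to_PGL n (mat_diag n l')" "\<forall>i<n. l' i \<noteq> 0" "c' \<noteq> 0" "\<forall>m\<in>Poly_Mapping.keys F. monom_eval l' m = c'"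
      by auto
    have "x \<otimes>\<^bsub>PGL n\<^esub> y = to_PGL n (mat_diag n (\<lambda>i. l i * l' i))" using x y mult by simp
    moreover have "?ok (\<lambda>i. l i * l' i)" using x y by (auto simp: monom_eval_mult intro!: exI[of _ "c * c'"])
    ultimately show "x \<otimes>\<^bsub>PGL n\<^esub> y \<in> {to_PGL n (mat_diag n l) |l. ?ok l}" by blast
  next
    fix x assume "x \<in> {to_PGL n (mat_diag n l) |l. ?ok l}"
    then obtain l c where x: "x = to_PGL n (mat_diag n l)" "\<forall>i<n. l i \<noteq> 0" "c \<noteq> 0" "\<forall>m\<in>Poly_Mapping.keys F. monom_eval l m = c"
      by auto
    have ok: "?ok (\<lambda>i. inverse (l i))" using x by (auto simp: monom_eval_inverse intro!: exI[of _ "inverse c"])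
    have "mat_diag n (\<lambda>i. inverse (l i) * l i) = mat_diag n (\<lambda>i. 1)"
      using x(2) by (intro eq_matI) (auto simp: mat_diag_def)
    then have "to_PGL n (mat_diag n (\<lambda>i. inverse (l i))) \<otimes>\<^bsub>PGL n\<^esub> x = \<one>\<^bsub>PGL n\<^esub>"
      using mult[of "\<lambda>i. inverse (l i)" l] x one by simp
    then have "inv\<^bsub>PGL n\<^esub> x = to_PGL n (mat_diag n (\<lambda>i. inverse (l i)))"
      by (rule PGL.inv_equality) (use x in \<open>auto intro!: to_PGL_closed mat_diag_in_GL\<close>)
    then show "inv\<^bsub>PGL n\<^esub> x \<in> {to_PGL n (mat_diag n l) |l. ?ok l}" using ok by blast
  qed
qed

text \<open>A one-dimensional complex representation, as a function that is constrained on the carrier only. Working with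
  characters instead of homomorphisms into matrices lets them be multiplied and raised to powers freely.\<close>

definition is_char :: "('a, 'b) monoid_scheme \<Rightarrow> ('a \<Rightarrow> complex) \<Rightarrow> bool" where
  "is_char G \<chi> \<longleftrightarrow> (\<forall>g\<in>carrier G. \<chi> g \<noteq> 0) \<and>
     (\<forall>g\<in>carrier G. \<forall>h\<in>carrier G. \<chi> (g \<otimes>\<^bsub>G\<^esub> h) = \<chi> g * \<chi> h)"

text \<open>How embeddings into $G_F$ are produced: by $n$ characters for which all monomials of $F$ have the same weight
  \<^term>\<open>c\<close>. The action on projective space is faithful when only the identity acts by a scalar.\<close>

lemma iso_to_subgroup_diag_aut_groupI:
  assumes G: "group G"
    and char: "\<And>i. i < n \<Longrightarrow> is_char G (\<Lambda> i)"
    and semi: "\<And>g m. g \<in> carrier G \<Longrightarrow> m \<in> Poly_Mapping.keys F \<Longrightarrow> monom_eval (\<lambda>i. \<Lambda> i g) m = c g"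
    and c: "\<And>g. g \<in> carrier G \<Longrightarrow> c g \<noteq> 0"
    and inj: "\<And>g. g \<in> carrier G \<Longrightarrow> (\<And>i j. i < n \<Longrightarrow> j < n \<Longrightarrow> \<Lambda> i g = \<Lambda> j g) \<Longrightarrow> g = \<one>\<^bsub>G\<^esub>"
  shows "iso_to_subgroup G (diag_aut_group n F)"
proof -
  interpret G: group G by (rule G)
  let ?H = "diag_aut_group n F"
  define \<Theta> where "\<Theta> g = to_PGL n (mat_diag n (\<lambda>i. \<Lambda> i g))" for g
  have nz: "\<Lambda> i g \<noteq> 0" if "i < n" "g \<in> carrier G" for i g
    using char[OF that(1)] that(2) by (simp add: is_char_def)
  have GL: "mat_diag n (\<lambda>i. \<Lambda> i g) \<in> carrier (GL n)" if "g \<in> carrier G" for g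
    by (rule mat_diag_in_GL) (use nz that in auto)
  have H: "group ?H"
    using subgroup.subgroup_is_group[OF diag_aut_group_subgroup group_PGL, of n F]
    by (simp add: diag_aut_group_def)
  have \<Theta>_mult: "\<Theta> (g \<otimes>\<^bsub>G\<^esub> h) = \<Theta> g \<otimes>\<^bsub>?H\<^esub> \<Theta> h" if "g \<in> carrier G" "h \<in> carrier G" for g h
  proof -
    have "mat_diag n (\<lambda>i. \<Lambda> i (g \<otimes>\<^bsub>G\<^esub> h)) = mat_diag n (\<lambda>i. \<Lambda> i g * \<Lambda> i h)"
      using char that by (intro eq_matI) (auto simp: mat_diag_def is_char_def)
    then have "\<Theta> (g \<otimes>\<^bsub>G\<^esub> h) = \<Theta> g \<otimes>\<^bsub>PGL n\<^esub> \<Theta> h"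
      using to_PGL_mult[OF GL[OF that(1)] GL[OF that(2)]] by (simp add: \<Theta>_def)
    then show ?thesis by (simp add: diag_aut_group_def)
  qed
  have \<Theta>_closed: "\<Theta> g \<in> carrier ?H" if "g \<in> carrier G" for g
    using that nz c[OF that] semi[OF that]
    by (auto simp: diag_aut_group_def subst_poly_diag_eq_iff \<Theta>_def intro!: exI[of _ "\<lambda>i. \<Lambda> i g"] exI[of _ "c g"])
  have hom: "\<Theta> \<in> hom G ?H" using \<Theta>_mult \<Theta>_closed by (auto simp: hom_def)
  interpret \<Theta>: group_hom G ?H \<Theta>
    by (intro group_hom.intro group_hom_axioms.intro G H hom)
  have "kernel G ?H \<Theta> = {\<one>\<^bsub>G\<^esub>}"
  proof
    show "kernel G ?H \<Theta> \<subseteq> {\<one>\<^bsub>G\<^esub>}"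
    proof
      fix g assume "g \<in> kernel G ?H \<Theta>"
      then have g: "g \<in> carrier G" and "\<Theta> g = \<one>\<^bsub>?H\<^esub>" by (auto simp: kernel_def)
      then have "to_PGL n (mat_diag n (\<lambda>i. \<Lambda> i g)) = to_PGL n (1\<^sub>m n)"
        by (simp add: \<Theta>_def to_PGL_one) (simp add: diag_aut_group_def)
      moreover have "1\<^sub>m n \<in> carrier (GL n)" using group.is_monoid[OF group_GL] monoid.one_closed GL_one by metis
      ultimately obtain a where a: "mat_diag n (\<lambda>i. \<Lambda> i g) = a \<cdot>\<^sub>m 1\<^sub>m n"
        using to_PGL_eqD[OF GL[OF g]] by blast
      have "\<Lambda> i g = a" if "i < n" for i
        using arg_cong[OF a, of "\<lambda>M. M $$ (i, i)"] that by (simp add: mat_diag_def)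
      then show "g \<in> {\<one>\<^bsub>G\<^esub>}" using inj[OF g] by simp
    qed
  qed (auto simp: kernel_def)
  then have "inj_on \<Theta> (carrier G)" using \<Theta>.inj_iff_trivial_ker by blast
  then have "\<Theta> \<in> iso G (?H\<lparr>carrier := \<Theta> ` carrier G\<rparr>)"
    using \<Theta>_mult by (auto simp: iso_def hom_def bij_betw_def)
  then show ?thesis
    unfolding iso_to_subgroup_def is_iso_def using \<Theta>.img_is_subgroup by blast
qed

section \<open>Sums of cycles and paths\<close>

definition arrow_monom :: "nat \<Rightarrow> nat \<Rightarrow> nat \<Rightarrow> (nat \<Rightarrow>\<^sub>0 nat)" where
  "arrow_monom d i j = Poly_Mapping.single i (d - 1) + Poly_Mapping.single j 1"

text \<open>The components $K_k$ and $T_k$ are both of this shape, $f$ being a cyclic permutation in the first case and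
  in the second a path that ends in a fixed point; the last term $x_k^d$ of $T_k$ counts as
  $x_k^{d-1} x_k$.\<close>

definition arrow_poly :: "nat \<Rightarrow> nat set \<Rightarrow> (nat \<Rightarrow> nat) \<Rightarrow> cpoly" where
  "arrow_poly d S f = (\<Sum>i\<in>S. Var i ^ (d - 1) * Var (f i))"

lemma Var_power: "Var i ^ k = Poly_Mapping.single (Poly_Mapping.single i k) 1"
  using subst_monomial[of "\<lambda>_. 1" "\<lambda>_. k" "{i}"] by (simp add: Const_def)

lemma arrow_term: "Var i ^ (d - 1) * Var j = Poly_Mapping.single (arrow_monom d i j) 1"
  by (simp only: Var_power) (simp add: Var_def mult_single arrow_monom_def)

lemma keys_sum_single:
  assumes "finite A"
  shows "Poly_Mapping.keys (\<Sum>i\<in>A. Poly_Mapping.single (m i) (1::complex)) = m ` A"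
proof -
  have "Poly_Mapping.lookup (\<Sum>i\<in>A. Poly_Mapping.single (m i) (1::complex)) k
      = of_nat (card {i\<in>A. m i = k})" for k
  proof -
    have "Poly_Mapping.lookup (\<Sum>i\<in>A. Poly_Mapping.single (m i) (1::complex)) k
        = (\<Sum>i\<in>A. if m i = k then 1 else 0)"
      unfolding lookup_sum by (intro sum.cong) (auto simp: lookup_single when_def)
    also have "\<dots> = (\<Sum>i\<in>{i\<in>A. m i = k}. 1)"
      by (rule sum.inter_filter[symmetric]) (rule assms)
    finally show ?thesis by simp
  qed
  moreover have "card {i\<in>A. m i = k} = 0 \<longleftrightarrow> k \<notin> m ` A" for k
    using assms by auto
  ultimately show ?thesis by (auto simp: in_keys_iff)
qed

lemma keys_arrow_poly:
  "finite S \<Longrightarrow> Poly_Mapping.keys (arrow_poly d S f) = (\<lambda>i. arrow_monom d i (f i)) ` S"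
  unfolding arrow_poly_def arrow_term by (rule keys_sum_single)

lemma lookup_arrow_monom:
  "Poly_Mapping.lookup (arrow_monom d i j) k = (if k = i then d - 1 else 0) + (if k = j then 1 else 0)"
  by (simp add: arrow_monom_def lookup_add lookup_single when_def)

lemma keys_arrow_monom: "d \<ge> 2 \<Longrightarrow> Poly_Mapping.keys (arrow_monom d i j) = {i, j}"
  by (auto simp: in_keys_iff lookup_arrow_monom split: if_splits)

lemma monom_eval_arrow_monom: "monom_eval l (arrow_monom d i j) = l i ^ (d - 1) * l j"
proof -
  have "monom_eval l (arrow_monom d i j)
      = (\<Prod>k\<in>{i, j}. l k ^ Poly_Mapping.lookup (arrow_monom d i j) k)"
    by (rule monom_eval_superset) (auto simp: in_keys_iff lookup_arrow_monom split: if_splits)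
  then show ?thesis
    by (cases "i = j") (simp_all add: lookup_arrow_monom power_add mult.commute)
qed

lemma vars_arrow_poly:
  assumes "finite S" "f ` S \<subseteq> S" "d \<ge> 2"
  shows "vars (arrow_poly d S f) = S"
  using assms by (auto simp: vars_def keys_arrow_poly keys_arrow_monom)

lemma arrow_monom_inj:
  assumes "d \<ge> 3" "arrow_monom d i j = arrow_monom d i' j'"
  shows "i = i' \<and> j = j'"
proof -
  have eq: "(if k = i then d - 1 else 0) + (if k = j then 1 else 0)
      = (if k = i' then d - 1 else 0) + (if k = j' then 1 else (0::nat))" for k
    using arg_cong[OF assms(2), of "\<lambda>m. Poly_Mapping.lookup m k"] by (simp add: lookup_arrow_monom)
  have "i = i'" using eq[of i] assms(1) by (auto split: if_splits)
  moreover from this have "j = j'" using eq[of j] by (auto split: if_splits)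
  ultimately show ?thesis by simp
qed

lemma funpow_closed: "f ` S \<subseteq> S \<Longrightarrow> x \<in> S \<Longrightarrow> (f ^^ n) x \<in> S"
  by (induction n) auto

lemma funpow_inj_on_cancel:
  assumes "inj_on f S" "f ` S \<subseteq> S" "x \<in> S" "(f ^^ i) x = (f ^^ (i + n)) x"
  shows "(f ^^ n) x = x"
  using assms(4)
proof (induction i)
  case (Suc i)
  then have "(f ^^ i) x = (f ^^ (i + n)) x"
    using inj_onD[OF assms(1)] funpow_closed[OF assms(2,3)] by simp
  then show ?case by (rule Suc.IH)
qed simp

text \<open>The orbit lies in the finite set $S$, so it returns; by injectivity it returns to its starting point.\<close>

lemma funpow_period:
  assumes "finite S" "inj_on f S" "f ` S \<subseteq> S" "x \<in> S"
  obtains n where "n \<ge> 1" "(f ^^ n) x = x"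
proof -
  have "(\<lambda>i. (f ^^ i) x) ` UNIV \<subseteq> S" using funpow_closed[OF assms(3,4)] by auto
  then have "\<not> inj (\<lambda>i. (f ^^ i) x)"
    using assms(1) finite_subset finite_imageD infinite_UNIV_nat by blast
  then obtain i j where "i < j" "(f ^^ i) x = (f ^^ j) x"
    unfolding inj_on_def by (metis UNIV_I nat_neq_iff)
  then have "(f ^^ (j - i)) x = x"
    using funpow_inj_on_cancel[OF assms(2-4), of i "j - i"] by simp
  moreover have "j - i \<ge> 1" using \<open>i < j\<close> by simp
  ultimately show thesis using that by blast
qed

text \<open>For $k \ge 2$ the end of $T_k$ has two monomials $x^{d-1}y$ and $y^d$ with the same target $y$, whereas in $K_k$
  each variable is the target of one monomial only.\<close>

lemma type_K_not_type_T:
  assumes "d \<ge> 3" "type_K d k P" "type_T d l P" "l \<ge> 2"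
  shows False
proof -
  obtain x where x: "inj_on x {..<k}" "P = (\<Sum>i<k. Var (x i) ^ (d - 1) * Var (x ((i + 1) mod k)))"
    and k: "k \<ge> 1"
    using assms(2) by (auto simp: type_K_def)
  obtain y where y: "inj_on y {..<l}"
    "P = (\<Sum>i<l - 1. Var (y i) ^ (d - 1) * Var (y (i + 1))) + Var (y (l - 1)) ^ d"
    using assms(3) by (auto simp: type_T_def)
  have keysK: "Poly_Mapping.keys P = (\<lambda>i. arrow_monom d (x i) (x ((i + 1) mod k))) ` {..<k}"
    unfolding x(2) arrow_term by (rule keys_sum_single) simp
  define z where "z i = (if i = l - 1 then y i else y (i + 1))" for i
  have "Var (y (l - 1)) ^ d = Var (y (l - 1)) ^ (d - 1) * Var (y (l - 1))"
    using assms(1) by (simp flip: power_Suc2)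
  moreover have "{..<l} = insert (l - 1) {..<l - 1}" using assms(4) by auto
  ultimately have "P = (\<Sum>i<l. Var (y i) ^ (d - 1) * Var (z i))"
    unfolding y(2) by (simp add: z_def add.commute)
  then have keysT: "Poly_Mapping.keys P = (\<lambda>i. arrow_monom d (y i) (z i)) ` {..<l}"
    unfolding arrow_term by (simp add: keys_sum_single)
  have "arrow_monom d (y (l - 2)) (y (l - 1)) \<in> Poly_Mapping.keys P"
    unfolding keysT using assms(4) by (intro image_eqI[of _ _ "l - 2"]) (auto simp: z_def Suc_diff_Suc numeral_2_eq_2)
  then obtain i where i0: "i < k"
    "arrow_monom d (y (l - 2)) (y (l - 1)) = arrow_monom d (x i) (x ((i + 1) mod k))"
    unfolding keysK by auto
  then have i: "i < k" "y (l - 2) = x i" "y (l - 1) = x ((i + 1) mod k)"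
    using arrow_monom_inj[OF assms(1) i0(2)] by simp_all
  have "arrow_monom d (y (l - 1)) (y (l - 1)) \<in> Poly_Mapping.keys P"
    unfolding keysT using assms(4) by (intro image_eqI[of _ _ "l - 1"]) (auto simp: z_def)
  then obtain j where j0: "j < k"
    "arrow_monom d (y (l - 1)) (y (l - 1)) = arrow_monom d (x j) (x ((j + 1) mod k))"
    unfolding keysK by auto
  then have j: "j < k" "y (l - 1) = x j" "y (l - 1) = x ((j + 1) mod k)"
    using arrow_monom_inj[OF assms(1) j0(2)] by simp_all
  have mod_j: "(j + 1) mod k = j"
  proof (rule inj_onD[OF x(1)])
    show "x ((j + 1) mod k) = x j" using j(2,3) by metis
  qed (use j(1) k in simp_all)
  have "\<not> j + 1 < k"
  proof
    assume "j + 1 < k"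
    then have "(j + 1) mod k = j + 1" by (rule mod_less)
    then show False using mod_j by linarith
  qed
  then have jk: "j + 1 = k" using j(1) by linarith
  then have "j = 0" using mod_j by (metis mod_self)
  then have "i = j" using jk i(1) by linarith
  then have "y (l - 2) = y (l - 1)" using i(2) j(2) by simp
  then show False using inj_onD[OF y(1), of "l - 2" "l - 1"] assms(4) by auto
qed

text \<open>A permutation is a product of disjoint cycles; the orbit of one point is split off and the induction
  hypothesis is applied to the rest.\<close>

lemma arrow_poly_cycles:
  assumes "d \<ge> 2" "finite S" "inj_on f S" "f ` S \<subseteq> S"
  shows "\<exists>C. finite C \<and> (\<forall>P\<in>C. \<exists>k. type_K d k P) \<and> disjoint_family_on vars C \<and>
     (\<Union>P\<in>C. vars P) = S \<and> arrow_poly d S f = (\<Sum>P\<in>C. P)"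
  using assms(2-4)
proof (induction "card S" arbitrary: S rule: less_induct)
  case less
  show ?case
  proof (cases "S = {}")
    case True
    then show ?thesis by (intro exI[of _ "{}"]) (auto simp: disjoint_family_on_def arrow_poly_def)
  next
    case False
    then obtain x where x: "x \<in> S" by blast
    obtain n where "n \<ge> 1 \<and> (f ^^ n) x = x"
      using funpow_period[OF less.prems x] by blast
    then obtain k where k: "k \<ge> 1" "(f ^^ k) x = x" and least: "\<And>n. n \<ge> 1 \<Longrightarrow> (f ^^ n) x = x \<Longrightarrow> k \<le> n"
      using LeastI[of "\<lambda>n. n \<ge> 1 \<and> (f ^^ n) x = x"] Least_le[of "\<lambda>n. n \<ge> 1 \<and> (f ^^ n) x = x"] by blast
    define Orb where "Orb = (\<lambda>i. (f ^^ i) x) ` {..<k}"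
    have inj: "inj_on (\<lambda>i. (f ^^ i) x) {..<k}"
    proof (rule linorder_inj_onI)
      fix i j assume ij: "i < j" "i \<in> {..<k}" "j \<in> {..<k}"
      show "(f ^^ i) x \<noteq> (f ^^ j) x"
      proof
        assume "(f ^^ i) x = (f ^^ j) x"
        then have "(f ^^ (j - i)) x = x"
          using funpow_inj_on_cancel[OF less.prems(2,3) x, of i "j - i"] ij(1) by simp
        then have "k \<le> j - i" using least[of "j - i"] ij by simp
        then show False using ij by auto
      qed
    qed auto
    have nxt: "f ((f ^^ i) x) = (f ^^ ((i + 1) mod k)) x" if "i < k" for i
      using that k by (cases "i + 1 = k") auto
    have Orb: "Orb \<subseteq> S" "finite Orb" "x \<in> Orb" "f ` Orb \<subseteq> Orb"
      using funpow_closed[OF less.prems(3) x] k(1) nxt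
      by (auto simp: Orb_def image_iff intro: bexI[of _ 0])
    have pre: "y \<in> Orb" if y: "y \<in> S" "f y \<in> Orb" for y
    proof -
      obtain i where i: "i < k" "f y = (f ^^ i) x" using y(2) by (auto simp: Orb_def)
      have "f y = f ((f ^^ ((i + k - 1) mod k)) x)"
      proof (cases i)
        case 0
        then show ?thesis using nxt[of "k - 1"] i k(1) by simp
      next
        case (Suc i')
        then show ?thesis using i by simp
      qed
      then have "y = (f ^^ ((i + k - 1) mod k)) x"
        using inj_onD[OF less.prems(2)] y(1) funpow_closed[OF less.prems(3) x] by blast
      then show ?thesis using k(1) by (auto simp: Orb_def)
    qed
    have K: "type_K d k (arrow_poly d Orb f)"
      unfolding type_K_def
    proof (intro conjI exI[of _ "\<lambda>i. (f ^^ i) x"] k(1) inj)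
      show "arrow_poly d Orb f = (\<Sum>i<k. Var ((f ^^ i) x) ^ (d - 1) * Var ((f ^^ ((i + 1) mod k)) x))"
        unfolding arrow_poly_def Orb_def sum.reindex[OF inj] by (rule sum.cong) (auto simp: nxt)
    qed
    have "card (S - Orb) < card S" using Orb x less.prems(1) by (intro psubset_card_mono) auto
    moreover have "f ` (S - Orb) \<subseteq> S - Orb" using less.prems(3) pre by auto
    moreover have "inj_on f (S - Orb)" using less.prems(2) by (rule inj_on_subset) auto
    ultimately obtain C where C: "finite C" "\<forall>P\<in>C. \<exists>k. type_K d k P" "disjoint_family_on vars C"
      "(\<Union>P\<in>C. vars P) = S - Orb" "arrow_poly d (S - Orb) f = (\<Sum>P\<in>C. P)"
      using less.hyps[of "S - Orb"] less.prems(1) by auto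
    have vO: "vars (arrow_poly d Orb f) = Orb" by (rule vars_arrow_poly) (use Orb assms(1) in auto)
    then have notin: "arrow_poly d Orb f \<notin> C" using C(4) Orb(3) by blast
    have "arrow_poly d S f = arrow_poly d Orb f + arrow_poly d (S - Orb) f"
      unfolding arrow_poly_def using sum.subset_diff[OF Orb(1) less.prems(1)] by (simp only: add.commute)
    then have "arrow_poly d S f = (\<Sum>P\<in>insert (arrow_poly d Orb f) C. P)"
      using notin C(1,5) by simp
    moreover have "disjoint_family_on vars (insert (arrow_poly d Orb f) C)"
      using C(3,4) vO by (auto simp: disjoint_family_on_def)
    moreover have "(\<Union>P\<in>insert (arrow_poly d Orb f) C. vars P) = S"
      using C(4) vO Orb(1) by auto
    moreover have "\<exists>k. type_K d k P" if "P \<in> insert (arrow_poly d Orb f) C" for P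
      using that C(2) K by auto
    ultimately show ?thesis
      by (intro exI[of _ "insert (arrow_poly d Orb f) C"] conjI ballI finite.insertI C(1))
  qed
qed

lemma simple_components_cycles:
  assumes "d \<ge> 3" "inj_on f {..<n}" "f ` {..<n} \<subseteq> {..<n}"
  shows "\<exists>C. simple_components d n (arrow_poly d {..<n} f) C \<and> card (T_ge2_components d C) = 0"
proof -
  have d2: "d \<ge> 2" using assms(1) by simp
  obtain C where C: "finite C" "\<forall>P\<in>C. \<exists>k. type_K d k P" "disjoint_family_on vars C"
      "(\<Union>P\<in>C. vars P) = {..<n}" "arrow_poly d {..<n} f = (\<Sum>P\<in>C. P)"
    using arrow_poly_cycles[OF d2 finite_lessThan assms(2,3)]
    by (elim exE conjE) (rule that)
  have "T_ge2_components d C = {}"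
  proof -
    have False if "P \<in> C" "l \<ge> 2" "type_T d l P" for P l
    proof -
      obtain k where "type_K d k P" using C(2) \<open>P \<in> C\<close> by auto
      then show False using that(3,2) by (rule type_K_not_type_T[OF assms(1)])
    qed
    then show ?thesis unfolding T_ge2_components_def by auto
  qed
  moreover have "simple_components d n (arrow_poly d {..<n} f) C"
    unfolding simple_components_def
  proof (intro conjI C(1,3,4,5) ballI)
    show "\<exists>k. type_K d k P \<or> type_T d k P" if "P \<in> C" for P
      using C(2) that by auto
  qed
  ultimately show ?thesis by (intro exI[of _ C] conjI) simp_all
qed

text \<open>The indices below $n$ carry the cycles and those from $n$ to $n + s$ the path. The path is the only component
  of type $T_{\ge 2}$.\<close>

lemma simple_components_cycles_path:
  assumes "d \<ge> 3" "inj_on f {..<n}" "f ` {..<n} \<subseteq> {..<n}" "s \<ge> 1"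
    and path: "\<And>t. t < s \<Longrightarrow> f (n + t) = n + t + 1" "f (n + s) = n + s"
  shows "\<exists>C. simple_components d (n + s + 1) (arrow_poly d {..<n + s + 1} f) C \<and>
    card (T_ge2_components d C) = 1"
proof -
  have d2: "d \<ge> 2" using assms(1) by simp
  obtain C where C: "finite C" "\<forall>P\<in>C. \<exists>k. type_K d k P" "disjoint_family_on vars C"
      "(\<Union>P\<in>C. vars P) = {..<n}" "arrow_poly d {..<n} f = (\<Sum>P\<in>C. P)"
    using arrow_poly_cycles[OF d2 finite_lessThan assms(2,3)]
    by (elim exE conjE) (rule that)
  define T where "T = arrow_poly d {n..n + s} f"
  have T: "type_T d (s + 1) T"
    unfolding type_T_def
  proof (intro conjI exI[of _ "\<lambda>i. n + i"])
    have "T = (\<Sum>i<s + 1. Var (n + i) ^ (d - 1) * Var (f (n + i)))"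
      unfolding T_def arrow_poly_def
      by (rule sum.reindex_bij_witness[of _ "\<lambda>i. n + i" "\<lambda>i. i - n"]) auto
    also have "\<dots> = (\<Sum>i<s. Var (n + i) ^ (d - 1) * Var (n + i + 1)) + Var (n + s) ^ (d - 1) * Var (n + s)"
      by (simp add: path)
    also have "Var (n + s) ^ (d - 1) * Var (n + s) = Var (n + s) ^ d"
      using assms(1) by (simp flip: power_Suc2)
    finally show "T = (\<Sum>i<s + 1 - 1. Var (n + i) ^ (d - 1) * Var (n + (i + 1))) + Var (n + (s + 1 - 1)) ^ d"
      by (simp add: add.assoc)
  qed auto
  have "f ` {n..n + s} \<subseteq> {n..n + s}"
  proof
    fix y assume "y \<in> f ` {n..n + s}"
    then obtain i where i: "n \<le> i" "i \<le> n + s" "y = f i" by auto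
    then obtain t where t: "i = n + t" "t \<le> s" using that[of "i - n"] by simp
    then show "y \<in> {n..n + s}" using i(3) path by (cases "t = s") auto
  qed
  then have vT: "vars T = {n..n + s}"
    unfolding T_def by (intro vars_arrow_poly) (use assms(1) in auto)
  have notin: "T \<notin> C"
  proof
    assume "T \<in> C"
    moreover have "n \<in> vars T" unfolding vT by simp
    ultimately have "n \<in> {..<n}" using C(4) by blast
    then show False by simp
  qed
  have split: "{..<n + s + 1} = {..<n} \<union> {n..n + s}" by auto
  have "arrow_poly d {..<n + s + 1} f = arrow_poly d {..<n} f + T"
    unfolding arrow_poly_def T_def split by (rule sum.union_disjoint) auto
  also have "\<dots> = (\<Sum>P\<in>insert T C. P)"
    unfolding sum.insert[OF C(1) notin] C(5)[symmetric] by (rule add.commute)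
  finally have "arrow_poly d {..<n + s + 1} f = (\<Sum>P\<in>insert T C. P)" .
  moreover have "disjoint_family_on vars (insert T C)"
    unfolding disjoint_family_on_def
  proof (intro ballI impI)
    fix P Q assume PQ: "P \<in> insert T C" "Q \<in> insert T C" "P \<noteq> Q"
    have "vars R \<inter> vars T = {}" if "R \<in> C" for R
    proof -
      have "vars R \<subseteq> {..<n}" using UN_upper[of R C vars] that C(4) by simp
      moreover have "{..<n} \<inter> {n..n + s} = {}" by auto
      ultimately show ?thesis unfolding vT by blast
    qed
    then show "vars P \<inter> vars Q = {}"
      using PQ disjoint_family_onD[OF C(3), of P Q] by (metis insert_iff inf_commute)
  qed
  moreover have "(\<Union>P\<in>insert T C. vars P) = {..<n + s + 1}"
    using C(4) vT by auto
  moreover have "\<forall>P\<in>insert T C. \<exists>k. type_K d k P \<or> type_T d k P" using C(2) T by auto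
  ultimately have "simple_components d (n + s + 1) (arrow_poly d {..<n + s + 1} f) (insert T C)"
    unfolding simple_components_def using C(1) by (intro conjI finite.insertI)
  moreover have "T_ge2_components d (insert T C) = {T}"
  proof -
    have 1: "\<exists>k\<ge>2. type_T d k T"
    proof (intro exI conjI)
      show "type_T d (s + 1) T" by (rule T)
      show "2 \<le> s + 1" using assms(4) by simp
    qed
    have 2: "\<not> (\<exists>k\<ge>2. type_T d k P)" if "P \<in> C" for P
    proof
      assume "\<exists>k\<ge>2. type_T d k P"
      then obtain l where l: "l \<ge> 2" "type_T d l P" by auto
      obtain k where "type_K d k P" using C(2) \<open>P \<in> C\<close> by auto
      then show False using l(2,1) by (rule type_K_not_type_T[OF assms(1)])
    qed
    have "P \<in> insert T C \<and> (\<exists>k\<ge>2. type_T d k P) \<longleftrightarrow> P = T" for P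
      using 1 2[of P] by (metis insert_iff)
    then show ?thesis unfolding T_ge2_components_def by simp
  qed
  ultimately show ?thesis by (intro exI[of _ "insert T C"]) simp
qed

section \<open>Common eigenbases\<close>

text \<open>Vectors are functions on the naturals with the coordinates from $N$ on set to $0$. This avoids carrier
  conditions in sums of vectors.\<close>

definition mat_act :: "nat \<Rightarrow> complex mat \<Rightarrow> (nat \<Rightarrow> complex) \<Rightarrow> nat \<Rightarrow> complex" where
  "mat_act N M v = (\<lambda>i. if i < N then \<Sum>k<N. M $$ (i, k) * v k else 0)"

lemma mat_act_linear: "mat_act N M (\<lambda>i. a i + t * v i) = (\<lambda>i. mat_act N M a i + t * mat_act N M v i)"
  by (rule ext) (simp add: mat_act_def sum.distrib sum_distrib_left distrib_left mult.left_commute)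

lemma mat_act_sum:
  "mat_act N M (\<lambda>i. \<Sum>k\<in>K. c k * v k i) = (\<lambda>i. \<Sum>k\<in>K. c k * mat_act N M (v k) i)"
proof
  fix i
  have "(\<Sum>l<N. M $$ (i, l) * (\<Sum>k\<in>K. c k * v k l)) = (\<Sum>l<N. \<Sum>k\<in>K. c k * (M $$ (i, l) * v k l))"
    by (simp add: sum_distrib_left mult.left_commute)
  also have "\<dots> = (\<Sum>k\<in>K. c k * (\<Sum>l<N. M $$ (i, l) * v k l))"
    by (subst sum.swap) (simp add: sum_distrib_left)
  finally show "mat_act N M (\<lambda>i. \<Sum>k\<in>K. c k * v k i) i = (\<Sum>k\<in>K. c k * mat_act N M (v k) i)"
    by (simp add: mat_act_def)
qed

lemma mat_act_smult: "mat_act N M (\<lambda>i. c * v i) = (\<lambda>i. c * mat_act N M v i)"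
  using mat_act_sum[of N M "\<lambda>_. c" "\<lambda>_. v" "{0::nat}"] by simp

lemma mat_act_cong: "(\<And>i. i < N \<Longrightarrow> x i = y i) \<Longrightarrow> mat_act N M x = mat_act N M y"
  unfolding mat_act_def by (intro ext if_cong sum.cong refl) simp

lemma mat_act_mult:
  assumes "A \<in> carrier_mat N N" "B \<in> carrier_mat N N"
  shows "mat_act N (A * B) v = mat_act N A (mat_act N B v)"
proof
  fix i
  show "mat_act N (A * B) v i = mat_act N A (mat_act N B v) i"
  proof (cases "i < N")
    case True
    have "(\<Sum>k<N. (A * B) $$ (i, k) * v k) = (\<Sum>k<N. \<Sum>l<N. A $$ (i, l) * (B $$ (l, k) * v k))"
    proof (rule sum.cong)
      fix k assume "k \<in> {..<N}"
      then have "(A * B) $$ (i, k) = (\<Sum>l<N. A $$ (i, l) * B $$ (l, k))"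
        using assms True by (simp add: scalar_prod_def lessThan_atLeast0)
      then show "(A * B) $$ (i, k) * v k = (\<Sum>l<N. A $$ (i, l) * (B $$ (l, k) * v k))"
        by (simp add: sum_distrib_right mult.assoc)
    qed simp
    also have "\<dots> = (\<Sum>l<N. A $$ (i, l) * (\<Sum>k<N. B $$ (l, k) * v k))"
      by (subst sum.swap) (simp add: sum_distrib_left)
    finally show ?thesis using True by (simp add: mat_act_def)
  qed (simp add: mat_act_def)
qed

definition supp_below :: "nat \<Rightarrow> (nat \<Rightarrow> complex) \<Rightarrow> bool" where
  "supp_below N v \<longleftrightarrow> (\<forall>i\<ge>N. v i = 0)"

lemma supp_below_mat_act: "supp_below N (mat_act N M v)"
  by (simp add: supp_below_def mat_act_def)

lemma mat_act_one: "supp_below N v \<Longrightarrow> mat_act N (1\<^sub>m N) v = v"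
proof
  fix i assume v: "supp_below N v"
  have "(\<Sum>k<N. 1\<^sub>m N $$ (i, k) * v k) = (\<Sum>k<N. if k = i then v k else 0)" if "i < N"
    by (rule sum.cong) (use that in auto)
  then show "mat_act N (1\<^sub>m N) v i = v i" using v by (simp add: mat_act_def supp_below_def)
qed

lemma sum_roots_of_unity:
  assumes "n > 0" "k < n"
  shows "(\<Sum>j<n. cis (2 * pi / real n) ^ (j * k)) = (if k = 0 then of_nat n else 0)"
proof (cases "k = 0")
  case False
  let ?z = "cis (2 * pi / real n) ^ k"
  have z: "?z = cis (2 * pi * real k / real n)" by (simp add: DeMoivre mult.commute)
  have "?z \<noteq> 1"
  proof
    assume "?z = 1"
    then have "cis (2 * pi * real k / real n) = cis (2 * pi * real 0 / real n)" using z by simp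
    moreover have "inj_on (\<lambda>k. cis (2 * pi * real k / real n)) {..<n}"
      using bij_betw_roots_unity[OF assms(1)] by (rule bij_betw_imp_inj_on)
    ultimately have "k = 0" using inj_onD[of "\<lambda>k. cis (2 * pi * real k / real n)" "{..<n}" k 0] assms by simp
    then show False using False by simp
  qed
  have "?z ^ n = cis (real n * (2 * pi * real k / real n))" unfolding z by (rule DeMoivre)
  also have "\<dots> = cis (2 * pi * real k)" using assms(1) by simp
  also have "\<dots> = 1" by (rule cis_multiple_2pi) simp
  finally have "?z ^ n = 1" .
  then have "(\<Sum>j<n. ?z ^ j) = 0" using geometric_sum[OF \<open>?z \<noteq> 1\<close>, of n] by simp
  then show ?thesis using False by (simp add: power_mult[symmetric] mult.commute)
qed simp

text \<open>The functional with coefficients $c$ need not be an eigenvector, but if it does not vanish at $v$, then it does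
  not vanish at some common eigenvector. For one $g$ of order dividing $n$ the vectors
  $\sum_k \omega^{jk} g^k v$ with $\omega = e^{2\pi i/n}$ are eigenvectors that add up to $nv$; the elements treated before
  keep their eigenvalue because $G$ is commutative.\<close>

lemma common_eigenvector:
  assumes G: "comm_group G" "finite (carrier G)"
    and car: "\<And>g. g \<in> carrier G \<Longrightarrow> \<sigma> g \<in> carrier_mat N N"
    and mult: "\<And>g h. g \<in> carrier G \<Longrightarrow> h \<in> carrier G \<Longrightarrow> \<sigma> (g \<otimes>\<^bsub>G\<^esub> h) = \<sigma> g * \<sigma> h"
    and one: "\<sigma> \<one>\<^bsub>G\<^esub> = 1\<^sub>m N"
    and v: "supp_below N v" "(\<Sum>i<N. c i * v i) \<noteq> 0"
  shows "\<exists>w. supp_below N w \<and> (\<Sum>i<N. c i * w i) \<noteq> 0 \<and>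
    (\<forall>g\<in>carrier G. \<exists>\<mu>. mat_act N (\<sigma> g) w = (\<lambda>i. \<mu> * w i))"
proof -
  interpret comm_group G by (rule G)
  have "\<exists>w. supp_below N w \<and> (\<Sum>i<N. c i * w i) \<noteq> 0 \<and>
    (\<forall>g\<in>S. \<exists>\<mu>. mat_act N (\<sigma> g) w = (\<lambda>i. \<mu> * w i))" if "finite S" "S \<subseteq> carrier G" for S
    using that
  proof (induction S rule: finite_induct)
    case empty
    then show ?case using v by (intro exI[of _ v]) simp
  next
    case (insert g S)
    obtain w where w: "supp_below N w" "(\<Sum>i<N. c i * w i) \<noteq> 0"
      "\<And>h. h \<in> S \<Longrightarrow> \<exists>\<mu>. mat_act N (\<sigma> h) w = (\<lambda>i. \<mu> * w i)"
      using insert.IH insert.prems by auto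
    have g: "g \<in> carrier G" using insert.prems by simp
    define n where "n = Coset.order G"
    have n: "n > 0" using G(2) unfolding n_def order_gt_0_iff_finite .
    define a where "a k = mat_act N (\<sigma> (g [^]\<^bsub>G\<^esub> (k::nat))) w" for k
    define \<omega> where "\<omega> = cis (2 * pi / real n)"
    have \<omega>0: "\<omega> \<noteq> 0" by (simp add: \<omega>_def)
    have \<omega>n: "\<omega> ^ n = 1"
    proof -
      have "\<omega> ^ n = cis (real n * (2 * pi / real n))" unfolding \<omega>_def by (rule DeMoivre)
      also have "\<dots> = cis (2 * pi)" using n by simp
      finally show ?thesis by simp
    qed
    have a0: "a 0 = w" by (simp add: a_def one mat_act_one[OF w(1)])
    have an: "a n = w" using pow_order_eq_1[OF g] by (simp add: a_def n_def one mat_act_one[OF w(1)])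
    have aSuc: "mat_act N (\<sigma> g) (a k) = a (Suc k)" for k
    proof -
      have "g [^]\<^bsub>G\<^esub> Suc k = g \<otimes>\<^bsub>G\<^esub> g [^]\<^bsub>G\<^esub> k" using g by (simp add: m_comm)
      then show ?thesis
        using mat_act_mult[OF car car, of g "g [^]\<^bsub>G\<^esub> k" w] mult[of g "g [^]\<^bsub>G\<^esub> k"] g by (simp add: a_def)
    qed
    define P where "P j = (\<lambda>i. \<Sum>k<n. \<omega> ^ (j * k) * a k i)" for j
    have LP: "(\<Sum>i<N. c i * P j i) = (\<Sum>k<n. \<omega> ^ (j * k) * (\<Sum>i<N. c i * a k i))" for j
      unfolding P_def sum_distrib_left by (subst sum.swap) (simp add: mult.left_commute)
    have "(\<Sum>j<n. \<Sum>i<N. c i * P j i) = (\<Sum>k<n. (\<Sum>j<n. \<omega> ^ (j * k)) * (\<Sum>i<N. c i * a k i))"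
      unfolding LP sum_distrib_right by (rule sum.swap)
    also have "\<dots> = (\<Sum>k<n. if k = 0 then of_nat n * (\<Sum>i<N. c i * a k i) else 0)"
      by (rule sum.cong) (simp_all add: \<omega>_def sum_roots_of_unity n)
    also have "\<dots> = of_nat n * (\<Sum>i<N. c i * w i)" using n by (simp add: a0)
    finally have "(\<Sum>j<n. \<Sum>i<N. c i * P j i) \<noteq> 0" using n w(2) by simp
    then obtain j where j: "(\<Sum>i<N. c i * P j i) \<noteq> 0" by (meson sum.neutral)
    have suppP: "supp_below N (P j)"
      using supp_below_mat_act by (simp add: supp_below_def P_def a_def)
    have "mat_act N (\<sigma> g) (P j) = (\<lambda>i. inverse (\<omega> ^ j) * P j i)"
    proof
      fix i
      let ?f = "\<lambda>k. \<omega> ^ (j * k) * a k i"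
      have "mat_act N (\<sigma> g) (P j) i = (\<Sum>k<n. \<omega> ^ (j * k) * a (Suc k) i)"
        unfolding P_def mat_act_sum aSuc ..
      also have "\<dots> = (\<Sum>k<n. inverse (\<omega> ^ j) * ?f (Suc k))"
        by (rule sum.cong) (use \<omega>0 in \<open>simp_all add: power_add\<close>)
      also have "\<dots> = inverse (\<omega> ^ j) * (\<Sum>k<n. ?f (Suc k))" by (rule sum_distrib_left[symmetric])
      also have "(\<Sum>k<n. ?f (Suc k)) = (\<Sum>k<n. ?f k)"
      proof -
        have e1: "?f n = ?f 0" using \<omega>n by (simp add: a0 an mult.commute[of j] power_mult)
        have e2: "(\<Sum>k<Suc n. ?f k) = ?f 0 + (\<Sum>k<n. ?f (Suc k))" by (rule sum.lessThan_Suc_shift)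
        have e3: "(\<Sum>k<Suc n. ?f k) = (\<Sum>k<n. ?f k) + ?f n" by (rule sum.lessThan_Suc)
        have "?f 0 + (\<Sum>k<n. ?f (Suc k)) = ?f 0 + (\<Sum>k<n. ?f k)"
          using trans[OF e2[symmetric] e3] unfolding e1 add.commute[of "\<Sum>k<n. ?f k"] .
        then show ?thesis by (rule add_left_imp_eq)
      qed
      finally show "mat_act N (\<sigma> g) (P j) i = inverse (\<omega> ^ j) * P j i" by (simp add: P_def)
    qed
    moreover have "\<exists>\<mu>. mat_act N (\<sigma> h) (P j) = (\<lambda>i. \<mu> * P j i)" if "h \<in> S" for h
    proof -
      obtain \<mu> where \<mu>: "mat_act N (\<sigma> h) w = (\<lambda>i. \<mu> * w i)" using w(3)[OF \<open>h \<in> S\<close>] by auto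
      have h: "h \<in> carrier G" using that insert.prems by auto
      have "mat_act N (\<sigma> h) (a k) = (\<lambda>i. \<mu> * a k i)" for k
      proof -
        let ?g = "g [^]\<^bsub>G\<^esub> k"
        have gk: "?g \<in> carrier G" using g by simp
        have "mat_act N (\<sigma> h) (a k) = mat_act N (\<sigma> (h \<otimes>\<^bsub>G\<^esub> ?g)) w"
          unfolding a_def mult[OF h gk] by (rule mat_act_mult[OF car[OF h] car[OF gk], symmetric])
        also have "h \<otimes>\<^bsub>G\<^esub> ?g = ?g \<otimes>\<^bsub>G\<^esub> h" by (rule m_comm[OF h gk])
        also have "mat_act N (\<sigma> (?g \<otimes>\<^bsub>G\<^esub> h)) w = mat_act N (\<sigma> ?g) (mat_act N (\<sigma> h) w)"
          unfolding mult[OF gk h] by (rule mat_act_mult[OF car[OF gk] car[OF h]])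
        also have "\<dots> = (\<lambda>i. \<mu> * a k i)" unfolding \<mu> mat_act_smult a_def ..
        finally show ?thesis .
      qed
      then have "mat_act N (\<sigma> h) (P j) = (\<lambda>i. \<mu> * P j i)"
        unfolding P_def mat_act_sum by (simp add: sum_distrib_left mult.left_commute)
      then show ?thesis by (rule exI)
    qed
    ultimately show ?case using j suppP by (intro exI[of _ "P j"] conjI ballI) auto
  qed
  from this[OF G(2) order_refl] show ?thesis .
qed

definition col_mat :: "nat \<Rightarrow> (nat \<Rightarrow> nat \<Rightarrow> complex) \<Rightarrow> complex mat" where
  "col_mat N b = mat N N (\<lambda>(i, j). b j i)"

lemma det_col_mat_update:
  assumes "k < N"
  shows "det (col_mat N (b(k := v))) = (\<Sum>i<N. cofactor (col_mat N b) i k * v i)"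
proof -
  have "det (col_mat N (b(k := v)))
      = (\<Sum>i<N. col_mat N (b(k := v)) $$ (i, k) * cofactor (col_mat N (b(k := v))) i k)"
    by (rule laplace_expansion_column) (use assms in \<open>auto simp: col_mat_def\<close>)
  also have "\<dots> = (\<Sum>i<N. cofactor (col_mat N b) i k * v i)"
  proof (rule sum.cong)
    fix i assume i: "i \<in> {..<N}"
    have "mat_delete (col_mat N (b(k := v))) i k = mat_delete (col_mat N b) i k"
      using assms i by (intro eq_matI) (auto simp: mat_delete_def col_mat_def)
    then show "col_mat N (b(k := v)) $$ (i, k) * cofactor (col_mat N (b(k := v))) i k
        = cofactor (col_mat N b) i k * v i"
      using assms i by (simp add: cofactor_def col_mat_def)
  qed simp
  finally show ?thesis .
qed

text \<open>Start with the unit vectors and replace the columns one at a time. The determinant is a nonzero linear functional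
  of the column to be replaced, so there is a common eigenvector at which it does not vanish.\<close>

lemma common_eigenbasis:
  assumes G: "comm_group G" "finite (carrier G)"
    and car: "\<And>g. g \<in> carrier G \<Longrightarrow> \<sigma> g \<in> carrier_mat N N"
    and mult: "\<And>g h. g \<in> carrier G \<Longrightarrow> h \<in> carrier G \<Longrightarrow> \<sigma> (g \<otimes>\<^bsub>G\<^esub> h) = \<sigma> g * \<sigma> h"
    and one: "\<sigma> \<one>\<^bsub>G\<^esub> = 1\<^sub>m N"
  obtains b where "det (col_mat N b) \<noteq> 0" "\<And>j. j < N \<Longrightarrow> supp_below N (b j)"
    "\<And>j g. j < N \<Longrightarrow> g \<in> carrier G \<Longrightarrow> \<exists>\<mu>. mat_act N (\<sigma> g) (b j) = (\<lambda>i. \<mu> * b j i)"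
proof -
  have "\<exists>b. det (col_mat N b) \<noteq> 0 \<and> (\<forall>j. supp_below N (b j)) \<and>
    (\<forall>j<k. \<forall>g\<in>carrier G. \<exists>\<mu>. mat_act N (\<sigma> g) (b j) = (\<lambda>i. \<mu> * b j i))" if "k \<le> N" for k
    using that
  proof (induction k)
    case 0
    define b :: "nat \<Rightarrow> nat \<Rightarrow> complex" where "b j i = (if i = j \<and> i < N then 1 else 0)" for i j
    have "col_mat N b = 1\<^sub>m N" by (intro eq_matI) (auto simp: col_mat_def b_def)
    then have "det (col_mat N b) \<noteq> 0" by simp
    moreover have "\<forall>j. supp_below N (b j)" by (simp add: supp_below_def b_def)
    ultimately show ?case by (intro exI[of _ b]) simp
  next
    case (Suc k)
    then obtain b where b: "det (col_mat N b) \<noteq> 0" "\<And>j. supp_below N (b j)"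
      "\<And>j g. j < k \<Longrightarrow> g \<in> carrier G \<Longrightarrow> \<exists>\<mu>. mat_act N (\<sigma> g) (b j) = (\<lambda>i. \<mu> * b j i)" by auto
    have k: "k < N" using Suc.prems by simp
    have nz: "(\<Sum>i<N. cofactor (col_mat N b) i k * b k i) \<noteq> 0"
      using det_col_mat_update[OF k, of b "b k"] b(1) by simp
    obtain w where w: "supp_below N w" "(\<Sum>i<N. cofactor (col_mat N b) i k * w i) \<noteq> 0"
      "\<And>g. g \<in> carrier G \<Longrightarrow> \<exists>\<mu>. mat_act N (\<sigma> g) w = (\<lambda>i. \<mu> * w i)"
      using common_eigenvector[where c = "\<lambda>i. cofactor (col_mat N b) i k", OF G car mult one b(2) nz] by auto
    define b' where "b' = b(k := w)"
    have "det (col_mat N b') \<noteq> 0" using w(2) det_col_mat_update[OF k] by (simp add: b'_def)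
    moreover have "\<forall>j. supp_below N (b' j)" using w(1) b(2) by (simp add: b'_def)
    moreover have "\<exists>\<mu>. mat_act N (\<sigma> g) (b' j) = (\<lambda>i. \<mu> * b' j i)"
      if "j < Suc k" "g \<in> carrier G" for j g
      using that w(3)[of g] b(3)[of j g] by (cases "j = k") (simp_all add: b'_def)
    ultimately show ?case by (intro exI[of _ b'] conjI allI impI ballI) simp_all
  qed
  from this[OF order_refl] show thesis using that by auto
qed

lemma col_mat_nonsingular:
  assumes "det (col_mat N b) \<noteq> 0"
  shows "\<exists>y. \<forall>i<N. v i = (\<Sum>j<N. y j * b j i)"
    and "(\<And>i. i < N \<Longrightarrow> (\<Sum>j<N. y j * b j i) = 0) \<Longrightarrow> j < N \<Longrightarrow> y j = 0"
proof -
  let ?A = "col_mat N b"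
  have A: "?A \<in> carrier_mat N N" by (simp add: col_mat_def)
  have act: "mat_act N ?A y i = (\<Sum>j<N. y j * b j i)" if "i < N" for i y
    using that by (simp add: mat_act_def col_mat_def mult.commute)
  have "?A \<in> Units (mat_ring N)" by (rule det_non_zero_imp_unit[OF A assms])
  then obtain B where B: "B \<in> carrier_mat N N" "?A * B = 1\<^sub>m N" "B * ?A = 1\<^sub>m N"
    by (auto simp: Units_def ring_mat_def)
  define v' where "v' i = (if i < N then v i else 0)" for i
  have "supp_below N v'" by (simp add: supp_below_def v'_def)
  then have "mat_act N ?A (mat_act N B v') = v'"
    by (simp add: mat_act_mult[OF A B(1), symmetric] B(2) mat_act_one)
  then have "v i = (\<Sum>j<N. mat_act N B v' j * b j i)" if "i < N" for i
    using act[OF that, of "mat_act N B v'"] that by (simp add: v'_def)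
  then show "\<exists>y. \<forall>i<N. v i = (\<Sum>j<N. y j * b j i)" by (intro exI[of _ "mat_act N B v'"]) simp
  assume y: "\<And>i. i < N \<Longrightarrow> (\<Sum>j<N. y j * b j i) = 0" and j: "j < N"
  define y' where "y' i = (if i < N then y i else 0)" for i
  have "supp_below N y'" by (simp add: supp_below_def y'_def)
  then have "y' = mat_act N B (mat_act N ?A y')"
    by (simp add: mat_act_mult[OF B(1) A, symmetric] B(3) mat_act_one)
  also have "mat_act N ?A y' = mat_act N ?A y" by (rule mat_act_cong) (simp add: y'_def)
  also have "mat_act N B (mat_act N ?A y) = mat_act N B (\<lambda>i. 0)" by (rule mat_act_cong) (simp add: act y)
  also have "\<dots> = (\<lambda>i. 0)" by (rule ext) (simp add: mat_act_def)
  finally show "y j = 0" using j by (metis y'_def)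
qed

section \<open>Eigencharacters of a symmetric smooth form\<close>

lemma dir_deriv_smult: "dir_deriv N P a (\<lambda>i. c * v i) = c * dir_deriv N P a v"
  by (simp add: dir_deriv_def sum_distrib_left mult.assoc)

lemma dir_deriv_sum:
  "dir_deriv N P a (\<lambda>i. \<Sum>k\<in>K. c k * v k i) = (\<Sum>k\<in>K. c k * dir_deriv N P a (v k))"
  unfolding dir_deriv_def sum_distrib_left sum_distrib_right
  by (subst sum.swap) (simp add: mult.assoc)

lemma dir_deriv_cong: "(\<And>i. i < N \<Longrightarrow> v i = w i) \<Longrightarrow> dir_deriv N P a v = dir_deriv N P a w"
  unfolding dir_deriv_def by (rule sum.cong) auto

lemma dir_deriv_unit:
  assumes "k < N"
  shows "dir_deriv N P a (\<lambda>i. if i = k then 1 else 0) = eval_poly a (partial_deriv k P)"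
proof -
  have "dir_deriv N P a (\<lambda>i. if i = k then 1 else 0)
      = (\<Sum>i<N. if i = k then eval_poly a (partial_deriv i P) else 0)"
    unfolding dir_deriv_def by (rule sum.cong) auto
  then show ?thesis using assms by simp
qed

lemma dir_deriv_equivariant:
  assumes vars: "vars P \<subseteq> {..<N}"
    and lin: "\<And>a v t. T (\<lambda>i. a i + t * v i) = (\<lambda>i. T a i + t * T v i)"
    and semi: "\<And>x. eval_poly (T x) P = c * eval_poly x P"
  shows "dir_deriv N P (T a) (T v) = c * dir_deriv N P a v"
proof -
  have "poly (line_poly (T a) (T v) P) t = poly (Polynomial.smult c (line_poly a v P)) t" for t
    by (simp add: poly_line_poly semi[symmetric] lin)
  then have "line_poly (T a) (T v) P = Polynomial.smult c (line_poly a v P)"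
    unfolding poly_eq_poly_eq_iff[symmetric] by (rule ext)
  then have "Polynomial.coeff (line_poly (T a) (T v) P) 1 = c * Polynomial.coeff (line_poly a v P) 1"
    by (metis coeff_smult)
  then show ?thesis unfolding coeff_1_line_poly[OF vars] .
qed

lemma dir_deriv_homogeneous:
  assumes F: "form N d P" "d \<ge> 1" and "c \<noteq> 0"
  shows "dir_deriv N P (\<lambda>i. c * a i) v = c ^ (d - 1) * dir_deriv N P a v"
proof -
  have "dir_deriv N P (\<lambda>i. c * a i) (\<lambda>i. c * v i) = c ^ d * dir_deriv N P a v"
    by (rule dir_deriv_equivariant[where T = "\<lambda>a i. c * a i"])
      (use F in \<open>simp_all add: form_def eval_poly_homogeneous distrib_left mult.left_commute\<close>)
  then have "c * dir_deriv N P (\<lambda>i. c * a i) v = c * (c ^ (d - 1) * dir_deriv N P a v)"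
    using F(2) unfolding dir_deriv_smult by (cases d) simp_all
  then show ?thesis using assms(3) by simp
qed

lemma dir_deriv_basis_nonzero:
  assumes F: "form N d F" "smooth N F" and b: "det (col_mat N b) \<noteq> 0"
    and z: "i < N" "z i \<noteq> 0"
  shows "\<exists>w<N. dir_deriv N F z (b w) \<noteq> 0"
proof (rule ccontr)
  assume "\<not> ?thesis"
  then have 0: "dir_deriv N F z (b w) = 0" if "w < N" for w using that by auto
  obtain k where k: "k < N" "eval_poly z (partial_deriv k F) \<noteq> 0"
    using smooth_dir_deriv[OF F, of i z] z by auto
  obtain y where y: "\<forall>i<N. (if i = k then 1 else 0) = (\<Sum>j<N. y j * b j i)"
    using col_mat_nonsingular(1)[OF b, of "\<lambda>i. if i = k then 1 else 0"] by auto
  have "eval_poly z (partial_deriv k F) = dir_deriv N F z (\<lambda>i. if i = k then 1 else 0)"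
    by (rule dir_deriv_unit[OF k(1), symmetric])
  also have "\<dots> = dir_deriv N F z (\<lambda>i. \<Sum>j<N. y j * b j i)"
    by (rule dir_deriv_cong) (use y in simp)
  also have "\<dots> = (\<Sum>j<N. y j * dir_deriv N F z (b j))" by (rule dir_deriv_sum)
  also have "\<dots> = 0" by (simp add: 0)
  finally show False using k(2) by simp
qed

text \<open>On the plane spanned by $a$ and $b$ the derivative is a binary form of degree $d - 1 \ge 1$, and such a form has a
  nontrivial zero: either $a$ itself or a point of the line $b + ta$.\<close>

lemma dir_deriv_vanishes_on_line:
  assumes F: "form N d P" "d \<ge> 2"
  shows "dir_deriv N P a v = 0 \<or> (\<exists>t. dir_deriv N P (\<lambda>i. b i + t * a i) v = 0)"
proof (rule ccontr)
  assume H: "\<not> ?thesis"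
  define q where "q x y = (\<Sum>i<N. Polynomial.smult (v i) (line_poly x y (partial_deriv i P)))" for x y
  have q: "poly (q x y) t = dir_deriv N P (\<lambda>i. x i + t * y i) v" for x y t
    by (simp add: q_def dir_deriv_def poly_sum poly_line_poly)
  have "constant (poly (q b a))"
    using fundamental_theorem_of_algebra[of "q b a"] H by (auto simp: q)
  then obtain c where c: "\<And>t. poly (q b a) t = c" unfolding constant_def by auto
  \<comment> \<open>Without a zero on the line, the form is constant there, hence equal to $c s^{d-1}$ after homogenisation, and vanishes at $s = 0$.\<close>
  define p where "p = q a b - Polynomial.monom c (d - 1)"
  have "poly p s = 0" if "s \<noteq> 0" for s
  proof -
    have "(\<lambda>i. a i + s * b i) = (\<lambda>i. s * (b i + inverse s * a i))"
      by (rule ext) (use that in \<open>simp add: field_simps\<close>)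
    then have "poly (q a b) s = s ^ (d - 1) * dir_deriv N P (\<lambda>i. b i + inverse s * a i) v"
      using dir_deriv_homogeneous[OF F(1) _ that, of "\<lambda>i. b i + inverse s * a i" v] F(2) by (simp add: q)
    also have "\<dots> = s ^ (d - 1) * c" using c[of "inverse s"] by (simp add: q)
    finally show ?thesis by (simp add: p_def poly_monom mult.commute)
  qed
  then have "- {0} \<subseteq> {s. poly p s = 0}" by auto
  moreover have "infinite (- {0 :: complex})" by (simp add: infinite_UNIV_char_0 Compl_eq_Diff_UNIV)
  ultimately have "p = 0" using poly_roots_finite[of p] finite_subset by metis
  then have "poly (q a b) 0 = poly (Polynomial.monom c (d - 1)) 0" by (simp add: p_def)
  also have "\<dots> = 0" using F(2) by (simp add: poly_monom power_0_left)
  finally show False using H by (simp add: q)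
qed

lemma eval_poly_eq_vec: "vars P \<subseteq> {..<N} \<Longrightarrow> eval_poly (\<lambda>j. vec N a $ j) P = eval_poly a P"
  by (rule eval_poly_cong) auto

text \<open>The action is by permutations of the points of the hypersurface; a matrix representing it therefore
  maps zeros of $F$ to zeros of $F$, also at the origin, which is not a point.\<close>

lemma linear_action_zeros:
  assumes act: "linear_action G N F \<rho>" and F: "form N d F" "d \<ge> 1"
    and g: "g \<in> carrier G" and A: "A \<in> carrier (GL N)" "to_PGL N A = \<rho> g"
    and x: "eval_poly x F = 0"
  shows "eval_poly (mat_act N A x) F = 0"
proof -
  have vF: "vars F \<subseteq> {..<N}" and hom: "homogeneous d F" using F(1) by (simp_all add: form_def)
  have A_car: "A \<in> carrier_mat N N" using A(1) by (rule GL_carrier_mat)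
  have Av: "eval_poly (\<lambda>j. (A *\<^sub>v vec N x) $ j) F = eval_poly (mat_act N A x) F"
  proof (rule eval_poly_cong)
    fix i assume "i \<in> vars F"
    then show "(A *\<^sub>v vec N x) $ i = mat_act N A x i"
      using vF A_car by (auto simp: mat_act_def scalar_prod_def lessThan_atLeast0)
  qed
  show ?thesis
  proof (cases "vec N x = 0\<^sub>v N")
    case True
    have "x i = 0" if "i < N" for i using arg_cong[OF True, of "\<lambda>v. v $ i"] that by simp
    then have "mat_act N A x = (\<lambda>i. 0 * x i)" by (intro ext) (simp add: mat_act_def)
    then show ?thesis using eval_poly_homogeneous[OF hom, of 0 x] F(2) by simp
  next
    case False
    have "proj_point (vec N x) \<in> hypersurface N F"
      unfolding hypersurface_def
      by (rule CollectI, rule exI[of _ "vec N x"]) (use False x eval_poly_eq_vec[OF vF, of x] in simp)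
    then have "proj_apply (\<rho> g) (proj_point (vec N x)) \<in> hypersurface N F"
      using act g unfolding linear_action_def by (metis imageI)
    then obtain u where u: "proj_apply (\<rho> g) (proj_point (vec N x)) = proj_point u"
      "u \<in> carrier_vec N" "eval_poly (\<lambda>j. u $ j) F = 0"
      unfolding hypersurface_def by auto
    have "vec N x \<in> proj_point (vec N x)"
      unfolding proj_point_def by (rule CollectI, rule exI[of _ 1]) simp
    moreover have "A \<in> \<rho> g" using mat_self_in_to_PGL[OF A(1)] A(2) by simp
    ultimately have "A *\<^sub>v vec N x \<in> proj_point u"
      unfolding u(1)[symmetric] proj_apply_def by auto
    then obtain c where c: "A *\<^sub>v vec N x = c \<cdot>\<^sub>v u" by (auto simp: proj_point_def)
    have "eval_poly (\<lambda>j. (c \<cdot>\<^sub>v u) $ j) F = eval_poly (\<lambda>j. c * u $ j) F"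
      by (rule eval_poly_cong) (use vF u(2) in auto)
    then show ?thesis using Av u(3) by (simp add: c eval_poly_homogeneous[OF hom])
  qed
qed

text \<open>What remains of the geometry. The numbers $\lambda_i(g)$ are the eigenvalues of $g$ and $\chi$ is the character by
  which $G$ acts on $F$. The last two conditions express smoothness of $F$ on the axis of $u$ and on the plane
  of $u$ and $v$: on the axis some partial derivative of $F$ must not vanish, and on the plane at least two of
  them must not vanish identically, since a single one, being a form in two variables, has a nontrivial zero.\<close>

locale eigen_system = comm_group G for G :: "('a, 'b) monoid_scheme" (structure) +
  fixes N d :: nat and lam :: "nat \<Rightarrow> 'a \<Rightarrow> complex" and chi :: "'a \<Rightarrow> complex"
  assumes fin: "finite (carrier G)" and d3: "d \<ge> 3" and N1: "N \<ge> 1"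
    and lam_char: "\<And>i. i < N \<Longrightarrow> is_char G (lam i)" and chi_char: "is_char G chi"
    and lam_faithful: "\<And>g. g \<in> carrier G \<Longrightarrow> (\<And>i j. i < N \<Longrightarrow> j < N \<Longrightarrow> lam i g = lam j g) \<Longrightarrow> g = \<one>"
    and arrow_ex: "\<And>u. u < N \<Longrightarrow> \<exists>w<N. \<forall>g\<in>carrier G. lam w g * lam u g ^ (d - 1) = chi g"
    and two_targets: "\<And>u v y. u < N \<Longrightarrow> v < N \<Longrightarrow> u \<noteq> v \<Longrightarrow> y < N \<Longrightarrow>
       \<exists>w<N. w \<noteq> y \<and> (\<forall>g\<in>carrier G. lam u g = lam v g \<longrightarrow> lam w g * lam u g ^ (d - 1) = chi g)"

text \<open>If the derivative of $F$ in the direction of the eigenvector $b_w$ does not vanish at a point $z$ on the plane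
  of $b_u$ and $b_v$, then every $g$ that acts on this plane by a scalar satisfies
  $\lambda_w(g)\lambda_u(g)^{d-1} = \chi(g)$, since $F$ is equivariant and homogeneous. For $z = b_u$ smoothness
  provides some $w$. On a plane, choose $z$ to be a zero of the derivative in the direction $b_y$; smoothness at
  $z$ then provides some $w \ne y$.\<close>

lemma eigencharacters:
  assumes d: "d \<ge> 3" and N: "N \<ge> 1" and G: "comm_group G" "finite (carrier G)"
    and F: "form N d F" "smooth N F"
    and act: "linear_action G N F \<rho>" "faithful G \<rho>" "liftable G N \<rho>"
  shows "\<exists>lam chi. eigen_system G N d lam chi"
proof -
  interpret comm_group G by (rule G(1))
  have d2: "d \<ge> 2" using d by simp
  have vF: "vars F \<subseteq> {..<N}" using F(1) by (simp add: form_def)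
  obtain \<sigma> where \<sigma>: "\<sigma> \<in> hom G (GL N)" "\<And>g. g \<in> carrier G \<Longrightarrow> to_PGL N (\<sigma> g) = \<rho> g"
    using act(3) unfolding liftable_def by auto
  have GL: "\<sigma> g \<in> carrier (GL N)" if "g \<in> carrier G" for g using \<sigma>(1) that by (auto simp: hom_def)
  have car: "\<sigma> g \<in> carrier_mat N N" if "g \<in> carrier G" for g using GL[OF that] by (rule GL_carrier_mat)
  have mult: "\<sigma> (g \<otimes>\<^bsub>G\<^esub> h) = \<sigma> g * \<sigma> h" if "g \<in> carrier G" "h \<in> carrier G" for g h
    using \<sigma>(1) that by (simp add: hom_def)
  have one: "\<sigma> \<one>\<^bsub>G\<^esub> = 1\<^sub>m N" using hom_one[OF \<sigma>(1) is_group group_GL] by simp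
  obtain b where det: "det (col_mat N b) \<noteq> 0" and supp: "\<And>j. j < N \<Longrightarrow> supp_below N (b j)"
    and eig: "\<And>j g. j < N \<Longrightarrow> g \<in> carrier G \<Longrightarrow> \<exists>\<mu>. mat_act N (\<sigma> g) (b j) = (\<lambda>i. \<mu> * b j i)"
    using common_eigenbasis[OF G car mult one] by metis
  define lam where "lam j g = (SOME \<mu>. mat_act N (\<sigma> g) (b j) = (\<lambda>i. \<mu> * b j i))" for j g
  have lam: "mat_act N (\<sigma> g) (b j) = (\<lambda>i. lam j g * b j i)" if "j < N" "g \<in> carrier G" for j g
    unfolding lam_def by (rule someI_ex[OF eig[OF that]])
  have indep: "y j = 0" if "\<And>i. i < N \<Longrightarrow> (\<Sum>j<N. y j * b j i) = 0" "j < N" for y j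
    by (rule col_mat_nonsingular(2)[OF det that])
  have b0: "\<exists>i<N. b j i \<noteq> 0" if j: "j < N" for j
  proof (rule ccontr)
    assume "\<not> ?thesis"
    then have "(\<Sum>l<N. (if l = j then 1 else 0) * b l i) = 0" if "i < N" for i
      using that by (intro sum.neutral) auto
    from indep[of "\<lambda>l. if l = j then 1 else 0", OF this j] show False by simp
  qed
  have lam_unique: "\<mu> = \<nu>" if "j < N" "(\<lambda>i. \<mu> * b j i) = (\<lambda>i. \<nu> * b j i)" for j \<mu> \<nu>
    using b0[OF that(1)] fun_cong[OF that(2)] by auto
  have lam_mult: "lam j (g \<otimes>\<^bsub>G\<^esub> h) = lam j g * lam j h" if "j < N" "g \<in> carrier G" "h \<in> carrier G" for j g h
  proof (rule lam_unique[OF that(1)])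
    have "(\<lambda>i. lam j (g \<otimes>\<^bsub>G\<^esub> h) * b j i) = mat_act N (\<sigma> g * \<sigma> h) (b j)"
      using lam[of j "g \<otimes>\<^bsub>G\<^esub> h"] that by (simp add: mult)
    also have "\<dots> = mat_act N (\<sigma> g) (\<lambda>i. lam j h * b j i)"
      using mat_act_mult[OF car car, of g h "b j"] lam[of j h] that by simp
    also have "\<dots> = (\<lambda>i. lam j g * lam j h * b j i)"
      unfolding mat_act_smult using lam[of j g] that by (simp add: mult_ac)
    finally show "(\<lambda>i. lam j (g \<otimes>\<^bsub>G\<^esub> h) * b j i) = (\<lambda>i. lam j g * lam j h * b j i)" .
  qed
  have lam_one: "lam j \<one>\<^bsub>G\<^esub> = 1" if "j < N" for j
  proof (rule lam_unique[OF that])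
    show "(\<lambda>i. lam j \<one>\<^bsub>G\<^esub> * b j i) = (\<lambda>i. 1 * b j i)"
      using lam[OF that one_closed] by (simp add: one mat_act_one[OF supp[OF that]])
  qed
  have lam_char: "is_char G (lam j)" if "j < N" for j
    unfolding is_char_def
  proof (intro conjI ballI)
    fix g assume g: "g \<in> carrier G"
    have "lam j g * lam j (inv\<^bsub>G\<^esub> g) = 1"
      using lam_mult[OF that g inv_closed[OF g]] lam_one[OF that] g by simp
    then show "lam j g \<noteq> 0" by auto
  qed (rule lam_mult[OF that])
  have "\<exists>c. \<forall>x. eval_poly (mat_act N (\<sigma> g) x) F = c * eval_poly x F" if g: "g \<in> carrier G" for g
  proof (rule proportional_of_zeros[OF F])
    show "1 \<le> d" using d by simp
    show "eval_poly (mat_act N (\<sigma> g) x) F = 0" if "eval_poly x F = 0" for x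
      using linear_action_zeros[OF act(1) F(1) _ g GL[OF g] \<sigma>(2)[OF g] that] d by simp
  qed (rule mat_act_linear, rule mat_act_cong)
  then obtain chi where chi: "\<And>g x. g \<in> carrier G \<Longrightarrow> eval_poly (mat_act N (\<sigma> g) x) F = chi g * eval_poly x F"
    by metis
  have "\<exists>x. eval_poly x F \<noteq> 0"
  proof (rule ccontr)
    assume "\<not> ?thesis"
    then have "poly (line_poly a v F) t = 0" for a v t by (simp add: poly_line_poly)
    then have "line_poly a v F = 0" for a v using poly_all_0_iff_0 by blast
    then have "dir_deriv N F a v = 0" for a v
      unfolding coeff_1_line_poly[OF vF, symmetric] by simp
    moreover obtain i where "i < N" "b 0 i \<noteq> 0" using b0[of 0] N by auto
    ultimately show False using dir_deriv_basis_nonzero[OF F det] by blast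
  qed
  then obtain x0 where x0: "eval_poly x0 F \<noteq> 0" by blast
  have chi_mult: "chi (g \<otimes>\<^bsub>G\<^esub> h) = chi g * chi h" if "g \<in> carrier G" "h \<in> carrier G" for g h
    using chi[of "g \<otimes>\<^bsub>G\<^esub> h" x0] chi[of g "mat_act N (\<sigma> h) x0"] chi[of h x0] that x0
    by (simp add: mult mat_act_mult[OF car car])
  define x1 where "x1 i = (if i < N then x0 i else 0)" for i
  have x1: "eval_poly x1 F = eval_poly x0 F" by (rule eval_poly_cong) (use vF in \<open>auto simp: x1_def\<close>)
  have "mat_act N (1\<^sub>m N) x1 = x1" by (rule mat_act_one) (simp add: supp_below_def x1_def)
  then have chi_one: "chi \<one>\<^bsub>G\<^esub> = 1" using chi[OF one_closed, of x1] x0 x1 by (simp add: one)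
  have chi_char: "is_char G chi"
    unfolding is_char_def
  proof (intro conjI ballI)
    fix g assume g: "g \<in> carrier G"
    have "chi g * chi (inv\<^bsub>G\<^esub> g) = 1" using chi_mult[OF g inv_closed[OF g]] chi_one g by simp
    then show "chi g \<noteq> 0" by auto
  qed (rule chi_mult)
  have relation: "lam w g * lam u g ^ (d - 1) = chi g"
    if g: "g \<in> carrier G" and uvw: "u < N" "v < N" "w < N" and eq: "lam u g = lam v g"
      and z: "z = (\<lambda>i. p * b u i + r * b v i)" "dir_deriv N F z (b w) \<noteq> 0" for g u v w p r z
  proof -
    have "mat_act N (\<sigma> g) z = (\<lambda>i. mat_act N (\<sigma> g) (\<lambda>i. p * b u i) i + r * mat_act N (\<sigma> g) (b v) i)"
      unfolding z(1) by (rule mat_act_linear)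
    also have "\<dots> = (\<lambda>i. lam u g * z i)"
      unfolding mat_act_smult lam[OF uvw(1) g] lam[OF uvw(2) g] z(1) eq by (simp add: algebra_simps)
    finally have zg: "mat_act N (\<sigma> g) z = (\<lambda>i. lam u g * z i)" .
    have "chi g * dir_deriv N F z (b w) = dir_deriv N F (mat_act N (\<sigma> g) z) (mat_act N (\<sigma> g) (b w))"
      by (rule dir_deriv_equivariant[OF vF mat_act_linear chi[OF g], symmetric])
    also have "\<dots> = lam w g * (lam u g ^ (d - 1) * dir_deriv N F z (b w))"
      unfolding zg lam[OF uvw(3) g] dir_deriv_smult
      using dir_deriv_homogeneous[OF F(1), of "lam u g" z "b w"] d lam_char[OF uvw(1)] g by (simp add: is_char_def)
    finally show ?thesis using z(2) by simp
  qed
  have "eigen_system G N d lam chi"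
  proof (intro eigen_system.intro eigen_system_axioms.intro G d N lam_char chi_char)
    fix g assume g: "g \<in> carrier G" and eq: "\<And>i j. i < N \<Longrightarrow> j < N \<Longrightarrow> lam i g = lam j g"
    define c where "c = lam 0 g"
    have c: "lam j g = c" if "j < N" for j using eq[OF that, of 0] N by (simp add: c_def)
    have c0: "c \<noteq> 0" using lam_char[of 0] N g by (simp add: c_def is_char_def)
    have all: "mat_act N (\<sigma> g) x i = c * x i" if i: "i < N" for x i
    proof -
      obtain y where y: "\<forall>i<N. x i = (\<Sum>j<N. y j * b j i)" using col_mat_nonsingular(1)[OF det, of x] by auto
      have "mat_act N (\<sigma> g) x = mat_act N (\<sigma> g) (\<lambda>i. \<Sum>j<N. y j * b j i)"
        by (rule mat_act_cong) (use y in simp)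
      also have "\<dots> = (\<lambda>i. \<Sum>j<N. y j * mat_act N (\<sigma> g) (b j) i)" by (rule mat_act_sum)
      finally have "mat_act N (\<sigma> g) x i = (\<Sum>j<N. y j * mat_act N (\<sigma> g) (b j) i)" by simp
      also have "\<dots> = (\<Sum>j<N. c * (y j * b j i))"
        by (rule sum.cong) (use g in \<open>simp_all add: lam c\<close>)
      also have "\<dots> = c * x i" using y i by (simp add: sum_distrib_left)
      finally show ?thesis .
    qed
    have "\<sigma> g = c \<cdot>\<^sub>m 1\<^sub>m N"
    proof (rule eq_matI)
      fix i k assume ik: "i < dim_row (c \<cdot>\<^sub>m 1\<^sub>m N)" "k < dim_col (c \<cdot>\<^sub>m 1\<^sub>m N)"
      have "(\<Sum>l<N. \<sigma> g $$ (i, l) * (if l = k then 1 else 0)) = (\<Sum>l<N. if l = k then \<sigma> g $$ (i, l) else 0)"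
        by (rule sum.cong) auto
      then have "mat_act N (\<sigma> g) (\<lambda>l. if l = k then 1 else 0) i = \<sigma> g $$ (i, k)"
        using ik by (simp add: mat_act_def)
      then show "\<sigma> g $$ (i, k) = (c \<cdot>\<^sub>m 1\<^sub>m N) $$ (i, k)" using all ik by auto
    qed (use car[OF g] in auto)
    then have "to_PGL N (\<sigma> g) = to_PGL N (\<sigma> \<one>\<^bsub>G\<^esub>)"
      using to_PGL_smult[OF GL[OF one_closed] c0] by (simp add: one)
    then have "\<rho> g = \<rho> \<one>\<^bsub>G\<^esub>" using \<sigma>(2)[OF g] \<sigma>(2)[OF one_closed] by simp
    then show "g = \<one>\<^bsub>G\<^esub>" using act(2) g one_closed unfolding faithful_def inj_on_def by blast
  next
    fix u assume u: "u < N"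
    obtain i where "i < N" "b u i \<noteq> 0" using b0[OF u] by auto
    then obtain w where w: "w < N" "dir_deriv N F (b u) (b w) \<noteq> 0"
      using dir_deriv_basis_nonzero[OF F det] by blast
    have "lam w g * lam u g ^ (d - 1) = chi g" if "g \<in> carrier G" for g
      by (rule relation[OF that u u w(1), of "b u" 1 0]) (use w in simp_all)
    then show "\<exists>w<N. \<forall>g\<in>carrier G. lam w g * lam u g ^ (d - 1) = chi g" using w(1) by auto
  next
    fix u v y assume uv: "u < N" "v < N" "u \<noteq> v" "y < N"
    have "\<exists>p r. (p \<noteq> 0 \<or> r \<noteq> 0) \<and> dir_deriv N F (\<lambda>i. p * b u i + r * b v i) (b y) = 0"
    proof (cases "dir_deriv N F (b u) (b y) = 0")
      case True
      then show ?thesis by (intro exI[of _ 1] exI[of _ 0]) simp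
    next
      case False
      then obtain t where "dir_deriv N F (\<lambda>i. b v i + t * b u i) (b y) = 0"
        using dir_deriv_vanishes_on_line[OF F(1) d2, of "b u" "b y" "b v"] by auto
      then show ?thesis by (intro exI[of _ t] exI[of _ 1]) (simp add: add.commute)
    qed
    then obtain p r where pr: "p \<noteq> 0 \<or> r \<noteq> 0" and zero: "dir_deriv N F (\<lambda>i. p * b u i + r * b v i) (b y) = 0"
      by auto
    define z where "z = (\<lambda>i. p * b u i + r * b v i)"
    have "\<exists>i<N. z i \<noteq> 0"
    proof (rule ccontr)
      assume "\<not> ?thesis"
      then have z0: "z i = 0" if "i < N" for i using that by auto
      define Y where "Y j = (if j = u then p else if j = v then r else 0)" for j
      have Ysum: "(\<Sum>j<N. Y j * b j i) = 0" if i: "i < N" for i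
      proof -
        have "(\<Sum>j<N. Y j * b j i) = (\<Sum>j\<in>{u, v}. Y j * b j i)"
          by (rule sum.mono_neutral_right) (use uv in \<open>auto simp: Y_def\<close>)
        also have "\<dots> = z i" using uv(3) by (simp add: Y_def z_def)
        finally show ?thesis using z0[OF i] by simp
      qed
      have Y0: "Y j = 0" if "j < N" for j using indep[of Y j] Ysum that by simp
      show False using Y0[OF uv(1)] Y0[OF uv(2)] pr uv(3) by (simp add: Y_def)
    qed
    then obtain i where "i < N" "z i \<noteq> 0" by auto
    then obtain w where w: "w < N" "dir_deriv N F z (b w) \<noteq> 0"
      using dir_deriv_basis_nonzero[OF F det] by blast
    have "w \<noteq> y" using w(2) zero by (auto simp: z_def)
    moreover have "lam w g * lam u g ^ (d - 1) = chi g" if "g \<in> carrier G" "lam u g = lam v g" for g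
      by (rule relation[OF that(1) uv(1,2) w(1) that(2) z_def w(2)])
    ultimately show "\<exists>w<N. w \<noteq> y \<and> (\<forall>g\<in>carrier G. lam u g = lam v g \<longrightarrow> lam w g * lam u g ^ (d - 1) = chi g)"
      using w(1) by auto
  qed
  then show ?thesis by (intro exI)
qed

section \<open>Counting the variables\<close>

lemma is_char_mult: "is_char G \<chi> \<Longrightarrow> g \<in> carrier G \<Longrightarrow> h \<in> carrier G \<Longrightarrow> \<chi> (g \<otimes>\<^bsub>G\<^esub> h) = \<chi> g * \<chi> h"
  by (simp add: is_char_def)

lemma is_char_nonzero: "is_char G \<chi> \<Longrightarrow> g \<in> carrier G \<Longrightarrow> \<chi> g \<noteq> 0"
  by (simp add: is_char_def)

lemma is_char_one: "group G \<Longrightarrow> is_char G \<chi> \<Longrightarrow> \<chi> \<one>\<^bsub>G\<^esub> = 1"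
  using is_char_mult[of G \<chi> "\<one>\<^bsub>G\<^esub>" "\<one>\<^bsub>G\<^esub>"] is_char_nonzero[of G \<chi> "\<one>\<^bsub>G\<^esub>"]
  by (simp add: group.is_monoid monoid.one_closed)

lemma is_char_pow:
  assumes "group G" "is_char G \<chi>" "g \<in> carrier G"
  shows "\<chi> (g [^]\<^bsub>G\<^esub> (k::nat)) = \<chi> g ^ k"
proof -
  interpret group G by (rule assms(1))
  show ?thesis
    by (induction k) (simp_all add: is_char_one[OF assms(1,2)] is_char_mult[OF assms(2)] assms(3))
qed

lemma is_char_trivial: "is_char G (\<lambda>_. 1)"
  by (simp add: is_char_def)

lemma is_char_power: "is_char G \<chi> \<Longrightarrow> is_char G (\<lambda>g. \<chi> g ^ (k::nat))"
  by (simp add: is_char_def power_mult_distrib)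

lemma is_char_divide: "is_char G \<chi> \<Longrightarrow> is_char G \<psi> \<Longrightarrow> is_char G (\<lambda>g. \<chi> g / \<psi> g)"
  by (simp add: is_char_def)

lemma is_char_prod:
  "(\<And>x. x \<in> A \<Longrightarrow> is_char G (\<chi> x)) \<Longrightarrow> is_char G (\<lambda>g. \<Prod>x\<in>A. \<chi> x g)"
  by (induction A rule: infinite_finite_induct) (simp_all add: is_char_def)

lemma power_gcd_eq_1:
  fixes z :: complex
  assumes "z ^ a = 1" "z ^ b = 1"
  shows "z ^ gcd a b = 1"
proof (cases "a = 0")
  case False
  obtain x y where xy: "a * x = b * y + gcd a b" using bezout_nat[OF False, of b] by auto
  have "1 = (z ^ a) ^ x" using assms(1) by simp
  also have "\<dots> = z ^ (b * y + gcd a b)" by (simp only: power_mult[symmetric] xy)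
  also have "\<dots> = (z ^ b) ^ y * z ^ gcd a b" by (simp only: power_add power_mult)
  finally show ?thesis using assms(2) by simp
qed (use assms in simp)

lemma eq_1_of_coprime_powers:
  fixes z :: complex
  shows "z ^ a = 1 \<Longrightarrow> z ^ b = 1 \<Longrightarrow> coprime a b \<Longrightarrow> z = 1"
  using power_gcd_eq_1[of z a b] by simp

lemma power_eq_1_dvd: "z ^ a = 1 \<Longrightarrow> a dvd b \<Longrightarrow> z ^ b = 1" for z :: complex
  by (metis dvdE power_mult power_one)

text \<open>Splits the order of $G$ into the part prime to $D$ and the rest.\<close>

lemma dvd_coprime_times_power:
  fixes n D :: nat
  assumes "n > 0" "D > 0"
  obtains h t where "coprime h D" "n dvd h * D ^ t"
proof -
  have "\<exists>h t. coprime h D \<and> n dvd h * D ^ t" using assms(1)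
  proof (induction n rule: less_induct)
    case (less n)
    show ?case
    proof (cases "coprime n D")
      case True
      then show ?thesis by (intro exI[of _ n] exI[of _ 0]) simp
    next
      case False
      define e where "e = gcd n D"
      have e: "e > 1" using False less.prems assms(2) unfolding e_def coprime_iff_gcd_eq_1
        by (metis gcd_pos_nat less_one linorder_neqE_nat not_gr_zero)
      obtain n' where n': "n = e * n'" using e_def by (metis dvdE gcd_dvd1)
      have pos: "n' > 0" using less.prems n' by (cases n') simp_all
      have "n' < n" unfolding n' using e pos by simp
      from less.IH[OF this pos] obtain h t where ht: "coprime h D" "n' dvd h * D ^ t" by auto
      have "e dvd D" by (simp add: e_def)
      then have "e * n' dvd D * (h * D ^ t)" using ht(2) by (rule mult_dvd_mono)
      then have "n dvd h * D ^ Suc t" by (simp add: n' mult.left_commute)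
      then show ?thesis using ht(1) by (intro exI[of _ h] exI[of _ "Suc t"]) simp
    qed
  qed
  then show thesis using that by auto
qed

context eigen_system begin

lemma lam_nonzero: "i < N \<Longrightarrow> g \<in> carrier G \<Longrightarrow> lam i g \<noteq> 0"
  using is_char_nonzero[OF lam_char] .

lemma chi_nonzero: "g \<in> carrier G \<Longrightarrow> chi g \<noteq> 0"
  using is_char_nonzero[OF chi_char] .

lemma lam_pow: "i < N \<Longrightarrow> g \<in> carrier G \<Longrightarrow> lam i (g [^] (k::nat)) = lam i g ^ k"
  using is_char_pow[OF is_group lam_char] .

lemma chi_pow: "g \<in> carrier G \<Longrightarrow> chi (g [^] (k::nat)) = chi g ^ k"
  using is_char_pow[OF is_group chi_char] .

lemma char_power_card: "is_char G \<chi> \<Longrightarrow> g \<in> carrier G \<Longrightarrow> \<chi> g ^ card (carrier G) = 1"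
  using is_char_pow[OF is_group, of \<chi> g "card (carrier G)"] pow_order_eq_1[of g] is_char_one[OF is_group, of \<chi>]
  by (simp add: Coset.order_def)

definition arrow :: "nat \<Rightarrow> nat" where
  "arrow u = (SOME w. w < N \<and> (\<forall>g\<in>carrier G. lam w g * lam u g ^ (d - 1) = chi g))"

lemma arrow:
  assumes "u < N"
  shows "arrow u < N" and "g \<in> carrier G \<Longrightarrow> lam (arrow u) g * lam u g ^ (d - 1) = chi g"
proof -
  have "\<exists>w. w < N \<and> (\<forall>g\<in>carrier G. lam w g * lam u g ^ (d - 1) = chi g)"
    using arrow_ex[OF assms] by auto
  from someI_ex[OF this] show "arrow u < N" "g \<in> carrier G \<Longrightarrow> lam (arrow u) g * lam u g ^ (d - 1) = chi g"
    unfolding arrow_def by auto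
qed

end

text \<open>With $M$ a power of $d-1$, raising to the $M$-th power maps $G$ onto its part of order prime to $d-1$. So
  the $M$-th powers of the characters stand for their restrictions to that part.\<close>

locale eigen_system_mod = eigen_system +
  fixes h M :: nat
  assumes coprime_h: "coprime h (d - 1)" and exponent: "\<And>g. g \<in> carrier G \<Longrightarrow> g [^] (h * M) = \<one>"
begin

definition eqv :: "nat \<Rightarrow> nat \<Rightarrow> bool" where
  "eqv i k \<longleftrightarrow> (\<forall>g\<in>carrier G. lam i g ^ M = lam k g ^ M)"

text \<open>A canonical index in each class of characters with the same $M$-th power; \<open>X\<close> is the set of these indices
  and \<open>\<phi>\<close> is the map induced by the arrows.\<close>

definition rep :: "nat \<Rightarrow> nat" where
  "rep i = (LEAST k. k < N \<and> eqv i k)"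

definition X :: "nat set" where "X = rep ` {..<N}"

definition \<phi> :: "nat \<Rightarrow> nat" where "\<phi> x = rep (arrow x)"

lemma eqv_refl: "eqv i i" by (simp add: eqv_def)

lemma rep: assumes "i < N" shows "rep i < N" "eqv i (rep i)"
  using LeastI[of "\<lambda>k. k < N \<and> eqv i k" i] assms eqv_refl unfolding rep_def by auto

lemma rep_cong:
  assumes "eqv i k"
  shows "rep i = rep k"
proof -
  have "eqv i = eqv k"
  proof
    fix x show "eqv i x = eqv k x" using assms by (simp add: eqv_def)
  qed
  then show ?thesis unfolding rep_def by simp
qed

lemma rep_eq_iff: "i < N \<Longrightarrow> k < N \<Longrightarrow> rep i = rep k \<longleftrightarrow> eqv i k"
  using rep[of i] rep[of k] rep_cong by (metis (mono_tags, lifting) eqv_def)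

lemma X_sub: "X \<subseteq> {..<N}" using rep by (auto simp: X_def)

lemma finite_X: "finite X" using finite_subset[OF X_sub] by simp

lemma rep_X: "x \<in> X \<Longrightarrow> rep x = x"
proof -
  assume "x \<in> X"
  then obtain i where "i < N" "x = rep i" by (auto simp: X_def)
  then show "rep x = x" using rep_cong[OF rep(2)[of i]] by simp
qed

lemma lam_rep: "i < N \<Longrightarrow> g \<in> carrier G \<Longrightarrow> lam (rep i) g ^ M = lam i g ^ M"
  using rep(2)[of i] by (simp add: eqv_def)

lemma arrow_power:
  assumes "i < N" "g \<in> carrier G"
  shows "lam (arrow i) g ^ M * lam i g ^ (M * (d - 1)) = chi g ^ M"
  using arrow(2)[OF assms]
  by (metis mult.commute power_mult power_mult_distrib)

text \<open>Along an arrow $i \to w$ the character $\lambda_w^M$ is determined by $\lambda_i^M$. The converse holds because a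
  ratio of $M$-th powers has order dividing $h$, so that it is trivial as soon as its $(d-1)$-st power is.\<close>

lemma eqv_arrow_iff:
  assumes ik: "i < N" "k < N"
  shows "eqv (arrow i) (arrow k) \<longleftrightarrow> eqv i k"
proof
  assume eq: "eqv i k"
  show "eqv (arrow i) (arrow k)" unfolding eqv_def
  proof
    fix g assume g: "g \<in> carrier G"
    have "lam i g ^ (M * (d - 1)) = lam k g ^ (M * (d - 1))"
      using eq g by (simp add: eqv_def power_mult)
    then have "lam (arrow i) g ^ M * lam k g ^ (M * (d - 1)) = lam (arrow k) g ^ M * lam k g ^ (M * (d - 1))"
      using arrow_power[OF ik(1) g] arrow_power[OF ik(2) g] by simp
    then show "lam (arrow i) g ^ M = lam (arrow k) g ^ M"
      using lam_nonzero[OF ik(2) g] by simp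
  qed
next
  assume eq: "eqv (arrow i) (arrow k)"
  show "eqv i k" unfolding eqv_def
  proof
    fix g assume g: "g \<in> carrier G"
    define z where "z = (lam i g / lam k g) ^ M"
    have "lam (arrow k) g ^ M * lam i g ^ (M * (d - 1)) = lam (arrow k) g ^ M * lam k g ^ (M * (d - 1))"
      using arrow_power[OF ik(1) g] arrow_power[OF ik(2) g] eq g by (simp add: eqv_def)
    then have "lam i g ^ (M * (d - 1)) = lam k g ^ (M * (d - 1))"
      using lam_nonzero[OF arrow(1)[OF ik(2)] g] by simp
    then have 1: "z ^ (d - 1) = 1"
      using lam_nonzero[OF ik(2) g] by (simp add: z_def power_divide flip: power_mult)
    have "lam l g ^ (h * M) = 1" if "l < N" for l
      using lam_pow[OF that g, of "h * M"] exponent[OF g] is_char_one[OF is_group lam_char[OF that]] by simp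
    then have 2: "z ^ h = 1"
      using ik by (simp add: z_def power_divide mult.commute[of M] flip: power_mult)
    have "z = 1" by (rule eq_1_of_coprime_powers[OF 2 1 coprime_h])
    then show "lam i g ^ M = lam k g ^ M"
      using lam_nonzero[OF ik(2) g] by (simp add: z_def power_divide)
  qed
qed

lemma \<phi>_rep: "i < N \<Longrightarrow> \<phi> (rep i) = rep (arrow i)"
  unfolding \<phi>_def
  by (rule rep_cong) (use eqv_arrow_iff[of "rep i" i] rep[of i] in \<open>simp add: eqv_def\<close>)

lemma \<phi>_X: "\<phi> ` X \<subseteq> X"
  using \<phi>_rep arrow(1) by (auto simp: X_def)

lemma inj_\<phi>: "inj_on \<phi> X"
proof (rule inj_onI)
  fix x y assume xy: "x \<in> X" "y \<in> X" "\<phi> x = \<phi> y"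
  have N: "x < N" "y < N" using xy X_sub by auto
  have "eqv x y"
    using xy(3) rep_eq_iff[OF arrow(1)[OF N(1)] arrow(1)[OF N(2)]] eqv_arrow_iff[OF N] by (simp add: \<phi>_def)
  then show "x = y" using rep_cong rep_X xy by metis
qed

lemma \<phi>_relation:
  assumes "x \<in> X" "g \<in> carrier G"
  shows "lam (\<phi> x) g ^ M * lam x g ^ (M * (d - 1)) = chi g ^ M"
proof -
  have x: "x < N" using assms X_sub by auto
  show ?thesis using arrow_power[OF x assms(2)] lam_rep[OF arrow(1)[OF x] assms(2)] by (simp add: \<phi>_def)
qed

lemma X_nonempty: "X \<noteq> {}" using N1 by (auto simp: X_def lessThan_empty_iff)

lemma faithful_X:
  assumes g: "g \<in> carrier G" and eq: "\<And>x y. x \<in> X \<Longrightarrow> y \<in> X \<Longrightarrow> lam x g ^ (M * k) = lam y g ^ (M * k)"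
  shows "g [^] (M * k) = \<one>"
proof (rule lam_faithful)
  fix i j assume ij: "i < N" "j < N"
  have "lam (rep i) g ^ (M * k) = lam (rep j) g ^ (M * k)"
    by (rule eq) (use ij in \<open>auto simp: X_def\<close>)
  then have "lam i g ^ (M * k) = lam j g ^ (M * k)"
    unfolding power_mult lam_rep[OF ij(1) g] lam_rep[OF ij(2) g] .
  then show "lam i (g [^] (M * k)) = lam j (g [^] (M * k))"
    by (simp add: lam_pow ij g)
qed (use g in simp)

lemma funpow_\<phi>_rep: "i < N \<Longrightarrow> (arrow ^^ k) i < N \<and> (\<phi> ^^ k) (rep i) = rep ((arrow ^^ k) i)"
  by (induction k) (simp_all add: arrow(1) \<phi>_rep)

text \<open>The order of $c = g_0^h$ divides $(d-1)^s$ but not $(d-1)^{s-1}$. The normalised eigenvalues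
  $\nu_i = \lambda_i(c)^d / \chi(c)$ satisfy $\nu_{w} = \nu_i^{-(d-1)}$ along an arrow $i \to w$. The normalisation
  loses nothing because $d$ is prime to the order of $c$. Starting at an index where the order of $\nu$ does not divide $(d-1)^{s-1}$, the arrows pass
  through $s$ different indices with $\nu \ne 1$ (the set $W$). The remaining indices, the set $Z$, are mapped
  onto $X$, since going round a cycle of $\phi$ often enough ends in $Z$.

  If there is no index to spare, let $u$ be the last index of the chain, $y$ its target, and $v$ the index in
  $Z$ with the class of $u$. The second target $w \ne y$ for $u$ and $v$ lies in the class of $y$ and has
  $\nu_w^{d-1} = 1$. So $w$ cannot be in $Z$, where $y$ is the only element of its class, and the only such element
  of the chain is $u$ itself. Then $u$ and $y$ have the same class, which is therefore fixed by $\phi$.\<close>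

lemma card_bound:
  assumes s: "s \<ge> 1" "M = (d - 1) ^ s" and g0: "g0 \<in> carrier G" "g0 [^] (h * (d - 1) ^ (s - 1)) \<noteq> \<one>"
  shows "card X + s \<le> N" and "(\<And>x. x \<in> X \<Longrightarrow> \<phi> x \<noteq> x) \<Longrightarrow> card X + s + 1 \<le> N"
proof -
  define c where "c = g0 [^] h"
  have c: "c \<in> carrier G" using g0 by (simp add: c_def)
  have cM: "c [^] M = \<one>" using exponent[OF g0(1)] g0(1) by (simp add: c_def nat_pow_pow)
  have lamM: "lam i c ^ M = 1" if "i < N" for i
    using lam_pow[OF that c, of M] cM is_char_one[OF is_group lam_char[OF that]] by simp
  have chiM: "chi c ^ M = 1" using chi_pow[OF c, of M] cM is_char_one[OF is_group chi_char] by simp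
  define nu where "nu i = lam i c ^ d / chi c" for i
  have chi0: "chi c \<noteq> 0" by (rule chi_nonzero[OF c])
  have lam0: "lam i c \<noteq> 0" if "i < N" for i by (rule lam_nonzero[OF that c])
  have nuM: "nu i ^ M = 1" if "i < N" for i
  proof -
    have "(lam i c ^ d) ^ M = (lam i c ^ M) ^ d" by (simp flip: power_mult add: mult.commute)
    then show ?thesis using lamM[OF that] chiM by (simp add: nu_def power_divide)
  qed
  have nu_arrow: "nu (arrow i) * nu i ^ (d - 1) = 1" if i: "i < N" for i
  proof -
    have "chi c ^ d = chi c * chi c ^ (d - 1)" using d3 by (cases d) simp_all
    moreover have "(lam (arrow i) c * lam i c ^ (d - 1)) ^ d = lam (arrow i) c ^ d * (lam i c ^ d) ^ (d - 1)"
      by (simp add: power_mult_distrib flip: power_mult) (simp add: mult.commute)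
    ultimately have "lam (arrow i) c ^ d * (lam i c ^ d) ^ (d - 1) = chi c * chi c ^ (d - 1)"
      using arrow(2)[OF i c] by simp
    moreover have "nu (arrow i) * nu i ^ (d - 1)
        = (lam (arrow i) c ^ d * (lam i c ^ d) ^ (d - 1)) / (chi c * chi c ^ (d - 1))"
      by (simp add: nu_def power_divide)
    ultimately show ?thesis using chi0 by simp
  qed
  have nu_iff1: "nu (arrow i) ^ k = 1 \<longleftrightarrow> nu i ^ ((d - 1) * k) = 1" if i: "i < N" for i k
  proof -
    have "nu (arrow i) ^ k * nu i ^ ((d - 1) * k) = 1"
      using nu_arrow[OF i] by (simp add: power_mult flip: power_mult_distrib)
    then show ?thesis by (metis mult_cancel_left1 mult_cancel_right2 mult_zero_right zero_neq_one)
  qed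
  have nu_iff: "nu ((arrow ^^ t) i) ^ k = 1 \<longleftrightarrow> nu i ^ ((d - 1) ^ t * k) = 1" if i: "i < N" for i t k
  proof (induction t arbitrary: k)
    case (Suc t)
    have "nu ((arrow ^^ Suc t) i) ^ k = 1 \<longleftrightarrow> nu ((arrow ^^ t) i) ^ ((d - 1) * k) = 1"
      using nu_iff1[of "(arrow ^^ t) i" k] funpow_\<phi>_rep[OF i, of t] by simp
    also have "\<dots> \<longleftrightarrow> nu i ^ ((d - 1) ^ t * ((d - 1) * k)) = 1" by (rule Suc.IH)
    finally show ?case by (simp add: mult_ac)
  qed simp
  have "\<exists>i<N. nu i ^ ((d - 1) ^ (s - 1)) \<noteq> 1"
  proof (rule ccontr)
    assume "\<not> ?thesis"
    then have nu1: "nu i ^ ((d - 1) ^ (s - 1)) = 1" if "i < N" for i using that by auto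
    define e where "e = (d - 1) ^ (s - 1)"
    have Me: "M = e * (d - 1)" using s by (cases s) (simp_all add: e_def)
    have "lam i c ^ e = chi c ^ e" if i: "i < N" for i
    proof -
      have "lam i c ^ (e * d) = chi c ^ e"
        using nu1[OF i] chi0 by (simp add: nu_def power_divide e_def mult.commute flip: power_mult)
      moreover have "lam i c ^ (e * d) = lam i c ^ M * lam i c ^ e"
        using d3 by (cases d) (simp_all add: Me power_add)
      ultimately show ?thesis using lamM[OF i] by simp
    qed
    then have "c [^] e = \<one>"
      by (intro lam_faithful) (simp_all add: c lam_pow)
    then show False using g0 by (simp add: c_def e_def nat_pow_pow)
  qed
  then obtain i0 where i0: "i0 < N" "nu i0 ^ ((d - 1) ^ (s - 1)) \<noteq> 1" by auto
  have i0_small: "nu i0 ^ ((d - 1) ^ t) \<noteq> 1" if "t < s" for t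
  proof
    assume "nu i0 ^ ((d - 1) ^ t) = 1"
    moreover have "(d - 1) ^ t dvd (d - 1) ^ (s - 1)" using that by (intro le_imp_power_dvd) simp
    ultimately show False using i0(2) power_eq_1_dvd by blast
  qed
  define p where "p t = (arrow ^^ t) i0" for t
  have pN: "p t < N" for t using funpow_\<phi>_rep[OF i0(1), of t] by (simp add: p_def)
  have nu_p: "nu (p t) ^ k = 1 \<longleftrightarrow> nu i0 ^ ((d - 1) ^ t * k) = 1" for t k
    unfolding p_def by (rule nu_iff[OF i0(1)])
  define Z where "Z = {i\<in>{..<N}. nu i = 1}"
  define W where "W = {i\<in>{..<N}. nu i \<noteq> 1}"
  have finZW: "finite Z" "finite W" by (simp_all add: Z_def W_def)
  have cardN: "card Z + card W = N"
  proof -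
    have "Z \<union> W = {..<N}" "Z \<inter> W = {}" by (auto simp: Z_def W_def)
    then show ?thesis using card_Un_disjoint[OF finZW] by simp
  qed
  have pW: "p ` {..<s} \<subseteq> W"
  proof
    fix x assume "x \<in> p ` {..<s}"
    then obtain t where t: "t < s" "x = p t" by auto
    then show "x \<in> W" using nu_p[of t 1] i0_small[OF t(1)] pN by (simp add: W_def)
  qed
  have inj_p: "inj_on p {..<s}"
  proof (rule linorder_inj_onI)
    fix t t' assume t: "t < t'" "t \<in> {..<s}" "t' \<in> {..<s}"
    show "p t \<noteq> p t'"
    proof
      assume eq: "p t = p t'"
      have "nu (p t') ^ ((d - 1) ^ (s - t')) = 1"
        unfolding nu_p using nuM[OF i0(1)] t(3) s(2) by (simp flip: power_add)
      then have "nu i0 ^ ((d - 1) ^ (t + (s - t'))) = 1"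
        unfolding eq[symmetric] nu_p by (simp add: power_add)
      moreover have "t + (s - t') < s" using t by auto
      ultimately show False using i0_small by blast
    qed
  qed auto
  have repZ: "rep ` Z = X"
  proof (rule equalityI)
    show "rep ` Z \<subseteq> X" unfolding X_def by (rule image_mono) (auto simp: Z_def)
    show "X \<subseteq> rep ` Z"
    proof
      fix x assume x: "x \<in> X"
      then have xN: "x < N" using X_sub by auto
      obtain n where n: "n \<ge> 1" "(\<phi> ^^ n) x = x" using funpow_period[OF finite_X inj_\<phi> \<phi>_X x] .
      have per: "((\<phi> ^^ n) ^^ m) x = x" for m by (induction m) (simp_all add: n(2))
      define i where "i = (arrow ^^ (n * s)) x"
      have "(\<phi> ^^ (n * s)) x = x" using per[of s] by (simp add: funpow_mult mult.commute)
      then have "rep i = x" and iN: "i < N" using funpow_\<phi>_rep[OF xN, of "n * s"] rep_X[OF x] by (simp_all add: i_def)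
      have "M dvd (d - 1) ^ (n * s)" unfolding s(2) by (rule le_imp_power_dvd) (use n(1) in simp)
      then have "nu x ^ ((d - 1) ^ (n * s)) = 1" by (rule power_eq_1_dvd[OF nuM[OF xN]])
      then have "nu i = 1" using nu_iff[OF xN, of "n * s" 1] by (simp add: i_def)
      then show "x \<in> rep ` Z" using \<open>rep i = x\<close> iN by (auto simp: Z_def)
    qed
  qed
  have cZ: "card X \<le> card Z" using card_image_le[OF finZW(1), of rep] by (simp add: repZ)
  have cp: "card (p ` {..<s}) = s" using card_image[OF inj_p] by simp
  have cW: "s \<le> card W" using card_mono[OF finZW(2) pW] cp by simp
  show "card X + s \<le> N" using cZ cW cardN by simp
  assume nofix: "\<And>x. x \<in> X \<Longrightarrow> \<phi> x \<noteq> x"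
  show "card X + s + 1 \<le> N"
  proof (rule ccontr)
    assume "\<not> ?thesis"
    then have eqs: "card Z = card X" "card W = s" using cZ cW cardN by simp_all
    have injZ: "inj_on rep Z" by (rule eq_card_imp_inj_on[OF finZW(1)]) (simp add: repZ eqs)
    have Wp: "p ` {..<s} = W" by (rule card_subset_eq[OF finZW(2) pW]) (simp add: cp eqs)
    define u where "u = p (s - 1)"
    define y where "y = arrow u"
    have u: "u < N" by (simp add: u_def pN)
    have y: "y < N" using arrow(1)[OF u] by (simp add: y_def)
    have nu_u: "nu u ^ (d - 1) = 1"
      unfolding u_def nu_p using nuM[OF i0(1)] s by (cases s) (simp_all add: mult.commute)
    have "nu y = 1" using nu_iff1[OF u, of 1] nu_u by (simp add: y_def)
    then have yZ: "y \<in> Z" using y by (simp add: Z_def)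
    have "rep u \<in> rep ` Z" unfolding repZ X_def using u by simp
    then obtain v where v: "v \<in> Z" "rep v = rep u" by auto
    have vN: "v < N" and nu_v: "nu v = 1" using v(1) by (simp_all add: Z_def)
    have "u \<in> W" using pW s(1) by (auto simp: u_def)
    then have uv: "u \<noteq> v" using nu_v by (auto simp: W_def)
    obtain w where w: "w < N" "w \<noteq> y"
      "\<And>g. g \<in> carrier G \<Longrightarrow> lam u g = lam v g \<Longrightarrow> lam w g * lam u g ^ (d - 1) = chi g"
      using two_targets[OF u vN uv y] by auto
    have uv_eqv: "eqv u v" using v(2) rep_eq_iff[OF vN u] by (simp add: eqv_def)
    have "eqv w y" unfolding eqv_def
    proof
      fix g assume g: "g \<in> carrier G"
      have gM: "g [^] M \<in> carrier G" using g by simp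
      have "lam u (g [^] M) = lam v (g [^] M)" using uv_eqv g by (simp add: lam_pow u vN eqv_def)
      then have "lam w (g [^] M) * lam u (g [^] M) ^ (d - 1) = lam y (g [^] M) * lam u (g [^] M) ^ (d - 1)"
        using w(3)[OF gM] arrow(2)[OF u gM] by (simp add: y_def)
      then have "lam w (g [^] M) = lam y (g [^] M)" using lam_nonzero[OF u gM] by simp
      then show "lam w g ^ M = lam y g ^ M" by (simp add: lam_pow w(1) y g)
    qed
    then have rep_wy: "rep w = rep y" by (rule rep_cong)
    \<comment> \<open>At $c^{d-1}$ both normalised eigenvalues are $1$. So the ratio $q$ of the two eigenvalues has an order dividing $d$ as well as a power of $d-1$, and they agree.\<close>
    define c2 where "c2 = c [^] (d - 1)"
    have c2: "c2 \<in> carrier G" using c by (simp add: c2_def)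
    define q where "q = (lam u c / lam v c) ^ (d - 1)"
    have "(lam u c / lam v c) ^ d = nu u / nu v"
      using chi0 by (simp add: nu_def power_divide)
    then have "q ^ d = nu u ^ (d - 1)"
      using nu_v by (simp add: q_def flip: power_mult) (simp add: mult.commute power_mult)
    then have qd: "q ^ d = 1" using nu_u by simp
    have "q ^ M = ((lam u c / lam v c) ^ M) ^ (d - 1)" by (simp add: q_def mult.commute flip: power_mult)
    then have qM: "q ^ M = 1" using lamM u vN by (simp add: power_divide)
    have "coprime d (d - 1)" using d3 by (metis Suc_pred' coprime_Suc_left_nat gr0I not_numeral_le_zero)
    then have "coprime d M" by (simp add: s(2))
    then have "q = 1" by (rule eq_1_of_coprime_powers[OF qd qM])
    then have lam_uv: "lam u c2 = lam v c2"
      using lam0[OF vN] by (simp add: q_def power_divide c2_def lam_pow u vN c)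
    have u_c2: "lam u c2 ^ d = chi c2"
    proof -
      have "nu u ^ (d - 1) = lam u c2 ^ d / chi c2"
        by (simp add: nu_def power_divide c2_def lam_pow chi_pow u c mult.commute flip: power_mult)
      then show ?thesis using nu_u chi_nonzero[OF c2] by simp
    qed
    have "lam u c2 ^ d = lam u c2 * lam u c2 ^ (d - 1)" using d3 by (cases d) simp_all
    then have "lam w c2 = lam u c2"
      using w(3)[OF c2 lam_uv] u_c2 lam_nonzero[OF u c2] by simp
    moreover have "nu i ^ (d - 1) = lam i c2 ^ d / chi c2" if "i < N" for i
      by (simp add: nu_def power_divide c2_def lam_pow chi_pow that c mult.commute flip: power_mult)
    ultimately have nu_w: "nu w ^ (d - 1) = 1" using u_c2 chi_nonzero[OF c2] w(1) by simp
    show False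
    proof (cases "w \<in> Z")
      case True
      then have "w = y" using inj_onD[OF injZ rep_wy] yZ by simp
      then show False using w(2) by simp
    next
      case False
      then have "w \<in> W" using w(1) by (simp add: Z_def W_def)
      then have "w \<in> p ` {..<s}" by (simp only: Wp)
      then obtain t where t: "t < s" "w = p t" by auto
      have "nu i0 ^ ((d - 1) ^ (t + 1)) = 1" using nu_w unfolding t(2) nu_p by (simp add: mult.commute)
      then have "\<not> t + 1 < s" using i0_small by blast
      then have "t = s - 1" using t(1) by simp
      then have "w = u" using t(2) by (simp add: u_def)
      then have "\<phi> (rep u) = rep u" using rep_wy \<phi>_rep[OF u] by (simp add: y_def)
      moreover have "rep u \<in> X" using u by (simp add: X_def)
      ultimately show False using nofix by blast
    qed
  qed
qed

end

section \<open>Characters on the cycles\<close>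

text \<open>Each orbit gets a root, with \<^term>\<open>x0\<close> as a prescribed one, and each point a number of steps from the root of
  its orbit. The number is determined only up to periods.\<close>

lemma orbit_roots:
  fixes f :: "nat \<Rightarrow> nat"
  assumes "finite X" "inj_on f X" "f ` X \<subseteq> X" "x0 \<in> X"
  obtains root ht where "\<And>x. x \<in> X \<Longrightarrow> root x \<in> X" "\<And>x. x \<in> X \<Longrightarrow> (f ^^ ht x) (root x) = x"
    "\<And>x. x \<in> X \<Longrightarrow> root (f x) = root x" "\<And>x. x \<in> X \<Longrightarrow> root (root x) = root x" "root x0 = x0"
proof -
  define orb where "orb x = {y. \<exists>k. y = (f ^^ k) x}" for x
  define root where "root x = (if x0 \<in> orb x then x0 else (LEAST y. y \<in> orb x))" for x
  have self: "x \<in> orb x" for x unfolding orb_def by (rule CollectI, rule exI[of _ 0]) simp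
  have orb_f: "orb (f x) = orb x" if x: "x \<in> X" for x
  proof (rule equalityI; rule subsetI)
    fix y assume "y \<in> orb (f x)"
    then obtain k where "y = (f ^^ k) (f x)" by (auto simp: orb_def)
    then have "y = (f ^^ Suc k) x" by (simp add: funpow_swap1)
    then show "y \<in> orb x" unfolding orb_def mem_Collect_eq by (rule exI)
  next
    fix y assume "y \<in> orb x"
    then obtain k where k: "y = (f ^^ k) x" by (auto simp: orb_def)
    obtain n where n: "n \<ge> 1" "(f ^^ n) x = x" using funpow_period[OF assms(1-3) x] .
    have "y = (f ^^ k) ((f ^^ n) x)" by (simp add: k n(2))
    also have "\<dots> = (f ^^ (k + (n - 1))) (f x)"
      using n(1) by (cases n) (simp_all add: funpow_add funpow_swap1)
    finally show "y \<in> orb (f x)" unfolding orb_def mem_Collect_eq by (rule exI)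
  qed
  have orb_pow: "orb ((f ^^ k) x) = orb x" if "x \<in> X" for k x
    by (induction k) (simp_all add: orb_f funpow_closed[OF assms(3) that])
  have orb_eq: "orb y = orb x" if "x \<in> X" "y \<in> orb x" for x y
  proof -
    obtain k where "y = (f ^^ k) x" using \<open>y \<in> orb x\<close> by (auto simp: orb_def)
    then show ?thesis using orb_pow[OF \<open>x \<in> X\<close>] by simp
  qed
  have root_orb: "root x \<in> orb x" for x
    using self[of x] LeastI[of "\<lambda>y. y \<in> orb x" x] by (simp add: root_def)
  have root_cong: "root y = root x" if "orb y = orb x" for x y by (simp add: root_def that)
  have orb_X: "y \<in> X" if "x \<in> X" "y \<in> orb x" for x y
    using that funpow_closed[OF assms(3)] by (auto simp: orb_def)
  have "\<exists>k. (f ^^ k) (root x) = x" if x: "x \<in> X" for x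
  proof -
    have "x \<in> orb (root x)" using orb_eq[OF x root_orb] self by simp
    then show ?thesis unfolding orb_def mem_Collect_eq by metis
  qed
  then obtain ht where ht: "\<And>x. x \<in> X \<Longrightarrow> (f ^^ ht x) (root x) = x" by metis
  have 1: "root x \<in> X" if "x \<in> X" for x by (rule orb_X[OF that root_orb])
  have 2: "root (f x) = root x" if "x \<in> X" for x by (rule root_cong[OF orb_f[OF that]])
  have 3: "root (root x) = root x" if "x \<in> X" for x by (rule root_cong[OF orb_eq[OF that root_orb]])
  have 4: "root x0 = x0" using self[of x0] by (simp add: root_def)
  show thesis by (rule that[OF 1 ht 2 3 4])
qed

lemma gcd_prime_power_dvd:
  fixes p u v :: nat
  assumes "prime p" "v \<noteq> 0" "multiplicity p u \<le> multiplicity p v" "u \<noteq> 0"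
  shows "gcd u (p ^ A) dvd v"
proof -
  obtain j where j: "gcd u (p ^ A) = p ^ j" using divides_primepow_nat[OF assms(1)] by (metis gcd_dvd2)
  have p: "\<not> is_unit p" using assms(1) not_prime_unit by blast
  have "p ^ j dvd u" unfolding j[symmetric] by (rule gcd_dvd1)
  then have "j \<le> multiplicity p u" using power_dvd_iff_le_multiplicity[of u p j] assms(4) p by blast
  then have "j \<le> multiplicity p v" using assms(3) by linarith
  then show ?thesis unfolding j using power_dvd_iff_le_multiplicity[of v p j] assms(2) p by blast
qed

context eigen_system_mod begin

text \<open>Dividing all characters by the one at the fixed point turns $\chi$ into the trivial character. The
  fixed point itself then carries the trivial character and can be left out.\<close>

lemma cycle_characters_fixed_point:
  assumes x0: "x0 \<in> X" "\<phi> x0 = x0" and p: "prime p" "coprime p M"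
  shows "\<exists>\<Omega>. (\<forall>x\<in>X. is_char G (\<Omega> x) \<and> (\<forall>g\<in>carrier G. \<Omega> x g ^ (d - 1) * \<Omega> (\<phi> x) g = 1)) \<and>
    (\<forall>g\<in>carrier G. g [^] p = \<one> \<longrightarrow> g \<noteq> \<one> \<longrightarrow> (\<exists>x\<in>X - {x0}. \<Omega> x g \<noteq> 1))"
proof (intro exI conjI ballI impI)
  define \<Omega> where "\<Omega> x g = (lam x g / lam x0 g) ^ M" for x g
  have N: "x < N" if "x \<in> X" for x using that X_sub by auto
  fix x assume x: "x \<in> X"
  show "is_char G (\<Omega> x)"
    unfolding \<Omega>_def by (intro is_char_power is_char_divide lam_char N x x0(1))
  fix g assume g: "g \<in> carrier G"
  have "lam (\<phi> x) g ^ M * lam x g ^ (M * (d - 1)) = lam x0 g ^ M * lam x0 g ^ (M * (d - 1))"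
    using \<phi>_relation[OF x g] \<phi>_relation[OF x0(1) g] x0(2) by simp
  then show "\<Omega> x g ^ (d - 1) * \<Omega> (\<phi> x) g = 1"
    using lam_nonzero[OF N[OF x0(1)] g] by (simp add: \<Omega>_def power_divide power_mult mult.commute)
next
  fix g assume g: "g \<in> carrier G" "g [^] p = \<one>" "g \<noteq> \<one>"
  have N: "x < N" if "x \<in> X" for x using that X_sub by auto
  show "\<exists>x\<in>X - {x0}. (lam x g / lam x0 g) ^ M \<noteq> 1"
  proof (rule ccontr)
    assume "\<not> ?thesis"
    then have "(lam x g / lam x0 g) ^ M = 1" if "x \<in> X" for x
      using that lam_nonzero[OF N[OF x0(1)] g(1)] by (cases "x = x0") auto
    then have eq: "lam x g ^ M = lam x0 g ^ M" if "x \<in> X" for x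
      using that lam_nonzero[OF N[OF x0(1)] g(1)] by (simp add: power_divide)
    have "g [^] (M * 1) = \<one>" by (rule faithful_X[OF g(1)]) (simp add: eq)
    then have gM: "g [^] M = \<one>" by simp
    have "lam i g = 1" if i: "i < N" for i
    proof (rule eq_1_of_coprime_powers[OF _ _ p(2)])
      show "lam i g ^ p = 1" "lam i g ^ M = 1"
        using lam_pow[OF i g(1), symmetric] g(2) gM is_char_one[OF is_group lam_char[OF i]] by simp_all
    qed
    then show False using lam_faithful[OF g(1)] g(3) by simp
  qed
qed

text \<open>Pass to characters $\psi_x$ of $p$-power order and divide by $\psi_{x_0}$. The quotients $\beta_x$ satisfy
  $\beta_{\phi(x)} = \beta_x^Q a$, where $Q$ stands for the exponent $1 - d$, so that
  $\beta_{\phi^k(x)} = \beta_x^{Q^k} a^{U(k)}$ with $U(k) = 1 + Q + \cdots + Q^{k-1}$. The factor $a$ prevents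
  them from being the weights of an action that fixes the form. But $a^{U(n_0)} = 1$ if $n_0$ is a period of $x_0$; if
  $(x_0, n_0)$ is chosen with the multiplicity of $p$ in $U(n_0)$ minimal among all points and periods, then
  $a^{U(n)} = 1$ for every period $n$ of every point, as $a$ has $p$-power order. Therefore
  $\beta_x^{Q^n} = \beta_x$ for each period $n$ of $x$, and the value at the root of an orbit extends to the whole
  orbit by $\Omega_{\phi(x)} = \Omega_x^Q$.

  On the orbit of $x_0$, where $\beta_{x_0}$ is trivial, $\beta_{\phi(x_0)} = a$ is used instead. Then $a$ and the
  $\beta$ of all roots can be recovered from $\Omega$, and with them all $\beta_x$. So an element of order $p$ in the
  kernel would act on the original space by a scalar.\<close>

lemma cycle_characters:
  assumes p: "prime p" "coprime p M"
  shows "\<exists>\<Omega>. (\<forall>x\<in>X. is_char G (\<Omega> x) \<and> (\<forall>g\<in>carrier G. \<Omega> x g ^ (d - 1) * \<Omega> (\<phi> x) g = 1)) \<and>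
    (\<forall>g\<in>carrier G. g [^] p = \<one> \<longrightarrow> g \<noteq> \<one> \<longrightarrow> (\<exists>x\<in>X. \<Omega> x g \<noteq> 1))"
proof -
  have N: "x < N" if "x \<in> X" for x using that X_sub by auto
  define m where "m = card (carrier G)"
  have m: "m > 0" using fin one_closed by (auto simp: m_def card_gt_0_iff)
  obtain r A where r: "coprime r p" "m dvd r * p ^ A"
    using dvd_coprime_times_power[OF m prime_gt_0_nat[OF p(1)]] .
  \<comment> \<open>a natural number congruent to $1 - d$ modulo the order of $G$\<close>
  define Q where "Q = (m - 1) * (d - 1)"
  have Qd: "Q + (d - 1) = m * (d - 1)" using m by (cases m) (simp_all add: Q_def)
  have m_pow: "\<chi> g ^ m = 1" if "is_char G \<chi>" "g \<in> carrier G" for \<chi> g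
    using char_power_card[OF that] by (simp add: m_def)
  have Q_inv: "\<chi> g ^ Q * \<chi> g ^ (d - 1) = 1" if "is_char G \<chi>" "g \<in> carrier G" for \<chi> g
    unfolding power_add[symmetric] Qd power_mult using m_pow[OF that] by simp
  define \<psi> where "\<psi> x g = lam x g ^ (M * r)" for x g
  have \<psi>_char: "is_char G (\<psi> x)" if "x \<in> X" for x
    unfolding \<psi>_def by (intro is_char_power lam_char N that)
  have \<psi>0: "\<psi> x g \<noteq> 0" if "x \<in> X" "g \<in> carrier G" for x g
    using is_char_nonzero[OF \<psi>_char] that .
  have \<psi>_\<phi>: "\<psi> (\<phi> x) g = chi g ^ (M * r) * \<psi> x g ^ Q" if x: "x \<in> X" and g: "g \<in> carrier G" for x g
  proof -
    have "\<psi> (\<phi> x) g * \<psi> x g ^ (d - 1) = (lam (\<phi> x) g ^ M * lam x g ^ (M * (d - 1))) ^ r"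
      by (simp add: \<psi>_def power_mult_distrib mult_ac flip: power_mult)
    also have "\<dots> = chi g ^ (M * r)" unfolding \<phi>_relation[OF x g] by (simp add: power_mult)
    finally have "\<psi> (\<phi> x) g * \<psi> x g ^ (d - 1) = chi g ^ (M * r)" .
    then have "chi g ^ (M * r) * \<psi> x g ^ Q = \<psi> (\<phi> x) g * (\<psi> x g ^ Q * \<psi> x g ^ (d - 1))"
      by (metis mult.assoc mult.commute)
    then show ?thesis unfolding Q_inv[OF \<psi>_char[OF x] g] by simp
  qed
  define U where "U n = (\<Sum>i<n. Q ^ i)" for n
  have U_Suc: "U (Suc n) = Q * U n + 1" for n
    unfolding U_def sum.lessThan_Suc_shift by (simp add: sum_distrib_left)
  have U0: "U n \<noteq> 0" if "n \<ge> 1" for n using that U_Suc[of "n - 1"] by simp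
  define per where "per xn \<longleftrightarrow> fst xn \<in> X \<and> snd xn \<ge> 1 \<and> (\<phi> ^^ snd xn) (fst xn) = fst xn" for xn
  obtain x1 where x1: "x1 \<in> X" using X_nonempty by auto
  obtain n1 where "n1 \<ge> 1" "(\<phi> ^^ n1) x1 = x1" using funpow_period[OF finite_X inj_\<phi> \<phi>_X x1] .
  then have "per (x1, n1)" using x1 by (simp add: per_def)
  then obtain xn where xn: "per xn" "\<And>yn. per yn \<Longrightarrow> multiplicity p (U (snd xn)) \<le> multiplicity p (U (snd yn))"
    using ex_has_least_nat[of per "(x1, n1)" "\<lambda>xn. multiplicity p (U (snd xn))"] by auto
  define x0 where "x0 = fst xn"
  define n0 where "n0 = snd xn"
  have x0: "x0 \<in> X" "n0 \<ge> 1" "(\<phi> ^^ n0) x0 = x0" using xn(1) by (simp_all add: per_def x0_def n0_def)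
  have min: "multiplicity p (U n0) \<le> multiplicity p (U n)" if "x \<in> X" "n \<ge> 1" "(\<phi> ^^ n) x = x" for x n
    using xn(2)[of "(x, n)"] that by (simp add: per_def n0_def)
  define \<beta> where "\<beta> x g = \<psi> x g / \<psi> x0 g" for x g
  define a where "a g = \<beta> (\<phi> x0) g" for g
  have \<beta>_char: "is_char G (\<beta> x)" if "x \<in> X" for x
    unfolding \<beta>_def by (intro is_char_divide \<psi>_char that x0(1))
  have \<phi>X: "\<phi> x \<in> X" if "x \<in> X" for x using that \<phi>_X by auto
  have \<beta>_step: "\<beta> (\<phi> x) g = \<beta> x g ^ Q * a g" if "x \<in> X" "g \<in> carrier G" for x g
    using \<psi>0[OF x0(1) that(2)] by (simp add: \<beta>_def a_def \<psi>_\<phi>[OF that] \<psi>_\<phi>[OF x0(1) that(2)] power_divide)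
  have \<beta>_iter: "\<beta> ((\<phi> ^^ k) x) g = \<beta> x g ^ (Q ^ k) * a g ^ U k" if "x \<in> X" "g \<in> carrier G" for x g k
  proof (induction k)
    case (Suc k)
    have "\<beta> ((\<phi> ^^ Suc k) x) g = \<beta> ((\<phi> ^^ k) x) g ^ Q * a g"
      using \<beta>_step[OF funpow_closed[OF \<phi>_X that(1)] that(2), of k] by simp
    also have "\<dots> = \<beta> x g ^ (Q ^ Suc k) * a g ^ U (Suc k)"
      unfolding Suc U_Suc by (simp add: power_mult_distrib power_add mult.commute flip: power_mult)
    finally show ?case .
  qed (simp add: U_def)
  have \<beta>_x0: "\<beta> x0 g = 1" if "g \<in> carrier G" for g using \<psi>0[OF x0(1) that] by (simp add: \<beta>_def)
  have a_U: "a g ^ U n = 1" if x: "x \<in> X" "n \<ge> 1" "(\<phi> ^^ n) x = x" and g: "g \<in> carrier G" for x n g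
  proof -
    have "a g ^ U n0 = 1" using \<beta>_iter[OF x0(1) g, of n0] by (simp add: x0(3) \<beta>_x0[OF g])
    moreover have "a g ^ (p ^ A) = 1"
    proof -
      have "\<psi> y g ^ (p ^ A) = 1" if "y \<in> X" for y
      proof -
        have "lam y g ^ (r * p ^ A) = 1"
          by (rule power_eq_1_dvd[OF m_pow[OF lam_char[OF N[OF that]] g] r(2)])
        then have "(lam y g ^ (r * p ^ A)) ^ M = 1" by simp
        then show ?thesis by (simp add: \<psi>_def mult_ac flip: power_mult)
      qed
      then show ?thesis using x0(1) \<phi>X by (simp add: a_def \<beta>_def power_divide)
    qed
    ultimately have "a g ^ gcd (U n0) (p ^ A) = 1" by (rule power_gcd_eq_1)
    then show ?thesis
      by (rule power_eq_1_dvd) (rule gcd_prime_power_dvd[OF p(1) U0[OF x(2)] min[OF x] U0[OF x0(2)]])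
  qed
  obtain root ht where root: "\<And>x. x \<in> X \<Longrightarrow> root x \<in> X" "\<And>x. x \<in> X \<Longrightarrow> (\<phi> ^^ ht x) (root x) = x"
    "\<And>x. x \<in> X \<Longrightarrow> root (\<phi> x) = root x" "\<And>x. x \<in> X \<Longrightarrow> root (root x) = root x" "root x0 = x0"
    using orbit_roots[OF finite_X inj_\<phi> \<phi>_X x0(1)] by metis
  define \<omega> where "\<omega> x = (if x = x0 then \<beta> (\<phi> x0) else \<beta> x)" for x
  have \<omega>_char: "is_char G (\<omega> x)" if "x \<in> X" for x
    using \<beta>_char that \<phi>X[OF x0(1)] by (simp add: \<omega>_def)
  have \<beta>_period: "\<beta> x g ^ (Q ^ n) = \<beta> x g" if "x \<in> X" "(\<phi> ^^ n) x = x" "g \<in> carrier G" for x n g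
  proof (cases "n \<ge> 1")
    case True
    then show ?thesis using \<beta>_iter[OF that(1,3), of n] a_U[OF that(1) True that(2,3)] by (simp add: that(2))
  next
    case False
    then have "n = 0" by simp
    then show ?thesis by simp
  qed
  have \<omega>_period: "\<omega> x g ^ (Q ^ n) = \<omega> x g" if "x \<in> X" "(\<phi> ^^ n) x = x" "g \<in> carrier G" for x n g
  proof (cases "x = x0")
    case True
    have "(\<phi> ^^ n) (\<phi> x0) = \<phi> x0" using that(2) True by (simp add: funpow_swap1[symmetric])
    then show ?thesis using \<beta>_period[OF \<phi>X[OF x0(1)] _ that(3)] True by (simp add: \<omega>_def)
  qed (use \<beta>_period[OF that] in \<open>simp add: \<omega>_def\<close>)
  have \<omega>_eq_le: "\<omega> x g ^ (Q ^ k) = \<omega> x g ^ (Q ^ l)"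
    if x: "x \<in> X" and g: "g \<in> carrier G" and eq: "(\<phi> ^^ k) x = (\<phi> ^^ l) x" and le: "k \<le> l" for x g k l
  proof -
    have "(\<phi> ^^ (l - k)) x = x"
      using funpow_inj_on_cancel[OF inj_\<phi> \<phi>_X x, of k "l - k"] eq le by simp
    then have "\<omega> x g ^ (Q ^ (l - k)) = \<omega> x g" by (rule \<omega>_period[OF x _ g])
    then have "(\<omega> x g ^ (Q ^ (l - k))) ^ (Q ^ k) = \<omega> x g ^ (Q ^ k)" by simp
    then show ?thesis using le by (simp flip: power_mult power_add)
  qed
  define \<Omega> where "\<Omega> x g = \<omega> (root x) g ^ (Q ^ ht x)" for x g
  show ?thesis
  proof (rule exI[of _ \<Omega>], intro conjI ballI impI)
    fix x assume x: "x \<in> X"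
    show char: "is_char G (\<Omega> x)" unfolding \<Omega>_def by (intro is_char_power \<omega>_char root(1) x)
    fix g assume g: "g \<in> carrier G"
    have "(\<phi> ^^ ht (\<phi> x)) (root x) = (\<phi> ^^ Suc (ht x)) (root x)"
      using root(2)[OF x] root(2)[OF \<phi>X[OF x]] root(3)[OF x] by simp
    then have "\<Omega> (\<phi> x) g = \<omega> (root x) g ^ (Q ^ Suc (ht x))"
      using \<omega>_eq_le[OF root(1)[OF x] g, of "ht (\<phi> x)" "Suc (ht x)"]
        \<omega>_eq_le[OF root(1)[OF x] g, of "Suc (ht x)" "ht (\<phi> x)"] nat_le_linear
      by (metis \<Omega>_def root(3)[OF x])
    also have "\<dots> = \<Omega> x g ^ Q" by (simp add: \<Omega>_def mult.commute flip: power_mult)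
    finally show "\<Omega> x g ^ (d - 1) * \<Omega> (\<phi> x) g = 1"
      using Q_inv[OF char g] by (simp add: mult.commute)
  next
    fix g assume g: "g \<in> carrier G" "g [^] p = \<one>" "g \<noteq> \<one>"
    show "\<exists>x\<in>X. \<Omega> x g \<noteq> 1"
    proof (rule ccontr)
      assume "\<not> ?thesis"
      then have \<Omega>1: "\<Omega> x g = 1" if "x \<in> X" for x using that by auto
      have \<omega>1: "\<omega> x g = 1" if x: "x \<in> X" "root x = x" for x
      proof -
        have "(\<phi> ^^ ht x) x = x" using root(2)[OF x(1)] x(2) by simp
        then have "\<omega> x g ^ (Q ^ ht x) = \<omega> x g" by (rule \<omega>_period[OF x(1) _ g(1)])
        then show ?thesis using \<Omega>1[OF x(1)] x(2) by (simp add: \<Omega>_def)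
      qed
      have a1: "a g = 1" using \<omega>1[OF x0(1) root(5)] by (simp add: \<omega>_def a_def)
      have \<beta>_root: "\<beta> (root x) g = 1" if "x \<in> X" for x
        using \<omega>1[OF root(1)[OF that] root(4)[OF that]] \<beta>_x0[OF g(1)]
        by (cases "root x = x0") (simp_all add: \<omega>_def)
      have "\<beta> x g = 1" if "x \<in> X" for x
        using \<beta>_iter[OF root(1)[OF that] g(1), of "ht x"] \<beta>_root[OF that] a1 root(2)[OF that] by simp
      then have eq: "\<psi> x g = \<psi> x0 g" if "x \<in> X" for x
        using that \<psi>0[OF x0(1) g(1)] by (simp add: \<beta>_def)
      have gM: "g [^] (M * r) = \<one>" by (rule faithful_X[OF g(1)]) (simp add: eq[unfolded \<psi>_def])
      have cop: "coprime p (M * r)" using p(2) r(1) by (simp add: coprime_commute)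
      have "lam i g = 1" if i: "i < N" for i
      proof (rule eq_1_of_coprime_powers[OF _ _ cop])
        show "lam i g ^ p = 1" "lam i g ^ (M * r) = 1"
          using lam_pow[OF i g(1), symmetric] g(2) gM is_char_one[OF is_group lam_char[OF i]] by simp_all
      qed
      then show False using lam_faithful[OF g(1)] g(3) by simp
    qed
  qed
qed

end

section \<open>Embedding the group\<close>

text \<open>The exponent of the family for $p$ is the product of the other primes. It annihilates the elements whose order is
  one of those primes, and is invertible on elements of order $p$. If the kernel of the product were nontrivial, it
  would contain an element of prime order, on which all families but one have disappeared.\<close>

lemma (in comm_group) combine_primewise_characters:
  fixes \<Lambda> :: "nat \<Rightarrow> nat \<Rightarrow> 'a \<Rightarrow> complex"
  assumes fin: "finite (carrier G)"
    and char: "\<And>p i. prime p \<Longrightarrow> i \<in> I \<Longrightarrow> is_char G (\<Lambda> p i)"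
    and kernel: "\<And>p g. prime p \<Longrightarrow> p dvd card (carrier G) \<Longrightarrow> g \<in> carrier G \<Longrightarrow> g [^] p = \<one> \<Longrightarrow> g \<noteq> \<one> \<Longrightarrow>
      \<exists>i\<in>I. \<Lambda> p i g \<noteq> 1"
  shows "\<exists>e P. finite P \<and> (\<forall>p\<in>P. prime (p::nat)) \<and>
    (\<forall>g\<in>carrier G. (\<forall>i\<in>I. (\<Prod>p\<in>P. \<Lambda> p i g ^ (e p :: nat)) = 1) \<longrightarrow> g = \<one>)"
proof -
  define m where "m = card (carrier G)"
  have m: "m > 0" using fin one_closed by (auto simp: m_def card_gt_0_iff)
  define P where "P = prime_factors m"
  define e where "e p = \<Prod>(P - {p})" for p
  have P: "finite P" "\<And>p. p \<in> P \<Longrightarrow> prime p" by (auto simp: P_def)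
  have "g = \<one>" if g: "g \<in> carrier G" and one: "\<And>i. i \<in> I \<Longrightarrow> (\<Prod>p\<in>P. \<Lambda> p i g ^ e p) = 1" for g
  proof (rule ccontr)
    assume "g \<noteq> \<one>"
    then have "ord g \<noteq> 1" using ord_eq_1[OF g] by simp
    then obtain p where p: "prime p" "p dvd ord g" using prime_factor_nat by blast
    have "ord g dvd m" using ord_dvd_group_order[OF g] by (simp add: m_def Coset.order_def)
    then have pm: "p dvd m" using p(2) by (rule dvd_trans[rotated])
    then have pP: "p \<in> P" using p(1) m by (simp add: P_def prime_factors_dvd)
    obtain l where l: "ord g = p * l" using p(2) by (rule dvdE)
    define g0 where "g0 = g [^] l"
    have g0: "g0 \<in> carrier G" using g by (simp add: g0_def)
    have g0p: "g0 [^] p = \<one>" using pow_ord_eq_1[OF g] by (simp add: g0_def nat_pow_pow[OF g] l mult.commute)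
    have "ord g > 0" using ord_ge_1[OF fin g] by linarith
    then have l0: "l > 0" using l by (cases l) simp_all
    then have "l < ord g" using l prime_gt_1_nat[OF p(1)] by simp
    then have "\<not> ord g dvd l" using l0 by (simp add: nat_dvd_not_less)
    then have g0n: "g0 \<noteq> \<one>" using pow_eq_id[OF g, of l] by (simp add: g0_def)
    obtain i where i: "i \<in> I" "\<Lambda> p i g0 \<noteq> 1" using kernel[OF p(1) pm[unfolded m_def] g0 g0p g0n] by auto
    have \<Lambda>pow: "\<Lambda> q i (a [^] k) = \<Lambda> q i a ^ k" if "prime q" "a \<in> carrier G" for q a and k :: nat
      by (rule is_char_pow[OF is_group char[OF that(1) i(1)] that(2)])
    have \<Lambda>one: "\<Lambda> q i \<one> = 1" if "prime q" for q
      by (rule is_char_one[OF is_group char[OF that i(1)]])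
    have "(\<Prod>q\<in>P. \<Lambda> q i g0 ^ e q) = (\<Prod>q\<in>P. \<Lambda> q i g ^ e q) ^ l"
      unfolding prod_power_distrib
      by (rule prod.cong) (simp_all add: g0_def \<Lambda>pow P(2) g mult.commute flip: power_mult)
    also have "\<dots> = 1" using one[OF i(1)] by simp
    finally have prod1: "(\<Prod>q\<in>P. \<Lambda> q i g0 ^ e q) = 1" .
    have other: "\<Lambda> q i g0 ^ e q = 1" if "q \<in> P" "q \<noteq> p" for q
    proof -
      have "p dvd e q" unfolding e_def by (rule dvd_prodI) (use P(1) pP that in auto)
      moreover have "\<Lambda> q i g0 ^ p = 1" using \<Lambda>pow[OF P(2)[OF that(1)] g0, of p] g0p \<Lambda>one[OF P(2)[OF that(1)]] by simp
      ultimately show ?thesis by (rule power_eq_1_dvd[rotated])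
    qed
    have "(\<Prod>q\<in>P. \<Lambda> q i g0 ^ e q) = \<Lambda> p i g0 ^ e p * (\<Prod>q\<in>P - {p}. \<Lambda> q i g0 ^ e q)"
      by (rule prod.remove[OF P(1) pP])
    also have "(\<Prod>q\<in>P - {p}. \<Lambda> q i g0 ^ e q) = 1" by (rule prod.neutral) (use other in auto)
    finally have ep: "\<Lambda> p i g0 ^ e p = 1" using prod1 by simp
    have pp: "\<Lambda> p i g0 ^ p = 1" using \<Lambda>pow[OF p(1) g0, of p] g0p \<Lambda>one[OF p(1)] by simp
    have "coprime (e p) p" unfolding e_def
      by (rule prod_coprime_left) (use P(2) p(1) primes_coprime in auto)
    then have "\<Lambda> p i g0 = 1" by (rule eq_1_of_coprime_powers[OF ep pp])
    then show False using i(2) by simp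
  qed
  then show ?thesis using P by (intro exI[of _ e] exI[of _ P]) simp
qed

lemma embedding_of_arrow_characters:
  assumes G: "group G" and d: "d \<ge> 3"
    and char: "\<And>i. i < n \<Longrightarrow> is_char G (\<Lambda> i)" and f: "\<And>i. i < n \<Longrightarrow> f i < n"
    and c: "\<And>g. g \<in> carrier G \<Longrightarrow> c g \<noteq> 0"
    and rel: "\<And>i g. i < n \<Longrightarrow> g \<in> carrier G \<Longrightarrow> \<Lambda> i g ^ (d - 1) * \<Lambda> (f i) g = c g"
    and inj: "\<And>g. g \<in> carrier G \<Longrightarrow> (\<And>i j. i < n \<Longrightarrow> j < n \<Longrightarrow> \<Lambda> i g = \<Lambda> j g) \<Longrightarrow> g = \<one>\<^bsub>G\<^esub>"
  shows "iso_to_subgroup G (diag_aut_group n (arrow_poly d {..<n} f))"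
proof (rule iso_to_subgroup_diag_aut_groupI[where \<Lambda> = \<Lambda> and c = c, OF G char _ c inj])
  fix g m assume g: "g \<in> carrier G" and "m \<in> Poly_Mapping.keys (arrow_poly d {..<n} f)"
  then obtain i where "i < n" "m = arrow_monom d i (f i)" by (auto simp: keys_arrow_poly)
  then show "monom_eval (\<lambda>i. \<Lambda> i g) m = c g"
    unfolding \<open>m = _\<close> monom_eval_arrow_monom using g by (intro rel)
qed

lemma relabel_permutation:
  assumes "finite Y" "inj_on \<phi> Y" "\<phi> ` Y \<subseteq> Y"
  shows "\<exists>b f. bij_betw b {..<card Y} Y \<and> inj_on f {..<card Y} \<and>
    (\<forall>i<card Y. f i < card Y \<and> b (f i) = \<phi> (b i))"
proof -
  obtain b where b: "bij_betw b {..<card Y} Y"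
    using ex_bij_betw_nat_finite[OF assms(1)] by (auto simp: lessThan_atLeast0)
  define f where "f i = inv_into {..<card Y} b (\<phi> (b i))" for i
  have bY: "b i \<in> Y" if "i < card Y" for i using b that by (auto simp: bij_betw_def)
  have \<phi>b: "\<phi> (b i) \<in> Y" if "i < card Y" for i using bY[OF that] assms(3) by auto
  have bf: "b (f i) = \<phi> (b i)" if "i < card Y" for i
    unfolding f_def by (rule bij_betw_inv_into_right[OF b \<phi>b[OF that]])
  have fn: "f i < card Y" if "i < card Y" for i
    using bij_betw_apply[OF bij_betw_inv_into[OF b] \<phi>b[OF that]] by (simp add: f_def)
  have "inj_on f {..<card Y}"
  proof (rule inj_onI)
    fix i j assume ij: "i \<in> {..<card Y}" "j \<in> {..<card Y}" "f i = f j"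
    then have "\<phi> (b i) = \<phi> (b j)" using bf[of i] bf[of j] by simp
    then have "b i = b j" using inj_onD[OF assms(2)] bY ij by auto
    then show "i = j" using b ij by (auto simp: bij_betw_def inj_on_def)
  qed
  then show ?thesis using b bf fn by (intro exI[of _ b] exI[of _ f]) simp
qed

context eigen_system begin

text \<open>Here all distinct characters are permuted by the arrows, so that the given characters themselves act on
  a sum of cycles.\<close>

lemma embedding_coprime_order:
  assumes cop: "coprime (card (carrier G)) (d - 1)"
  shows "\<exists>N0 F0 C. 1 \<le> N0 \<and> N0 \<le> N \<and> simple_components d N0 F0 C \<and>
    card (T_ge2_components d C) \<le> 1 \<and> iso_to_subgroup G (diag_aut_group N0 F0)"
proof -
  interpret E: eigen_system_mod G N d lam chi "card (carrier G)" 1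
    by unfold_locales (use cop pow_order_eq_1 in \<open>simp_all add: Coset.order_def\<close>)
  define n where "n = card E.X"
  obtain b f where b: "bij_betw b {..<n} E.X" and inj_f: "inj_on f {..<n}"
    and f: "\<forall>i<n. f i < n \<and> b (f i) = E.\<phi> (b i)"
    using relabel_permutation[OF E.finite_X E.inj_\<phi> E.\<phi>_X] unfolding n_def by (elim exE conjE)
  have bX: "b i \<in> E.X" if "i < n" for i using b that by (auto simp: bij_betw_def)
  have fn: "f i < n" and bf: "b (f i) = E.\<phi> (b i)" if "i < n" for i using f that by simp_all
  obtain C where C: "simple_components d n (arrow_poly d {..<n} f) C" "card (T_ge2_components d C) = 0"
    using simple_components_cycles[OF d3 inj_f] fn by auto
  have bN: "b i < N" if "i < n" for i using bX[OF that] E.X_sub by auto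
  have "iso_to_subgroup G (diag_aut_group n (arrow_poly d {..<n} f))"
  proof (rule embedding_of_arrow_characters[OF is_group d3, where \<Lambda> = "\<lambda>i. lam (b i)" and c = chi])
    show "is_char G (lam (b i))" if "i < n" for i by (rule lam_char[OF bN[OF that]])
    show "lam (b i) g ^ (d - 1) * lam (b (f i)) g = chi g" if "i < n" "g \<in> carrier G" for i g
      using E.\<phi>_relation[OF bX[OF that(1)] that(2)] by (simp add: bf[OF that(1)] mult.commute)
  next
    fix g assume g: "g \<in> carrier G" and eq: "\<And>i j. i < n \<Longrightarrow> j < n \<Longrightarrow> lam (b i) g = lam (b j) g"
    have "g [^] (1 * 1 :: nat) = \<one>"
    proof (rule E.faithful_X[OF g])
      fix x y assume "x \<in> E.X" "y \<in> E.X"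
      then have "x \<in> b ` {..<n}" "y \<in> b ` {..<n}" unfolding bij_betw_imp_surj_on[OF b] .
      then obtain i j where "i < n" "x = b i" "j < n" "y = b j" by (elim imageE) simp
      then show "lam x g ^ (1 * 1) = lam y g ^ (1 * 1)" using eq[of i j] by simp
    qed
    then show "g = \<one>" using g by simp
  qed (use fn chi_nonzero in auto)
  moreover have "1 \<le> n" using E.X_nonempty E.finite_X by (simp add: n_def Suc_le_eq card_gt_0_iff)
  moreover have "n \<le> N" using card_mono[OF _ E.X_sub] by (simp add: n_def)
  ultimately show ?thesis using C by (intro exI[of _ n] exI[of _ "arrow_poly d {..<n} f"] exI[of _ C]) simp
qed

end

context eigen_system_mod begin

text \<open>The set $Y$ of indices on the cycles. If $\phi$ has a fixed point, it is removed, because the end of the path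
  can play its role; this saves the one variable by which the bound is weaker in that case.\<close>

lemma cycle_part:
  assumes s: "s \<ge> 1" "M = (d - 1) ^ s" and g0: "g0 \<in> carrier G" "g0 [^] (h * (d - 1) ^ (s - 1)) \<noteq> \<one>"
  shows "\<exists>Y\<subseteq>X. \<phi> ` Y \<subseteq> Y \<and> card Y + s + 1 \<le> N \<and> (\<forall>p. prime p \<longrightarrow> coprime p M \<longrightarrow>
    (\<exists>\<Omega>. (\<forall>x\<in>Y. is_char G (\<Omega> x) \<and> (\<forall>g\<in>carrier G. \<Omega> x g ^ (d - 1) * \<Omega> (\<phi> x) g = 1)) \<and>
    (\<forall>g\<in>carrier G. g [^] p = \<one> \<longrightarrow> g \<noteq> \<one> \<longrightarrow> (\<exists>x\<in>Y. \<Omega> x g \<noteq> 1))))"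
proof (cases "\<exists>x0\<in>X. \<phi> x0 = x0")
  case True
  then obtain x0 where x0: "x0 \<in> X" "\<phi> x0 = x0" by auto
  have "\<phi> ` (X - {x0}) \<subseteq> X - {x0}"
  proof
    fix y assume "y \<in> \<phi> ` (X - {x0})"
    then obtain x where x: "x \<in> X" "x \<noteq> x0" "y = \<phi> x" by auto
    have "\<phi> x \<noteq> x0" using inj_onD[OF inj_\<phi> _ x(1) x0(1)] x(2) x0(2) by auto
    then show "y \<in> X - {x0}" using x \<phi>_X by auto
  qed
  moreover have "card (X - {x0}) + s + 1 \<le> N"
  proof -
    have "card X > 0" using x0 finite_X by (auto simp: card_gt_0_iff)
    then show ?thesis using card_bound(1)[OF s g0] x0 finite_X by simp
  qed
  moreover have "\<exists>\<Omega>. (\<forall>x\<in>X - {x0}. is_char G (\<Omega> x) \<and> (\<forall>g\<in>carrier G. \<Omega> x g ^ (d - 1) * \<Omega> (\<phi> x) g = 1)) \<and>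
    (\<forall>g\<in>carrier G. g [^] p = \<one> \<longrightarrow> g \<noteq> \<one> \<longrightarrow> (\<exists>x\<in>X - {x0}. \<Omega> x g \<noteq> 1))"
    if p: "prime p" "coprime p M" for p
  proof -
    obtain \<Omega> where \<Omega>: "\<forall>x\<in>X. is_char G (\<Omega> x) \<and> (\<forall>g\<in>carrier G. \<Omega> x g ^ (d - 1) * \<Omega> (\<phi> x) g = 1)"
      "\<forall>g\<in>carrier G. g [^] p = \<one> \<longrightarrow> g \<noteq> \<one> \<longrightarrow> (\<exists>x\<in>X - {x0}. \<Omega> x g \<noteq> 1)"
      using cycle_characters_fixed_point[OF x0 p] by (elim exE conjE)
    show ?thesis by (intro exI[of _ \<Omega>] conjI \<Omega>(2)) (use \<Omega>(1) in simp)
  qed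
  ultimately show ?thesis by (intro exI[of _ "X - {x0}"] conjI allI impI Diff_subset)
next
  case False
  then have "card X + s + 1 \<le> N" using card_bound(2)[OF s g0] by auto
  then show ?thesis by (intro exI[of _ X] conjI allI impI \<phi>_X cycle_characters order_refl)
qed

text \<open>Some ratio $\lambda_i/\lambda_j$ is nontrivial on a given element of order $p$, and then on all of them because
  these are powers of each other. Its $h$-th power still is, and it has order dividing a power of $d-1$.\<close>

lemma path_character:
  assumes M: "M = (d - 1) ^ s" and p: "prime p" "p dvd d - 1"
    and torsion: "\<And>g g'. g \<in> carrier G \<Longrightarrow> g' \<in> carrier G \<Longrightarrow> g [^] p = \<one> \<Longrightarrow> g' [^] p = \<one> \<Longrightarrow>
      g \<noteq> \<one> \<Longrightarrow> \<exists>k::nat. g' = g [^] k"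
  shows "\<exists>\<kappa>. is_char G \<kappa> \<and> (\<forall>g\<in>carrier G. \<kappa> g ^ M = 1) \<and>
    (\<forall>g\<in>carrier G. g [^] p = \<one> \<longrightarrow> g \<noteq> \<one> \<longrightarrow> \<kappa> g \<noteq> 1)"
proof (cases "\<exists>g\<in>carrier G. g [^] p = \<one> \<and> g \<noteq> \<one>")
  case False
  then show ?thesis using is_char_trivial by (intro exI[of _ "\<lambda>_. 1"]) auto
next
  case True
  then obtain g0 where g0: "g0 \<in> carrier G" "g0 [^] p = \<one>" "g0 \<noteq> \<one>" by auto
  then obtain i j where ij: "i < N" "j < N" "lam i g0 \<noteq> lam j g0" using lam_faithful by metis
  define \<kappa> where "\<kappa> g = (lam i g / lam j g) ^ h" for g
  have char: "is_char G \<kappa>" unfolding \<kappa>_def by (intro is_char_power is_char_divide lam_char ij)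
  have M1: "\<kappa> g ^ M = 1" if g: "g \<in> carrier G" for g
  proof -
    have "lam k g ^ (h * M) = 1" if "k < N" for k
      using lam_pow[OF that g, of "h * M"] exponent[OF g] is_char_one[OF is_group lam_char[OF that]] by simp
    then show ?thesis using ij by (simp add: \<kappa>_def power_divide flip: power_mult)
  qed
  have "\<kappa> g0 \<noteq> 1"
  proof
    assume k1: "\<kappa> g0 = 1"
    have "lam k g0 ^ p = 1" if "k < N" for k
      using lam_pow[OF that g0(1), of p] g0(2) is_char_one[OF is_group lam_char[OF that]] by simp
    then have lp: "(lam i g0 / lam j g0) ^ p = 1" using ij by (simp add: power_divide)
    have "coprime h p" using coprime_h p(2) by (metis coprime_divisors dvd_refl)
    then have "lam i g0 / lam j g0 = 1" by (rule eq_1_of_coprime_powers[OF k1[unfolded \<kappa>_def] lp])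
    then show False using ij(3) lam_nonzero[OF ij(2) g0(1)] by simp
  qed
  then have "\<kappa> g \<noteq> 1" if g: "g \<in> carrier G" "g [^] p = \<one>" "g \<noteq> \<one>" for g
  proof -
    obtain k :: nat where "g0 = g [^] k" using torsion[OF g(1) g0(1) g(2) g0(2) g(3)] by auto
    then have "\<kappa> g0 = \<kappa> g ^ k" using is_char_pow[OF is_group char g(1)] by simp
    then show ?thesis using \<open>\<kappa> g0 \<noteq> 1\<close> by auto
  qed
  then show ?thesis using char M1 by (intro exI[of _ \<kappa>]) simp
qed

text \<open>For a prime dividing $d-1$ the group acts on the path and trivially on the cycles, for the other primes the other way
  round. On the path the weights are $\kappa, \kappa^Q, \ldots, \kappa^{Q^s} = 1$ with $Q$ in the role of $1-d$. Since the last
  variable of the path always has weight $1$, an element that acts by a scalar acts trivially.\<close>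

lemma embedding_with_path:
  assumes s: "s \<ge> 1" "M = (d - 1) ^ s" and g0: "g0 \<in> carrier G" "g0 [^] (h * (d - 1) ^ (s - 1)) \<noteq> \<one>"
    and torsion: "\<And>p g g'. prime p \<Longrightarrow> p dvd d - 1 \<Longrightarrow> g \<in> carrier G \<Longrightarrow> g' \<in> carrier G \<Longrightarrow>
      g [^] p = \<one> \<Longrightarrow> g' [^] p = \<one> \<Longrightarrow> g \<noteq> \<one> \<Longrightarrow> \<exists>k::nat. g' = g [^] k"
  shows "\<exists>N0 F0 C. 1 \<le> N0 \<and> N0 \<le> N \<and> simple_components d N0 F0 C \<and>
    card (T_ge2_components d C) = 1 \<and> iso_to_subgroup G (diag_aut_group N0 F0)"
proof -
  obtain Y where Y: "Y \<subseteq> X" "\<phi> ` Y \<subseteq> Y" "card Y + s + 1 \<le> N" and chars: "\<forall>p. prime p \<longrightarrow> coprime p M \<longrightarrow>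
    (\<exists>\<Omega>. (\<forall>x\<in>Y. is_char G (\<Omega> x) \<and> (\<forall>g\<in>carrier G. \<Omega> x g ^ (d - 1) * \<Omega> (\<phi> x) g = 1)) \<and>
    (\<forall>g\<in>carrier G. g [^] p = \<one> \<longrightarrow> g \<noteq> \<one> \<longrightarrow> (\<exists>x\<in>Y. \<Omega> x g \<noteq> 1)))"
    using cycle_part[OF s g0] by (elim exE conjE)
  have finY: "finite Y" using finite_subset[OF Y(1) finite_X] .
  define n where "n = card Y"
  have inj_Y: "inj_on \<phi> Y" by (rule inj_on_subset[OF inj_\<phi> Y(1)])
  obtain b \<pi> where b: "bij_betw b {..<n} Y" and inj_\<pi>: "inj_on \<pi> {..<n}"
    and \<pi>: "\<forall>i<n. \<pi> i < n \<and> b (\<pi> i) = \<phi> (b i)"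
    using relabel_permutation[OF finY inj_Y Y(2)] unfolding n_def by (elim exE conjE)
  define f where "f i = (if i < n then \<pi> i else if i < n + s then i + 1 else i)" for i
  have bY: "b i \<in> Y" if "i < n" for i using b that by (auto simp: bij_betw_def)
  have fn: "f i < n" and bf: "b (f i) = \<phi> (b i)" if "i < n" for i using \<pi> that by (simp_all add: f_def)
  have inj_f: "inj_on f {..<n}" using inj_\<pi> by (simp add: f_def inj_on_def)
  let ?n = "n + s + 1"
  obtain C where C: "simple_components d ?n (arrow_poly d {..<?n} f) C" "card (T_ge2_components d C) = 1"
    using simple_components_cycles_path[OF d3 inj_f _ s(1)] fn by (auto simp: f_def)
  define m where "m = card (carrier G)"
  have m: "m > 0" using fin one_closed by (auto simp: m_def card_gt_0_iff)
  define Q where "Q = (m - 1) * (d - 1)"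
  have Qd: "Q + (d - 1) = m * (d - 1)" using m by (cases m) (simp_all add: Q_def)
  define local_chars where "local_chars p \<Lambda> \<longleftrightarrow> (\<forall>i<?n. is_char G (\<Lambda> i)) \<and>
      (\<forall>i<?n. \<forall>g\<in>carrier G. \<Lambda> i g ^ (d - 1) * \<Lambda> (f i) g = 1) \<and>
      (\<forall>g\<in>carrier G. \<Lambda> (n + s) g = 1) \<and>
      (\<forall>g\<in>carrier G. g [^] p = \<one> \<longrightarrow> g \<noteq> \<one> \<longrightarrow> (\<exists>i<?n. \<Lambda> i g \<noteq> 1))"
    for p :: nat and \<Lambda> :: "nat \<Rightarrow> 'a \<Rightarrow> complex"
  have ex_local: "\<exists>\<Lambda>. local_chars p \<Lambda>" if p: "prime p" for p :: nat
  proof (cases "p dvd d - 1")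
    case False
    have pM: "coprime p M" unfolding s(2) using prime_imp_coprime[OF p False] by simp
    obtain \<Omega> where \<Omega>: "\<forall>x\<in>Y. is_char G (\<Omega> x) \<and> (\<forall>g\<in>carrier G. \<Omega> x g ^ (d - 1) * \<Omega> (\<phi> x) g = 1)"
      "\<forall>g\<in>carrier G. g [^] p = \<one> \<longrightarrow> g \<noteq> \<one> \<longrightarrow> (\<exists>x\<in>Y. \<Omega> x g \<noteq> 1)"
      using chars[rule_format, OF p pM] by (elim exE conjE)
    define \<Lambda> where "\<Lambda> i = (if i < n then \<Omega> (b i) else (\<lambda>_. 1))" for i
    show ?thesis unfolding local_chars_def
    proof (intro exI[of _ \<Lambda>] conjI allI ballI impI)
      fix i assume i: "i < ?n"
      show "is_char G (\<Lambda> i)" using \<Omega>(1) bY by (simp add: \<Lambda>_def is_char_trivial)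
      fix g assume g: "g \<in> carrier G"
      show "\<Lambda> i g ^ (d - 1) * \<Lambda> (f i) g = 1"
      proof (cases "i < n")
        case True
        then show ?thesis using \<Omega>(1) bY[OF True] fn[OF True] g by (simp add: \<Lambda>_def bf)
      next
        case False
        then show ?thesis by (simp add: \<Lambda>_def f_def)
      qed
    next
      fix g assume g: "g \<in> carrier G" "g [^] p = \<one>" "g \<noteq> \<one>"
      then obtain x where x: "x \<in> Y" "\<Omega> x g \<noteq> 1" using \<Omega>(2) by auto
      then obtain i where "i < n" "x = b i" using b by (auto simp: bij_betw_def)
      then show "\<exists>i<?n. \<Lambda> i g \<noteq> 1" using x(2) by (intro exI[of _ i]) (simp add: \<Lambda>_def)
    qed (simp add: \<Lambda>_def)
  next
    case True
    have "\<exists>\<kappa>. is_char G \<kappa> \<and> (\<forall>g\<in>carrier G. \<kappa> g ^ M = 1) \<and>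
      (\<forall>g\<in>carrier G. g [^] p = \<one> \<longrightarrow> g \<noteq> \<one> \<longrightarrow> \<kappa> g \<noteq> 1)"
      by (rule path_character[OF s(2) p True]) (rule torsion[OF p True])
    then obtain \<kappa> where \<kappa>: "is_char G \<kappa>" "\<forall>g\<in>carrier G. \<kappa> g ^ M = 1"
      "\<forall>g\<in>carrier G. g [^] p = \<one> \<longrightarrow> g \<noteq> \<one> \<longrightarrow> \<kappa> g \<noteq> 1"
      by (elim exE conjE)
    have last: "\<kappa> g ^ (Q ^ s) = 1" if "g \<in> carrier G" for g
      using power_eq_1_dvd[of "\<kappa> g" M "Q ^ s"] \<kappa>(2) that by (simp add: Q_def power_mult_distrib s(2))
    define \<Lambda> where "\<Lambda> i = (if i < n then (\<lambda>_. 1) else (\<lambda>g. \<kappa> g ^ (Q ^ (i - n))))" for i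
    show ?thesis unfolding local_chars_def
    proof (intro exI[of _ \<Lambda>] conjI allI ballI impI)
      fix i assume i: "i < ?n"
      show "is_char G (\<Lambda> i)" by (simp add: \<Lambda>_def is_char_trivial is_char_power[OF \<kappa>(1)])
      fix g assume g: "g \<in> carrier G"
      show "\<Lambda> i g ^ (d - 1) * \<Lambda> (f i) g = 1"
      proof (cases "i < n")
        case True
        then show ?thesis using fn[OF True] by (simp add: \<Lambda>_def)
      next
        case ni: False
        show ?thesis
        proof (cases "i < n + s")
          case True
          define t where "t = i - n"
          have "\<Lambda> i g ^ (d - 1) * \<Lambda> (f i) g = \<kappa> g ^ (Q ^ t * (d - 1) + Q ^ t * Q)"
            using ni True by (simp add: \<Lambda>_def f_def t_def power_add Suc_diff_le power_mult mult.commute[of Q])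
          also have "Q ^ t * (d - 1) + Q ^ t * Q = m * (Q ^ t * (d - 1))"
            unfolding distrib_left[symmetric] add.commute[of "d - 1"] Qd by simp
          also have "\<kappa> g ^ (m * (Q ^ t * (d - 1))) = 1"
            unfolding power_mult using char_power_card[OF \<kappa>(1) g] by (simp add: m_def)
          finally show ?thesis .
        next
          case False
          then have "i = n + s" using i by simp
          then show ?thesis using last[OF g] by (simp add: \<Lambda>_def f_def)
        qed
      qed
    next
      fix g assume g: "g \<in> carrier G"
      show "\<Lambda> (n + s) g = 1" using last[OF g] by (simp add: \<Lambda>_def)
    next
      fix g assume g: "g \<in> carrier G" "g [^] p = \<one>" "g \<noteq> \<one>"
      then show "\<exists>i<?n. \<Lambda> i g \<noteq> 1" using \<kappa>(3) by (intro exI[of _ n]) (simp add: \<Lambda>_def)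
    qed
  qed
  define L where "L p = (SOME \<Lambda>. local_chars p \<Lambda>)" for p
  have "local_chars p (L p)" if "prime p" for p
    unfolding L_def by (rule someI_ex[OF ex_local[OF that]])
  then have L:
    "\<And>p i. prime p \<Longrightarrow> i < ?n \<Longrightarrow> is_char G (L p i)"
    "\<And>p i g. prime p \<Longrightarrow> i < ?n \<Longrightarrow> g \<in> carrier G \<Longrightarrow> L p i g ^ (d - 1) * L p (f i) g = 1"
    "\<And>p g. prime p \<Longrightarrow> g \<in> carrier G \<Longrightarrow> L p (n + s) g = 1"
    "\<And>p g. prime p \<Longrightarrow> g \<in> carrier G \<Longrightarrow> g [^] p = \<one> \<Longrightarrow> g \<noteq> \<one> \<Longrightarrow> \<exists>i<?n. L p i g \<noteq> 1"
    unfolding local_chars_def by simp_all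
  have "\<exists>e P. finite P \<and> (\<forall>p\<in>P. prime p) \<and>
    (\<forall>g\<in>carrier G. (\<forall>i\<in>{..<?n}. (\<Prod>p\<in>P. L p i g ^ e p) = 1) \<longrightarrow> g = \<one>)"
  proof (rule combine_primewise_characters[OF fin])
    show "is_char G (L p i)" if "prime p" "i \<in> {..<?n}" for p i using L(1) that by simp
    show "\<exists>i\<in>{..<?n}. L p i g \<noteq> 1" if "prime p" "g \<in> carrier G" "g [^] p = \<one>" "g \<noteq> \<one>" for p g
      using L(4)[OF that] by auto
  qed
  then obtain e P where P: "finite P" "\<forall>p\<in>P. prime p"
    and trivial: "\<forall>g\<in>carrier G. (\<forall>i\<in>{..<?n}. (\<Prod>p\<in>P. L p i g ^ e p) = 1) \<longrightarrow> g = \<one>"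
    by (elim exE conjE)
  have Pp: "prime p" if "p \<in> P" for p using P(2) that by simp
  define \<Lambda> where "\<Lambda> i g = (\<Prod>p\<in>P. L p i g ^ e p)" for i g
  have f_bound: "f i < ?n" if "i < ?n" for i using fn[of i] that by (auto simp: f_def)
  have "iso_to_subgroup G (diag_aut_group ?n (arrow_poly d {..<?n} f))"
  proof (rule embedding_of_arrow_characters[OF is_group d3, where \<Lambda> = \<Lambda> and c = "\<lambda>_. 1"])
    show "is_char G (\<Lambda> i)" if "i < ?n" for i
      unfolding \<Lambda>_def by (intro is_char_prod is_char_power L(1) Pp that)
    show "\<Lambda> i g ^ (d - 1) * \<Lambda> (f i) g = 1" if "i < ?n" "g \<in> carrier G" for i g
    proof -
      have "\<Lambda> i g ^ (d - 1) * \<Lambda> (f i) g = (\<Prod>p\<in>P. (L p i g ^ (d - 1) * L p (f i) g) ^ e p)"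
        unfolding \<Lambda>_def prod_power_distrib prod.distrib[symmetric]
        by (rule prod.cong) (simp_all add: power_mult_distrib mult.commute flip: power_mult)
      also have "\<dots> = 1"
      proof (rule prod.neutral, rule ballI)
        fix p assume "p \<in> P"
        show "(L p i g ^ (d - 1) * L p (f i) g) ^ e p = 1"
          unfolding L(2)[OF Pp[OF \<open>p \<in> P\<close>] that] by simp
      qed
      finally show ?thesis .
    qed
  next
    fix g assume g: "g \<in> carrier G" and eq: "\<And>i j. i < ?n \<Longrightarrow> j < ?n \<Longrightarrow> \<Lambda> i g = \<Lambda> j g"
    have "\<Lambda> (n + s) g = 1" unfolding \<Lambda>_def by (rule prod.neutral) (simp add: L(3)[OF Pp g])
    then have "\<Lambda> i g = 1" if "i < ?n" for i using eq[OF that, of "n + s"] by simp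
    then show "g = \<one>" using trivial g by (simp add: \<Lambda>_def)
  qed (use f_bound in auto)
  then show ?thesis using C Y(3)
    by (intro exI[of _ ?n] exI[of _ "arrow_poly d {..<?n} f"] exI[of _ C]) (simp add: n_def)
qed

end

lemma (in comm_group) element_of_prime_order:
  assumes "finite (carrier G)" "prime p" "p dvd card (carrier G)"
  shows "\<exists>g\<in>carrier G. g [^] p = \<one> \<and> g \<noteq> \<one>"
proof -
  obtain m where m: "card (carrier G) = p * m" using assms(3) by (rule dvdE)
  have "Coset.order G = p ^ 1 * m" by (simp add: Coset.order_def m)
  then obtain H where H: "subgroup H G" "card H = p ^ 1"
    using sylow_thm[OF assms(2) is_group _ assms(1), of 1 m] by auto
  have "card H > 1" using H(2) prime_gt_1_nat[OF assms(2)] by simp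
  then have "\<not> H \<subseteq> {\<one>}" using card_mono[of "{\<one>}" H] by auto
  then obtain g where g: "g \<in> H" "g \<noteq> \<one>" by auto
  interpret K: group "G\<lparr>carrier := H\<rparr>" by (rule subgroup.subgroup_is_group[OF H(1) is_group])
  have "g [^] p = \<one>"
    using K.pow_order_eq_1[of g] g(1) H(2) by (simp add: Coset.order_def nat_pow_consistent[symmetric])
  then show ?thesis using g subgroup.mem_carrier[OF H(1)] by auto
qed

text \<open>An element of order $p$ has trivial component in $G_2$, whose order is prime to $p$; so it lies in the cyclic group
  $G_1$, and a finite cyclic group has only one subgroup of order $p$.\<close>

lemma (in comm_group) prime_torsion_cyclic:
  assumes fin: "finite (carrier G)" and dec: "direct_sum_decomp G G1 G2"
    and cyc: "cyclic_group (G\<lparr>carrier := G1\<rparr>)" and cop: "coprime (card G2) D"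
    and p: "prime p" "p dvd D"
    and g: "g \<in> carrier G" "g [^] p = \<one>" "g \<noteq> \<one>" and g': "g' \<in> carrier G" "g' [^] p = \<one>"
  shows "\<exists>k::nat. g' = g [^] k"
proof -
  have sub: "subgroup G1 G" "subgroup G2 G" "G1 \<inter> G2 = {\<one>}" "G1 <#> G2 = carrier G"
    using dec by (simp_all add: direct_sum_decomp_def)
  have mem1: "x \<in> carrier G" if "x \<in> G1" for x using subgroup.mem_carrier[OF sub(1) that] .
  have mem2: "x \<in> carrier G" if "x \<in> G2" for x using subgroup.mem_carrier[OF sub(2) that] .
  interpret K1: group "G\<lparr>carrier := G1\<rparr>" by (rule subgroup.subgroup_is_group[OF sub(1) is_group])
  interpret K2: group "G\<lparr>carrier := G2\<rparr>" by (rule subgroup.subgroup_is_group[OF sub(2) is_group])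
  have pow1: "x [^] (k::nat) \<in> G1" if "x \<in> G1" for x k
    using K1.nat_pow_closed[of x k] that by (simp add: nat_pow_consistent[symmetric])
  have pow2: "x [^] (k::nat) \<in> G2" if "x \<in> G2" for x k
    using K2.nat_pow_closed[of x k] that by (simp add: nat_pow_consistent[symmetric])
  have in_G1: "x \<in> G1" if x: "x \<in> carrier G" "x [^] p = \<one>" for x
  proof -
    obtain a c where ac: "a \<in> G1" "c \<in> G2" "x = a \<otimes> c"
      using x(1) unfolding sub(4)[symmetric] set_mult_def by auto
    have a: "a \<in> carrier G" and c: "c \<in> carrier G" using mem1 mem2 ac by auto
    have "a [^] p \<otimes> c [^] p = \<one>" using x(2) pow_mult_distrib[OF m_comm[OF a c] a c] ac(3) by simp
    then have "c [^] p = inv (a [^] p)" using inv_equality[of "c [^] p" "a [^] p"] a c m_comm by simp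
    then have "c [^] p \<in> G1" using subgroup.m_inv_closed[OF sub(1) pow1[OF ac(1)]] by simp
    then have cp: "c [^] p = \<one>" using pow2[OF ac(2), of p] sub(3) by blast
    have cG2: "c [^] card G2 = \<one>"
      using K2.pow_order_eq_1[of c] ac(2) by (simp add: Coset.order_def nat_pow_consistent[symmetric])
    have "ord c dvd gcd p (card G2)" using pow_eq_id[OF c] cp cG2 by simp
    moreover have "gcd p (card G2) = 1"
      using cop p(2) by (metis coprime_commute coprime_divisors coprime_iff_gcd_eq_1 dvd_refl)
    ultimately have "c = \<one>" using ord_eq_1[OF c] by simp
    then show ?thesis using ac a by simp
  qed
  obtain z where z: "z \<in> G1" "\<And>x. x \<in> G1 \<Longrightarrow> \<exists>k::nat. x = z [^] k"
  proof -
    obtain z where z: "z \<in> G1" "G1 = range (\<lambda>n::int. z [^]\<^bsub>G\<lparr>carrier := G1\<rparr>\<^esub> n)"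
      using cyc unfolding K1.cyclic_group by (auto simp del: image_iff)
    have zc: "z \<in> carrier G" by (rule mem1[OF z(1)])
    have "\<exists>k::nat. x = z [^] k" if "x \<in> G1" for x
    proof -
      have "x \<in> range (\<lambda>n::int. z [^]\<^bsub>G\<lparr>carrier := G1\<rparr>\<^esub> n)" using z(2) that by simp
      then obtain n :: int where "x = z [^]\<^bsub>G\<lparr>carrier := G1\<rparr>\<^esub> n" by (rule rangeE)
      then have xn: "x = z [^] n" using int_pow_consistent[OF sub(1) z(1)] by simp
      define o' where "o' = int (ord z)"
      have o': "o' > 0" using ord_ge_1[OF fin zc] by (simp add: o'_def)
      have "z [^] n = z [^] (n mod o')"
      proof -
        have "z [^] n = z [^] (o' * (n div o') + n mod o')" by simp
        also have "\<dots> = z [^] (o' * (n div o')) \<otimes> z [^] (n mod o')" by (rule int_pow_mult[OF zc])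
        also have "z [^] (o' * (n div o')) = (z [^] o') [^] (n div o')" by (rule int_pow_pow[OF zc, symmetric])
        also have "z [^] o' = \<one>" using pow_ord_eq_1[OF zc] by (simp add: o'_def int_pow_int)
        finally show ?thesis using zc by simp
      qed
      also have "\<dots> = z [^] nat (n mod o')" using o' by (simp add: int_pow_int[symmetric])
      finally show ?thesis using xn by auto
    qed
    then show thesis using that z(1) by blast
  qed
  have zc: "z \<in> carrier G" by (rule mem1[OF z(1)])
  obtain a a' :: nat where a: "g = z [^] a" "g' = z [^] a'"
    using z(2)[OF in_G1[OF g(1,2)]] z(2)[OF in_G1[OF g']] by auto
  define o' where "o' = ord z"
  have o': "o' > 0" using ord_ge_1[OF fin zc] by (simp add: o'_def)
  have dvd: "o' dvd a * p" "o' dvd a' * p" and ndvd: "\<not> o' dvd a"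
    using pow_eq_id[OF zc, of "a * p"] pow_eq_id[OF zc, of "a' * p"] pow_eq_id[OF zc, of a] g g' a
    by (simp_all add: o'_def nat_pow_pow[OF zc])
  have "p dvd o'"
  proof (rule ccontr)
    assume "\<not> p dvd o'"
    then have "coprime o' p" using prime_imp_coprime[OF p(1)] coprime_commute by blast
    then show False using dvd(1) ndvd coprime_dvd_mult_left_iff by blast
  qed
  then obtain l where l: "o' = p * l" by (rule dvdE)
  have p0: "p > 0" using prime_gt_0_nat[OF p(1)] .
  have "l dvd a" "l dvd a'" using dvd p0 unfolding l by (simp_all add: mult.commute[of _ p])
  then obtain u u' where u: "a = l * u" "a' = l * u'" by (elim dvdE)
  have "\<not> p dvd u" using ndvd unfolding l u(1) by (metis dvd_refl mult.commute mult_dvd_mono)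
  then have "coprime u p" using prime_imp_coprime[OF p(1)] coprime_commute by blast
  then obtain w where w: "[u * w = 1] (mod p)" using cong_solve_coprime_nat by auto
  have "[u * (w * u') = u'] (mod p)" using cong_scalar_right[OF w, of u'] by (simp add: mult.assoc)
  then have "[l * (u * (w * u')) = l * u'] (mod (l * p))" by (rule cong_cmult_leftI)
  then have "[a * (w * u') = a'] (mod o')" by (simp add: u l mult_ac)
  then have "[int (a * (w * u')) = int a'] (mod int o')" by (simp only: cong_int_iff)
  then have "z [^] int (a * (w * u')) = z [^] int a'"
    unfolding int_pow_eq[OF zc] cong_iff_dvd_diff o'_def by (metis dvd_minus_iff minus_diff_eq)
  then have "z [^] (a * (w * u')) = z [^] a'" by (simp only: int_pow_int)
  then show ?thesis using a nat_pow_pow[OF zc, of a "w * u'"] by (intro exI[of _ "w * u'"]) simp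
qed

theorem theorem4p3:
  fixes G :: "('a, 'b) monoid_scheme" and d N :: nat
    and F :: cpoly and \<rho> :: "'a \<Rightarrow> complex mat set" and G1 G2 :: "'a set"
  assumes "d \<ge> 3" and "N \<ge> 3"
    and "comm_group G" and "finite (carrier G)"
    and "form N d F" and "smooth N F"
    and "linear_action G N F \<rho>" and "faithful G \<rho>" and "liftable G N \<rho>"
    and "direct_sum_decomp G G1 G2"
    and "cyclic_group (G\<lparr>carrier := G1\<rparr>)"
    and "coprime (card G2) (d - 1)"
  shows "(\<exists>N0 F0 C. 1 \<le> N0 \<and> N0 \<le> N \<and> simple_components d N0 F0 C \<and>
            card (T_ge2_components d C) \<le> 1 \<and> iso_to_subgroup G (diag_aut_group N0 F0)) \<and>
         (gcd (card (carrier G)) (d - 1) \<noteq> 1 \<longrightarrow>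
          (\<exists>N0 F0 C. 1 \<le> N0 \<and> N0 \<le> N \<and> simple_components d N0 F0 C \<and>
            card (T_ge2_components d C) = 1 \<and> iso_to_subgroup G (diag_aut_group N0 F0)))"
proof -
  interpret comm_group G by (rule assms(3))
  have N1: "N \<ge> 1" using assms(2) by simp
  obtain lam chi where sys: "eigen_system G N d lam chi"
    using eigencharacters[OF assms(1) N1 assms(3-9)] by (elim exE)
  interpret E: eigen_system G N d lam chi by (rule sys)
  define m where "m = card (carrier G)"
  have m: "m > 0" using assms(4) one_closed by (auto simp: m_def card_gt_0_iff)
  show ?thesis
  proof (cases "gcd (card (carrier G)) (d - 1) = 1")
    case True
    then have "coprime (card (carrier G)) (d - 1)" by (simp add: coprime_iff_gcd_eq_1)
    from E.embedding_coprime_order[OF this] True show ?thesis by simp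
  next
    case False
    have "d - 1 > 0" using assms(1) by simp
    then obtain h t where ht: "coprime h (d - 1)" "m dvd h * (d - 1) ^ t"
      using dvd_coprime_times_power[OF m] by metis
    define ok where "ok s \<longleftrightarrow> (\<forall>g\<in>carrier G. g [^]\<^bsub>G\<^esub> (h * (d - 1) ^ s) = \<one>\<^bsub>G\<^esub>)" for s
    have "ok t" unfolding ok_def
    proof
      fix g assume g: "g \<in> carrier G"
      obtain k where "h * (d - 1) ^ t = m * k" using ht(2) by (rule dvdE)
      then have "g [^]\<^bsub>G\<^esub> (h * (d - 1) ^ t) = (g [^]\<^bsub>G\<^esub> m) [^]\<^bsub>G\<^esub> k" using g by (simp add: nat_pow_pow)
      then show "g [^]\<^bsub>G\<^esub> (h * (d - 1) ^ t) = \<one>\<^bsub>G\<^esub>"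
        using pow_order_eq_1[OF g] by (simp add: Coset.order_def m_def)
    qed
    define s where "s = (LEAST s. ok s)"
    have ok_s: "ok s" unfolding s_def by (rule LeastI[of ok, OF \<open>ok t\<close>])
    obtain p where p: "prime p" "p dvd gcd (card (carrier G)) (d - 1)" using False prime_factor_nat by blast
    obtain a where a: "a \<in> carrier G" "a [^]\<^bsub>G\<^esub> p = \<one>\<^bsub>G\<^esub>" "a \<noteq> \<one>\<^bsub>G\<^esub>"
      using element_of_prime_order[OF assms(4) p(1)] p(2) by auto
    have s1: "s \<ge> 1"
    proof (rule ccontr)
      assume "\<not> s \<ge> 1"
      then have "ok 0" using ok_s by (cases s) simp_all
      then have "a [^]\<^bsub>G\<^esub> h = \<one>\<^bsub>G\<^esub>" using a(1) by (simp add: ok_def)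
      then have "ord a dvd gcd h p" using pow_eq_id[OF a(1)] a(2) by simp
      moreover have "gcd h p = 1" using ht(1) p(2)
        by (metis coprime_divisors coprime_iff_gcd_eq_1 dvd_refl gcd_greatest_iff)
      ultimately show False using ord_eq_1[OF a(1)] a(3) by simp
    qed
    then have "\<not> ok (s - 1)" using not_less_Least[of "s - 1" ok] by (simp add: s_def)
    then obtain g0 where g0: "g0 \<in> carrier G" "g0 [^]\<^bsub>G\<^esub> (h * (d - 1) ^ (s - 1)) \<noteq> \<one>\<^bsub>G\<^esub>"
      by (auto simp: ok_def)
    interpret EM: eigen_system_mod G N d lam chi h "(d - 1) ^ s"
      by unfold_locales (use ht(1) ok_s in \<open>auto simp: ok_def\<close>)
    have "\<exists>N0 F0 C. 1 \<le> N0 \<and> N0 \<le> N \<and> simple_components d N0 F0 C \<and>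
            card (T_ge2_components d C) = 1 \<and> iso_to_subgroup G (diag_aut_group N0 F0)"
      by (rule EM.embedding_with_path[OF s1 refl g0])
        (rule prime_torsion_cyclic[OF assms(4,10,11,12)])
    then show ?thesis by (metis order_refl)
  qed
qed

end
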